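(* With the notation below, there exist an integer $\ell_0\ge 4$ and a constant $\rho>0$ such that, for each integer $\ell\ge \ell_0$, the following properties hold. \begin{itemize} \item[(i)] For any $v\in\mathcal{V}_\ell$ and any $\mathbf{q}\in\mathcal{A}(\epsilon)$, we have \[ L_{\mathbf{x}(v)}(\mathbf{q})=\rho P_v(\rho^{-1}\mathbf{q})+\mathcal{O}_\xi(1), \] where $\mathcal{O}_\xi(1)$ denotes a function of $v$ and $\mathbf{q}$ whose absolute value is bounded above by a constant that depends only on $\xi$. \item[(ii)] For any triple of consecutive elements $u<v<w$ of $\mathcal{V}_\ell$, the points $\mathbf{x}(u)$, $\mathbf{x}(v)$, $\mathbf{x}(w)$ are linearly independent if and only if $v\notin\mathcal{V}_{\ell+1}$. \end{itemize}
   Context: For a real matrix $A$, $\|A\|$ denotes the maximum of the absolute values of its entries. Fix an integer $m\ge 1$ and let $M=\begin{pmatrix} m &1\\ -1 &0\end{pmatrix}$. A real number $\xi$ belongs to $\mathcal{E}_m$ if there exist a sequence $(W_i)_{i\ge 1}$ in $\mathrm{GL}_2(\mathbb{Z})$, unbounded and satisfying $W_{i+2}=W_{i+1}W_i$ for all $i\ge1$, and a constant $c\ge 1$ such that for each $i\ge 1$: (E1) $\mathbf{x}_i:=W_iM_i^{-1}$ is symmetric, where $M_i=M$ if $i$ is even and $M_i={}^tM$ if $i$ is odd; (E2) $c^{-1}\|W_{i+1}\|\,\|W_i\|\le\|W_{i+2}\|\le c\|W_{i+1}\|\,\|W_i\|$; (E3) $c^{-1}\|W_i\|^{-1}\le\|(\xi,-1)W_i\|\le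 c\|W_i\|^{-1}$. Fix $\xi\in\mathcal{E}_m$ with such a sequence $(W_i)_{i\ge1}$, and set $\boldsymbol{\xi}=(1,\xi,\xi^2)$. Let $E=\{a,b\}$, $E^*$ the monoid of words on $E$ (concatenation, empty word $\epsilon$); $u\le w$ means $u$ is a prefix of $w$, and $u<w$ means $u\le w$, $u\neq w$. Let $w_1=a$, $w_2=ab$, $w_{i+2}=w_{i+1}w_i$, and $w_\infty=\lim w_i$; "prefix of $w_\infty$" means prefix of some $w_i$. Let $F_{-1}=0$, $F_0=1$, $F_{i+2}=F_{i+1}+F_i$, so $|w_i|=F_i$. Let $\mathcal{F}=\{\epsilon,w_1,w_2,\dots\}$. For a prefix $v$ of $w_\infty$: $\iota(v)=v$ if $v\in\mathcal{F}$; otherwise $w_i<v<w_{i+1}$ for some $i\ge 3$ and $\iota(v)$ is the prefix of $w_\infty$ of length $|v|-2F_{i-2}$. Let $\alpha(v)=\lim_{k\to\infty}\iota^k(v)\in\mathcal{F}$ (the sequence is eventually constant). For $\ell\ge1$, $\mathcal{V}_\ell=\{v \text{ prefix of } w_\infty\,;\,\alpha(v)\ge w_\ell\}$; elements $u<v<w$ of $\mathcal{V}_\ell$ are consecutive if no element of $\mathcal{V}_\ell$ lies strictly between $u$ and $v$ or between $v$ and $w$. For a prefix $v$ of $w_\infty$, $P_v(q_1,q_2)=\max\{q_1-|v|,\,q_2-|\alpha(v)|,\,|v|\}$, and $\mathcal{A}(\epsilon)=\{(q_1,q_2)\in\mathbb{R}^2\,;\,q_1\ge 0,\ q_2\le q_1\}$.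 Set $W_0=W_1^{-1}W_2$ and let $\varphi\colon E^*\to\mathrm{GL}_2(\mathbb{Z})$ be the monoid morphism with $\varphi(b)=W_0$, $\varphi(a)=W_1$ (so $\varphi(w_i)=W_i$). For a non-empty word $v$, $M(v)=M$ if $v$ ends in $b$ and $M(v)={}^tM$ if $v$ ends in $a$. Let $\mathbf{x}(v)=\begin{pmatrix} x_0(v)&x_1(v)\\ x_1(v)&x_2(v)\end{pmatrix}$ be the symmetric integer matrix having the same first column as $\varphi(v)M(v)^{-1}$ and with $|x_1(v)\xi-x_2(v)|<1/2$; it is identified with the point $(x_0(v),x_1(v),x_2(v))\in\mathbb{Z}^3$. Its trajectory is \[ L_{\mathbf{x}(v)}(\mathbf{q})=\max\{\log|x_0(v)|,\ q_1+\log|x_0(v)\xi-x_1(v)|,\ q_2+\log|x_0(v)\xi^2-x_2(v)|\}\] for $\mathbf{q}=(q_1,q_2)\in\mathbb{R}^2$ (terms with $\log 0$ omitted). *)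

theory Defs
  imports
    "HOL-Analysis.Analysis"
    "HOL-Library.Sublist"
    "HOL-Number_Theory.Fib"
begin

definition max_norm :: "real^'n^'m \<Rightarrow> real" where
  "max_norm A = Max (range (\<lambda>(i, j). \<bar>A $ i $ j\<bar>))"

abbreviation real_mat :: "int^'n^'m \<Rightarrow> real^'n^'m" where
  "real_mat \<equiv> map_matrix real_of_int"

definition base_mat :: "int \<Rightarrow> int^2^2" where
  "base_mat m = vector [vector [m, 1], vector [- 1, 0]]"

definition base_mat_seq :: "int \<Rightarrow> nat \<Rightarrow> int^2^2" where
  "base_mat_seq m i = (if even i then base_mat m else transpose (base_mat m))"

text \<open>A real number \<open>\<xi>\<close> belongs to \<open>\<E>\<^sub>m\<close> iff there is a sequence \<open>W\<close> with
  \<open>admissible_seq m \<xi> W\<close>. The matrices are indexed from 1: the value \<open>W 0\<close> is never used.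
  Over \<open>int\<close>, \<open>invertible\<close> means invertible with an integral inverse, i.e.\ membership
  in \<open>GL\<^sub>2(\<int>)\<close>.\<close>

definition admissible_seq :: "int \<Rightarrow> real \<Rightarrow> (nat \<Rightarrow> int^2^2) \<Rightarrow> bool" where
  "admissible_seq m \<xi> W \<longleftrightarrow>
     (\<forall>i\<ge>1. invertible (W i)) \<and>
     (\<forall>B. \<exists>i\<ge>1. max_norm (real_mat (W i)) > B) \<and>
     (\<forall>i\<ge>1. W (i + 2) = W (i + 1) ** W i) \<and>
     (\<exists>c::real. c \<ge> 1 \<and> (\<forall>i\<ge>1.
        transpose (W i ** matrix_inv (base_mat_seq m i)) = W i ** matrix_inv (base_mat_seq m i) \<and>
        inverse c * (max_norm (real_mat (W (i + 1))) * max_norm (real_mat (W i)))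
          \<le> max_norm (real_mat (W (i + 2))) \<and>
        max_norm (real_mat (W (i + 2)))
          \<le> c * (max_norm (real_mat (W (i + 1))) * max_norm (real_mat (W i))) \<and>
        inverse c * inverse (max_norm (real_mat (W i)))
          \<le> max_norm (rowvector (vector [\<xi>, - 1] :: real^2) ** real_mat (W i) :: real^2^1) \<and>
        max_norm (rowvector (vector [\<xi>, - 1] :: real^2) ** real_mat (W i) :: real^2^1)
          \<le> c * inverse (max_norm (real_mat (W i)))))"

datatype letter = LetterA | LetterB

text \<open>The Fibonacci words \<open>w\<^sub>1 = a\<close>, \<open>w\<^sub>2 = ab\<close>, \<open>w\<^sub>i\<^sub>+\<^sub>2 = w\<^sub>i\<^sub>+\<^sub>1 w\<^sub>i\<close>; extending the recursion
  downwards gives \<open>w\<^sub>0 = b\<close>, which is not one of the words of the set \<open>fib_words\<close>.\<close>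

fun fib_word :: "nat \<Rightarrow> letter list" where
  "fib_word 0 = [LetterB]"
| "fib_word (Suc 0) = [LetterA]"
| "fib_word (Suc (Suc i)) = fib_word (Suc i) @ fib_word i"

text \<open>The library's \<open>fib\<close> starts with \<open>fib 0 = 0\<close>, \<open>fib 1 = 1\<close>; here \<open>F\<^sub>-\<^sub>1 = 0\<close>, \<open>F\<^sub>0 = 1\<close>.\<close>

abbreviation fib_len :: "nat \<Rightarrow> nat" where
  "fib_len i \<equiv> fib (Suc i)"

definition fib_words :: "letter list set" where
  "fib_words = insert [] (fib_word ` {1..})"

definition prefix_w_inf :: "letter list \<Rightarrow> bool" where
  "prefix_w_inf v \<longleftrightarrow> (\<exists>i\<ge>1. prefix v (fib_word i))"

text \<open>The next function is meaningful on prefixes \<open>v\<close> of \<open>w\<^sub>\<infinity>\<close> only; for these, the prefix of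
  \<open>w\<^sub>\<infinity>\<close> of a given length \<open>\<le> |v|\<close> is the prefix of \<open>v\<close> of that length.\<close>

definition iota :: "letter list \<Rightarrow> letter list" where
  "iota v = (if v \<in> fib_words then v
     else (let i = (THE i. i \<ge> 3 \<and> strict_prefix (fib_word i) v \<and> strict_prefix v (fib_word (i + 1)))
           in take (length v - 2 * fib_len (i - 2)) v))"

text \<open>The limit, in the discrete topology, of the eventually constant sequence of iterates.\<close>

definition alpha :: "letter list \<Rightarrow> letter list" where
  "alpha v = (THE u. \<forall>\<^sub>F k in sequentially. (iota ^^ k) v = u)"

definition V_set :: "nat \<Rightarrow> letter list set" where
  "V_set l = {v. prefix_w_inf v \<and> prefix (fib_word l) (alpha v)}"

definition consecutive :: "letter list set \<Rightarrow> letter list \<Rightarrow> letter list \<Rightarrow> letter list \<Rightarrow> bool" where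
  "consecutive V u v w \<longleftrightarrow>
     u \<in> V \<and> v \<in> V \<and> w \<in> V \<and> strict_prefix u v \<and> strict_prefix v w \<and>
     \<not> (\<exists>z\<in>V. strict_prefix u z \<and> strict_prefix z v) \<and>
     \<not> (\<exists>z\<in>V. strict_prefix v z \<and> strict_prefix z w)"

definition P_fun :: "letter list \<Rightarrow> real \<times> real \<Rightarrow> real" where
  "P_fun v q = Max {fst q - real (length v), snd q - real (length (alpha v)), real (length v)}"

definition A_empty :: "(real \<times> real) set" where
  "A_empty = {(q1, q2). q1 \<ge> 0 \<and> q2 \<le> q1}"

text \<open>The monoid morphism given by \<open>a \<mapsto> W\<^sub>1\<close> and \<open>b \<mapsto> W\<^sub>0 = W\<^sub>1\<^sup>-\<^sup>1 W\<^sub>2\<close>.\<close>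

definition phi :: "(nat \<Rightarrow> int^2^2) \<Rightarrow> letter list \<Rightarrow> int^2^2" where
  "phi W v = foldr (\<lambda>x P. (case x of LetterA \<Rightarrow> W 1 | LetterB \<Rightarrow> matrix_inv (W 1) ** W 2) ** P)
     v (mat 1)"

definition end_mat :: "int \<Rightarrow> letter list \<Rightarrow> int^2^2" where
  "end_mat m v = (if last v = LetterB then base_mat m else transpose (base_mat m))"

definition x_mat :: "int \<Rightarrow> real \<Rightarrow> (nat \<Rightarrow> int^2^2) \<Rightarrow> letter list \<Rightarrow> int^2^2" where
  "x_mat m \<xi> W v = (THE X. transpose X = X \<and>
     column 1 X = column 1 (phi W v ** matrix_inv (end_mat m v)) \<and>
     \<bar>real_of_int (X $ 1 $ 2) * \<xi> - real_of_int (X $ 2 $ 2)\<bar> < 1 / 2)"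

text \<open>The integer point \<open>(x\<^sub>0, x\<^sub>1, x\<^sub>2)\<close>, viewed in \<open>\<real>\<^sup>3\<close>.\<close>

definition x_point :: "int \<Rightarrow> real \<Rightarrow> (nat \<Rightarrow> int^2^2) \<Rightarrow> letter list \<Rightarrow> real^3" where
  "x_point m \<xi> W v = (let X = x_mat m \<xi> W v in
     vector [real_of_int (X $ 1 $ 1), real_of_int (X $ 1 $ 2), real_of_int (X $ 2 $ 2)])"

text \<open>Since \<open>ln 0 = 0\<close> in the library, the terms with \<open>log 0\<close> have to be left out explicitly.\<close>

definition trajectory :: "real \<Rightarrow> real^3 \<Rightarrow> real \<times> real \<Rightarrow> real" where
  "trajectory \<xi> x q = Max {t + ln \<bar>y\<bar> | t y. y \<noteq> 0 \<and>
     (t, y) \<in> {(0, x $ 1), (fst q, x $ 1 * \<xi> - x $ 2), (snd q, x $ 1 * \<xi>\<^sup>2 - x $ 3)}}"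

text \<open>Linear independence of a family of three vectors; \<open>independent\<close> alone concerns the underlying
  set and ignores repetitions.\<close>

definition lin_indep3 :: "real^3 \<Rightarrow> real^3 \<Rightarrow> real^3 \<Rightarrow> bool" where
  "lin_indep3 x y z \<longleftrightarrow> distinct [x, y, z] \<and> independent {x, y, z}"

end

theory Submission
  imports Defs
begin

text \<open>
  Words are replaced by their lengths: a prefix of \<open>w\<^sub>\<infinity>\<close> of length \<open>n\<close> is \<open>pre n\<close>, and
  \<open>\<V>\<^sub>l\<close> becomes the set \<open>S\<^sub>l\<close> of the \<open>n\<close> of level at least \<open>l\<close>. Between \<open>F\<^bsub>i+3\<^esub>\<close> and \<open>F\<^bsub>i+4\<^esub>\<close>
  the set \<open>S\<^sub>l\<close> is a translate by \<open>2F\<^bsub>i+1\<^esub>\<close> of a shorter piece of itself. By induction, consecutive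
  gaps of \<open>S\<^sub>l\<close> are \<open>F\<^bsub>l-1\<^esub>\<close> or \<open>F\<^bsub>l-2\<^esub>\<close>, the two gaps at a point are equal iff the point lies in
  \<open>S\<^bsub>l+1\<^esub>\<close>, all Zeckendorf digits of elements of \<open>S\<^sub>l\<close> have index at least \<open>l - 3\<close>, and
  the matrix of the word in a gap \<open>F\<^sub>k\<close> is \<open>\<x>\<^sub>k\<close> times \<open>M\<close> or its transpose.

  Hence Cayley-Hamilton gives \<open>\<x>(w) = m x\<^sub>0(k) \<x>(v) \<plusminus> \<x>(u)\<close> at points with equal gaps: first
  for the first two coordinates, then for the third because it is a nearest integer and the errors
  are small. Through these relations the determinant of a triple whose middle point \<open>v\<close> has exact
  level \<open>l\<close> is, up to sign, carried to the determinant of \<open>\<x>\<^sub>i, \<x>\<^bsub>i+1\<^esub>, \<x>\<^bsub>i+2\<^esub>\<close> for some \<open>i\<close>,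
  which is \<open>\<plusminus> 2\<close>. That proves (ii), and expanding the determinant also gives the two-sided
  estimate of \<open>|x\<^sub>1 \<xi> - x\<^sub>2|\<close>. The estimates of \<open>x\<^sub>0\<close> multiply out along Zeckendorf
  expansions, with summable relative errors because the digits are distinct and large, and those of
  \<open>x\<^sub>0 \<xi> - x\<^sub>1\<close> follow by telescoping \<open>\<xi> - x\<^sub>1 / x\<^sub>0\<close> along \<open>S\<^sub>l\<close>.
\<close>

section \<open>Prefixes of the Fibonacci word and their levels\<close>

text \<open>The obstacle is a circle. The relation for third coordinates holds only while the errors
  \<open>\<theta> n\<close>, that is x_1 \<xi> - x_2, are small; their bound is read off a
  determinant of absolute value 2; and this determinant is carried along by those very relations. To
  evaluate it at a point n of exact level l both neighbours must be under control, and the right one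
  is larger than n. But both neighbours lie in S_(l+1). So the circle is cut by a nested induction
  inside a window bounded by a Fibonacci number: downwards over the levels, and within one level
  upwards over n.

  The number \<rho> arises because m x_0 is almost multiplicative along w_(i+2) = w_(i+1) w_i: ln (m
  |x_0|) obeys the Fibonacci recursion up to an exponentially small error, hence equals \<rho> F_i
  up to a summable error. Boundedness of that error would not suffice, since the number of
  Zeckendorf digits is unbounded. For the same reason the size of x_0 is not followed from gap to
  gap of S_l, where an error would be added at each of the many gaps.

  Levels are written d + 3, so that all indices down to l - 3 stay natural numbers.\<close>

lemma fib_len_rec: "fib_len (i + 2) = fib_len (i + 1) + fib_len i"
  by simp

lemma fib_len_pos [simp]: "0 < fib_len i"
  by (simp add: fib_neq_0_nat)

lemma fib_len_mono: "i \<le> j \<Longrightarrow> fib_len i \<le> fib_len j"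
  by (simp add: fib_mono)

lemma fib_len_strict_mono: "1 \<le> i \<Longrightarrow> i < j \<Longrightarrow> fib_len i < fib_len j"
proof -
  assume "1 \<le> i" "i < j"
  then have "fib_len i < fib_len (Suc i)" using fib_len_pos[of "i - 1"] by (cases i) auto
  also have "\<dots> \<le> fib_len j" using \<open>i < j\<close> by (intro fib_len_mono) auto
  finally show ?thesis .
qed

lemma fib_len_less_iff: "1 \<le> i \<Longrightarrow> fib_len i < fib_len j \<longleftrightarrow> i < j"
  by (meson fib_len_mono fib_len_strict_mono leD leI)

lemma fib_len_ge: "i \<le> fib_len i"
proof (induction i rule: fib.induct)
  case (3 n)
  have "0 < fib_len n" by (rule fib_len_pos)
  then show ?case using 3 by (simp del: fib_len_pos)
qed auto

lemma fib_len_interval: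
  assumes "1 \<le> n"
  obtains i where "1 \<le> i" "fib_len i \<le> n" "n < fib_len (i + 1)"
proof -
  let ?i = "Greatest (\<lambda>i. fib_len i \<le> n)"
  have b: "fib_len j \<le> n \<Longrightarrow> j \<le> n" for j using fib_len_ge le_trans by blast
  have "fib_len 1 \<le> n" using assms by simp
  with b have "fib_len ?i \<le> n" "1 \<le> ?i"
    by (metis (mono_tags, lifting) GreatestI_ex_nat, metis (mono_tags, lifting) Greatest_le_nat)
  moreover have "n < fib_len (?i + 1)"
    by (metis (mono_tags, lifting) Greatest_le_nat b leI less_add_one not_less)
  ultimately show ?thesis using that by blast
qed

lemma fib_len_interval_unique:
  assumes "fib_len i \<le> n" "n < fib_len (i + 1)" "fib_len j \<le> n" "n < fib_len (j + 1)" "1 \<le> i" "1 \<le> j"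
  shows "i = j"
  using assms fib_len_less_iff[of i "j+1"] fib_len_less_iff[of j "i+1"] by linarith

lemma length_fib_word: "length (fib_word i) = fib_len i"
  by (induction i rule: fib_word.induct) auto

lemma prefix_fib_word_Suc: "1 \<le> i \<Longrightarrow> prefix (fib_word i) (fib_word (Suc i))"
  by (cases i) auto

lemma prefix_fib_word: "1 \<le> i \<Longrightarrow> i \<le> j \<Longrightarrow> prefix (fib_word i) (fib_word j)"
proof (induction j)
  case (Suc j)
  show ?case
  proof (cases "i = Suc j")
    case False
    then show ?thesis using Suc prefix_fib_word_Suc[of j] prefix_order.trans by fastforce
  qed auto
qed auto

text \<open>The index \<open>Suc n\<close> is at least 1, and \<open>fib_word (Suc n)\<close> has at
  least \<open>n\<close> letters, so nothing is cut short and the result is a prefix of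
  w_infinity.\<close>

definition pre :: "nat \<Rightarrow> letter list" where
  "pre n = take n (fib_word (Suc n))"

lemma take_prefix: "prefix xs ys \<Longrightarrow> n \<le> length xs \<Longrightarrow> take n ys = take n xs"
  by (auto simp: prefix_def)

lemma length_pre [simp]: "length (pre n) = n"
  using fib_len_ge[of "Suc n"] by (auto simp: pre_def length_fib_word)

lemma take_fib_word: 
  assumes "1 \<le> i" "n \<le> fib_len i"
  shows "take n (fib_word i) = pre n"
proof (cases "i \<le> Suc n")
  case True
  then show ?thesis using take_prefix[OF prefix_fib_word[of i "Suc n"]] assms
    by (simp add: pre_def length_fib_word)
next
  case False
  have "n \<le> fib_len (Suc n)" using fib_len_ge[of "Suc n"] by simp
  then show ?thesis using take_prefix[OF prefix_fib_word[of "Suc n" i], of n] False assms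
    unfolding pre_def length_fib_word by simp
qed

lemma pre_fib_len: "1 \<le> i \<Longrightarrow> pre (fib_len i) = fib_word i"
  by (metis length_fib_word order_refl take_all take_fib_word)

lemma take_pre: "k \<le> n \<Longrightarrow> take k (pre n) = pre k"
proof -
  assume "k \<le> n"
  have "n \<le> fib_len (Suc n)" using fib_len_ge[of "Suc n"] by linarith
  have "take k (pre n) = take k (fib_word (Suc n))" using \<open>k \<le> n\<close> by (simp add: pre_def min_def)
  also have "\<dots> = pre k" by (rule take_fib_word) (use \<open>k \<le> n\<close> \<open>n \<le> fib_len (Suc n)\<close> in auto)
  finally show ?thesis .
qed

lemma prefix_pre_iff: "prefix (pre a) (pre b) \<longleftrightarrow> a \<le> b"
  by (metis length_pre prefix_length_le take_is_prefix take_pre)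

lemma strict_prefix_pre_iff: "strict_prefix (pre a) (pre b) \<longleftrightarrow> a < b"
  unfolding strict_prefix_def prefix_pre_iff by (metis length_pre nat_less_le)

lemma prefix_w_inf_iff: "prefix_w_inf v \<longleftrightarrow> v = pre (length v)"
proof
  assume "prefix_w_inf v"
  then obtain i where i: "1 \<le> i" "prefix v (fib_word i)" by (auto simp: prefix_w_inf_def)
  then have "v = take (length v) (fib_word i)" by (auto simp: prefix_def)
  also have "\<dots> = pre (length v)"
    using i by (intro take_fib_word) (auto dest: prefix_length_le simp: length_fib_word)
  finally show "v = pre (length v)" .
next
  assume "v = pre (length v)"
  then show "prefix_w_inf v" unfolding prefix_w_inf_def pre_def
    by (metis One_nat_def Suc_le_mono le0 take_is_prefix)
qed

text \<open>In w_(i+1) = w_i w_(i-1) the second factor is again a prefix of w_infinity as soon as i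
  - 1 is positive; w_0 = b is not one.\<close>

lemma pre_add:
  assumes "2 \<le> i" "q \<le> fib_len (i - 1)"
  shows "pre (fib_len i + q) = fib_word i @ pre q"
proof -
  obtain j where j: "i = Suc j" "1 \<le> j" using assms(1) by (cases i) auto
  have "pre (fib_len i + q) = take (fib_len i + q) (fib_word (Suc i))"
    by (rule take_fib_word[symmetric]) (use assms j in auto)
  also have "\<dots> = fib_word i @ take q (fib_word j)"
    using length_fib_word[of i] j by simp
  also have "take q (fib_word j) = pre q" using assms j by (intro take_fib_word) auto
  finally show ?thesis .
qed

text \<open>\<open>level n l\<close> encodes \<alpha>(v) = w_l for the prefix v of length
  \<open>n\<close>. The clause \<open>step\<close> runs one application of \<iota> backwards, so
  facts about \<alpha> become inductions without limits or definite descriptions.\<close>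

inductive level :: "nat \<Rightarrow> nat \<Rightarrow> bool" where
  base: "1 \<le> l \<Longrightarrow> level (fib_len l) l"
| step: "level n l \<Longrightarrow> fib_len i < n \<Longrightarrow> n < fib_len (i + 2) + fib_len i \<Longrightarrow>
    level (n + 2 * fib_len (i + 1)) l"

lemma pre_in_fib_words_iff: "pre n \<in> fib_words \<longleftrightarrow> n = 0 \<or> (\<exists>i\<ge>1. n = fib_len i)"
proof -
  have "pre n \<in> fib_words \<longleftrightarrow> pre n = [] \<or> (\<exists>i\<ge>1. pre n = fib_word i)"
    unfolding fib_words_def by auto
  also have "\<dots> \<longleftrightarrow> n = 0 \<or> (\<exists>i\<ge>1. n = fib_len i)"
    by (metis length_0_conv length_fib_word length_pre pre_fib_len)
  finally show ?thesis .
qed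

text \<open>Subtracting 2 F_(i+1), as \<iota> does, moves the ends F_(i+3) and F_(i+4) of a block to
  F_i and F_(i+2) + F_i.\<close>

lemma fib_len_shift_bounds:
  "fib_len (i + 3) = fib_len i + 2 * fib_len (i + 1)"
  "fib_len (i + 4) = fib_len (i + 2) + fib_len i + 2 * fib_len (i + 1)"
  by (simp_all add: numeral_eq_Suc)

lemma not_fib_len_between:
  assumes "fib_len i < n" "n < fib_len (i + 1)" "1 \<le> i"
  shows "pre n \<notin> fib_words"
proof
  assume "pre n \<in> fib_words"
  then obtain j where "1 \<le> j" "n = fib_len j" using assms by (auto simp: pre_in_fib_words_iff)
  then have "i < j" "j < i + 1"
    using assms fib_len_less_iff[of i j] fib_len_less_iff[of j "i + 1"] by auto
  then show False by simp
qed

lemma iota_pre_between: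
  assumes "fib_len (i + 3) < n" "n < fib_len (i + 4)"
  shows "iota (pre n) = pre (n - 2 * fib_len (i + 1))"
proof -
  have nf: "pre n \<notin> fib_words"
    by (rule not_fib_len_between[of "i + 3"]) (use assms in \<open>auto simp: numeral_eq_Suc\<close>)
  have sp: "strict_prefix (fib_word j) (pre n) \<and> strict_prefix (pre n) (fib_word (j + 1)) \<longleftrightarrow>
      fib_len j < n \<and> n < fib_len (j + 1)" if "3 \<le> j" for j
    using that pre_fib_len[of j] pre_fib_len[of "j + 1"]
      strict_prefix_pre_iff[of "fib_len j" n] strict_prefix_pre_iff[of n "fib_len (j + 1)"] by simp
  have "(THE j. 3 \<le> j \<and> strict_prefix (fib_word j) (pre n) \<and> strict_prefix (pre n) (fib_word (j + 1))) = i + 3"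
  proof (rule the_equality)
    show "3 \<le> i + 3 \<and> strict_prefix (fib_word (i + 3)) (pre n) \<and> strict_prefix (pre n) (fib_word (i + 3 + 1))"
      using sp[of "i + 3"] assms by (simp add: add.commute[of _ "Suc _"] numeral_eq_Suc)
    fix j assume j: "3 \<le> j \<and> strict_prefix (fib_word j) (pre n) \<and> strict_prefix (pre n) (fib_word (j + 1))"
    then have "fib_len j < n" "n < fib_len (j + 1)" using sp[of j] by auto
    then show "j = i + 3"
      using fib_len_interval_unique[of j n "i + 3"] assms j by (simp add: numeral_eq_Suc)
  qed
  moreover have "i + 3 - 2 = i + 1" by simp
  ultimately show ?thesis using nf unfolding iota_def
    by (simp only: Let_def length_pre if_False) (simp add: take_pre)
qed

lemma level_pos: "level n l \<Longrightarrow> 0 < n \<and> 1 \<le> l"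
  by (induction rule: level.induct) auto

lemma level_iterate: "level n l \<Longrightarrow> \<exists>K. \<forall>k\<ge>K. (iota ^^ k) (pre n) = fib_word l"
proof (induction rule: level.induct)
  case (base l)
  have fx: "iota (fib_word l) = fib_word l" using base by (auto simp: iota_def fib_words_def)
  have "(iota ^^ k) (fib_word l) = fib_word l" for k
    by (induction k) (simp_all add: fx)
  then show ?case using base pre_fib_len by auto
next
  case (step n l i)
  have "iota (pre (n + 2 * fib_len (i + 1))) = pre n"
    using iota_pre_between[of i "n + 2 * fib_len (i + 1)"] step
    unfolding fib_len_shift_bounds by simp
  moreover from step obtain K where "\<forall>k\<ge>K. (iota ^^ k) (pre n) = fib_word l" by blast
  ultimately have "\<forall>k\<ge>Suc K. (iota ^^ k) (pre (n + 2 * fib_len (i + 1))) = fib_word l"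
    by (metis Suc_le_D Suc_le_mono comp_apply funpow_Suc_right)
  then show ?case by blast
qed

lemma alpha_level: "level n l \<Longrightarrow> alpha (pre n) = fib_word l"
proof -
  assume "level n l"
  then obtain K where K: "\<forall>k\<ge>K. (iota ^^ k) (pre n) = fib_word l" using level_iterate by blast
  show ?thesis unfolding alpha_def
  proof (rule the_equality)
    show "\<forall>\<^sub>F k in sequentially. (iota ^^ k) (pre n) = fib_word l"
      using K by (auto simp: eventually_sequentially)
    fix u assume "\<forall>\<^sub>F k in sequentially. (iota ^^ k) (pre n) = u"
    then obtain K' where "\<forall>k\<ge>K'. (iota ^^ k) (pre n) = u" by (auto simp: eventually_sequentially)
    then show "u = fib_word l" using K by (metis nle_le)
  qed
qed

lemma alpha_Nil: "alpha [] = []"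
proof -
  have "(iota ^^ k) [] = []" for k by (induction k) (auto simp: iota_def fib_words_def)
  then show ?thesis unfolding alpha_def by (auto simp: eventually_sequentially)
qed

lemma level_unique: "level n l \<Longrightarrow> level n l' \<Longrightarrow> l = l'"
  by (metis alpha_level fib_len_interval_unique length_fib_word level_pos fib_len_less_iff
      nat_neq_iff)

lemma level_exists: "1 \<le> n \<Longrightarrow> \<exists>l. level n l"
proof (induction n rule: less_induct)
  case (less n)
  obtain i where i: "1 \<le> i" "fib_len i \<le> n" "n < fib_len (i + 1)"
    using fib_len_interval less.prems by blast
  show ?case
  proof (cases "n = fib_len i")
    case True then show ?thesis using i level.base by blast
  next
    case False
    \<comment> \<open>F_1, F_2, F_3 are 1, 2, 3, so no integer lies strictly between two of them
      that are adjacent.\<close>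
    have "3 \<le> i"
    proof (rule ccontr)
      assume "\<not> 3 \<le> i"
      then have "i = 1 \<or> i = 2" using i by auto
      then show False using i False by (auto simp: numeral_eq_Suc)
    qed
    then obtain j where j: "i = j + 3" by (metis add.commute le_Suc_ex)
    let ?n = "n - 2 * fib_len (j + 1)"
    have *: "fib_len j < ?n" "?n < fib_len (j + 2) + fib_len j" "n = ?n + 2 * fib_len (j + 1)"
      using i False fib_len_shift_bounds[of j] unfolding j by (auto simp: numeral_eq_Suc)
    have "?n < n" using *(3) fib_len_pos[of "j + 1"] by linarith
    then obtain l where "level ?n l" using less.IH[of ?n] * by force
    then show ?thesis using level.step[of ?n l j] * by auto
  qed
qed

definition level_set :: "nat \<Rightarrow> nat set" where
  "level_set l = {n. \<exists>k\<ge>l. level n k}"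

lemma prefix_fib_word_iff: "1 \<le> i \<Longrightarrow> 1 \<le> j \<Longrightarrow> prefix (fib_word i) (fib_word j) \<longleftrightarrow> i \<le> j"
  by (metis fib_len_less_iff leI length_fib_word linorder_not_le prefix_fib_word prefix_length_le)

lemma V_set_eq: 
  assumes "1 \<le> l" shows "V_set l = pre ` level_set l"
proof -
  have mem: "pre n \<in> V_set l \<longleftrightarrow> n \<in> level_set l" for n
  proof (cases "n = 0")
    \<comment> \<open>The empty prefix is fixed by \<iota>, so its \<alpha> is empty and does not
      start with w_l. It has no level.\<close>
    case True
    have "pre 0 = []" by (simp add: pre_def)
    moreover have "fib_word l \<noteq> []" using length_fib_word[of l] fib_len_pos[of l] by (metis list.size(3) less_irrefl)
    moreover have "\<not> level 0 k" for k using level_pos[of 0 k] by auto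
    ultimately show ?thesis using True
      by (simp add: V_set_def level_set_def alpha_Nil)
  next
    case False
    then obtain k where k: "level n k" using level_exists[of n] by auto
    have "prefix_w_inf (pre n)" unfolding prefix_w_inf_iff by (simp only: length_pre)
    then have "pre n \<in> V_set l \<longleftrightarrow> prefix (fib_word l) (fib_word k)"
      by (simp add: V_set_def alpha_level[OF k])
    also have "\<dots> \<longleftrightarrow> l \<le> k" using assms level_pos[OF k] by (simp add: prefix_fib_word_iff)
    also have "\<dots> \<longleftrightarrow> n \<in> level_set l" using k level_unique unfolding level_set_def by blast
    finally show ?thesis .
  qed
  show ?thesis
  proof (intro subset_antisym subsetI)
    fix v assume v: "v \<in> V_set l"
    then obtain n where n: "v = pre n" using prefix_w_inf_iff unfolding V_set_def by blast
    then show "v \<in> pre ` level_set l" using mem[of n] v by auto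
  qed (use mem in blast)
qed

section \<open>Gaps between lengths of given level\<close>

lemma level_interior:
  assumes "fib_len (i + 3) < n" "n < fib_len (i + 4)"
  shows "level n l \<longleftrightarrow> level (n - 2 * fib_len (i + 1)) l"
proof
  assume "level n l"
  then show "level (n - 2 * fib_len (i + 1)) l"
  proof cases
    case base
    then show ?thesis using not_fib_len_between[of "i + 3" n] assms pre_in_fib_words_iff[of n]
      by (auto simp: numeral_eq_Suc)
  next
    case (step n' i')
    have "fib_len (i' + 3) < n" "n < fib_len (i' + 4)"
      using step fib_len_shift_bounds[of i'] by auto
    then have "i' + 3 = i + 3"
      using fib_len_interval_unique[of "i' + 3" n "i + 3"] assms by (simp add: numeral_eq_Suc)
    then show ?thesis using step by simp
  qed
next
  assume "level (n - 2 * fib_len (i + 1)) l"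
  from level.step[OF this, of i] show "level n l"
    using assms fib_len_shift_bounds[of i] by simp
qed

lemma fib_len_in_level_set: "1 \<le> j \<Longrightarrow> l \<le> j \<Longrightarrow> fib_len j \<in> level_set l"
  using level.base by (auto simp: level_set_def)

lemma level_set_interior:
  "fib_len (i + 3) < n \<Longrightarrow> n < fib_len (i + 4) \<Longrightarrow>
    n \<in> level_set l \<longleftrightarrow> n - 2 * fib_len (i + 1) \<in> level_set l"
  by (simp add: level_set_def level_interior)

lemma level_set_antimono: "l \<le> l' \<Longrightarrow> level_set l' \<subseteq> level_set l"
  unfolding level_set_def using le_trans by blast

lemma level_ge: "level n l \<Longrightarrow> fib_len l \<le> n"
  by (induction rule: level.induct) auto

lemma level_set_ge: "n \<in> level_set l \<Longrightarrow> fib_len l \<le> n"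
  unfolding level_set_def using level_ge fib_len_mono le_trans by blast

text \<open>This is the point to which the right end F_(i+4) of a block descends.\<close>

lemma level_fib_len_add: "level (fib_len (i + 2) + fib_len i) (i + 1)" if i: "1 \<le> i"
proof -
  obtain k where k: "i = k + 1" using i by (cases i) auto
  have "level (fib_len (k + 2) + 2 * fib_len (k + 1)) (k + 2)"
    by (rule level.step[OF level.base]) auto
  moreover have "fib_len (k + 2) + 2 * fib_len (k + 1) = fib_len (i + 2) + fib_len i"
    unfolding k by (simp add: numeral_eq_Suc)
  moreover have "k + 2 = i + 1" using k by simp
  ultimately show ?thesis by (simp only:)
qed

section \<open>Consecutive elements of S_l\<close>

definition consec :: "nat set \<Rightarrow> nat \<Rightarrow> nat \<Rightarrow> bool" where
  "consec A a b \<longleftrightarrow> a \<in> A \<and> b \<in> A \<and> a < b \<and> (\<forall>z\<in>A. \<not> (a < z \<and> z < b))"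

lemma consecD: "consec A a b \<Longrightarrow> a \<in> A \<and> b \<in> A \<and> a < b"
  by (simp add: consec_def)

lemma consec_right_le: "consec A a b \<Longrightarrow> z \<in> A \<Longrightarrow> a < z \<Longrightarrow> b \<le> z"
  unfolding consec_def by (meson leI)

lemma consec_left_ge: "consec A a b \<Longrightarrow> z \<in> A \<Longrightarrow> z < b \<Longrightarrow> z \<le> a"
  unfolding consec_def by (meson leI)

text \<open>At the two ends the translation changes the level: F_(i+3) and F_(i+4) descend to points
  of level i and i + 1. The hypothesis \<open>l \<le> i\<close> keeps all four points in S_l, so the
  equivalence extends to the closed block.\<close>

lemma level_set_translate:
  assumes "l \<le> i" "1 \<le> i" "fib_len (i + 3) \<le> n" "n \<le> fib_len (i + 4)"
  shows "n \<in> level_set l \<longleftrightarrow> n - 2 * fib_len (i + 1) \<in> level_set l"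
proof -
  consider "n = fib_len (i + 3)" | "n = fib_len (i + 4)" | "fib_len (i + 3) < n" "n < fib_len (i + 4)"
    using assms by linarith
  then show ?thesis
  proof cases
    case 1
    then have "n \<in> level_set l" "n - 2 * fib_len (i + 1) = fib_len i"
      using fib_len_in_level_set[of "i + 3" l] fib_len_shift_bounds[of i] assms by auto
    then show ?thesis using fib_len_in_level_set[of i l] assms by auto
  next
    case 2
    then have "n \<in> level_set l" "n - 2 * fib_len (i + 1) = fib_len (i + 2) + fib_len i"
      using fib_len_in_level_set[of "i + 4" l] fib_len_shift_bounds[of i] assms by auto
    moreover have "fib_len (i + 2) + fib_len i \<in> level_set l"
      unfolding level_set_def using level_fib_len_add[of i] assms by (intro CollectI exI[of _ "i+1"]) auto
    ultimately show ?thesis by simp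
  next
    case 3 then show ?thesis by (rule level_set_interior)
  qed
qed

text \<open>A pair starting in a block cannot leave it, since its right end F_(i+4) belongs to S_l;
  on the closed block the translation preserves both order and membership.\<close>

lemma consec_translate:
  assumes c: "consec (level_set l) a b" and i: "l \<le> i" "1 \<le> i" "fib_len (i + 3) \<le> a" "a < fib_len (i + 4)"
  shows "b \<le> fib_len (i + 4)" "consec (level_set l) (a - 2 * fib_len (i + 1)) (b - 2 * fib_len (i + 1))"
proof -
  let ?s = "2 * fib_len (i + 1)"
  note sb = fib_len_shift_bounds[of i]
  show b: "b \<le> fib_len (i + 4)"
    using consec_right_le[OF c fib_len_in_level_set[of "i + 4" l]] i by auto
  have c': "a \<in> level_set l" "b \<in> level_set l" "a < b" using c by (auto simp: consec_def)
  have "\<not> (a - ?s < z \<and> z < b - ?s)" if "z \<in> level_set l" for z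
  proof
    assume z: "a - ?s < z \<and> z < b - ?s"
    then have "z + ?s \<in> level_set l" "a < z + ?s" "z + ?s < b"
      using level_set_translate[of l i "z + ?s"] that i sb b c' by auto
    then show False using c unfolding consec_def by blast
  qed
  moreover have "a - ?s \<in> level_set l" "b - ?s \<in> level_set l"
    using level_set_translate[of l i a] level_set_translate[of l i b] c' i b by auto
  ultimately show "consec (level_set l) (a - ?s) (b - ?s)"
    unfolding consec_def using c' i sb by auto
qed

lemma fib_len_steps:
  "fib_len (d + 2) = fib_len (d + 1) + fib_len d"
  "fib_len (d + 3) = fib_len (d + 2) + fib_len (d + 1)"
  "fib_len (d + 4) = fib_len (d + 3) + fib_len (d + 2)"
  "fib_len (d + 5) = fib_len (d + 4) + fib_len (d + 3)"
  "fib_len (d + 6) = fib_len (d + 5) + fib_len (d + 4)"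
  "fib_len d \<le> fib_len (d + 1)" "0 < fib_len d"
  by (simp_all add: numeral_eq_Suc fib_neq_0_nat)

text \<open>The open block above F_(d+3) descends to numbers below F_(d+3), where S_(d+3) is empty.
  The next two lemmas pull their blocks back to the ones already known; together they list the
  elements of S_(d+3) below F_(d+6).\<close>

lemma level_set_initial_0:
  assumes "n \<in> level_set (d + 3)" "n < fib_len (d + 4)"
  shows "n = fib_len (d + 3)"
proof (rule ccontr)
  assume "n \<noteq> fib_len (d + 3)"
  then have "fib_len (d + 3) < n" using level_set_ge[OF assms(1)] by linarith
  then have "n - 2 * fib_len (d + 1) \<in> level_set (d + 3)" using level_set_interior[of d n] assms by simp
  then have "fib_len (d + 3) \<le> n - 2 * fib_len (d + 1)" by (rule level_set_ge)
  then show False using assms fib_len_steps[of d] by linarith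
qed

lemma level_set_initial_1:
  assumes "n \<in> level_set (d + 3)" "fib_len (d + 4) < n" "n < fib_len (d + 5)"
  shows "n = fib_len (d + 4) + fib_len (d + 2)"
proof -
  have "n - 2 * fib_len (d + 2) \<in> level_set (d + 3)"
    using level_set_interior[of "d + 1" n] assms by (simp add: numeral_eq_Suc)
  moreover have "n - 2 * fib_len (d + 2) < fib_len (d + 4)" using assms fib_len_steps[of d] by linarith
  ultimately have "n - 2 * fib_len (d + 2) = fib_len (d + 3)" by (rule level_set_initial_0)
  then show ?thesis using assms fib_len_steps[of d] by linarith
qed

lemma level_set_initial_2:
  assumes "n \<in> level_set (d + 3)" "fib_len (d + 5) < n" "n < fib_len (d + 6)"
  shows "n = fib_len (d + 5) + fib_len (d + 1) \<or> n = fib_len (d + 5) + fib_len (d + 3)"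
proof -
  let ?n = "n - 2 * fib_len (d + 3)"
  have m: "?n \<in> level_set (d + 3)"
    using level_set_interior[of "d + 2" n] assms by (simp add: numeral_eq_Suc)
  have "?n < fib_len (d + 4) + fib_len (d + 2)" using assms fib_len_steps[of d] by linarith
  then have "?n = fib_len (d + 3) \<or> ?n = fib_len (d + 4)"
    using level_set_initial_0[OF m] level_set_initial_1[OF m] fib_len_steps[of d] by linarith
  then show ?thesis using assms fib_len_steps[of d] by linarith
qed

lemma level_initial:
  "level (fib_len (d + 4) + fib_len (d + 2)) (d + 3)"
  "level (fib_len (d + 5) + fib_len (d + 1)) (d + 3)"
  "level (fib_len (d + 5) + fib_len (d + 3)) (d + 4)"
proof -
  show "level (fib_len (d + 4) + fib_len (d + 2)) (d + 3)"
    using level_fib_len_add[of "d + 2"] by (simp add: numeral_eq_Suc)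
  show "level (fib_len (d + 5) + fib_len (d + 3)) (d + 4)"
    using level_fib_len_add[of "d + 3"] by (simp add: numeral_eq_Suc)
  have "level (fib_len (d + 3) + 2 * fib_len (d + 2 + 1)) (d + 3)"
    using fib_len_steps[of d] by (intro level.step[OF level.base]) (auto simp: numeral_eq_Suc)
  moreover have "fib_len (d + 3) + 2 * fib_len (d + 2 + 1) = fib_len (d + 5) + fib_len (d + 1)"
    using fib_len_steps[of d] by (simp only: add.assoc) simp
  ultimately show "level (fib_len (d + 5) + fib_len (d + 1)) (d + 3)" by (simp only:)
qed

lemma level_set_initial_mem:
  "fib_len (d + 4) + fib_len (d + 2) \<in> level_set (d + 3)"
  "fib_len (d + 5) + fib_len (d + 1) \<in> level_set (d + 3)"
  "fib_len (d + 5) + fib_len (d + 3) \<in> level_set (d + 4)"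
  "fib_len (d + 5) + fib_len (d + 3) \<in> level_set (d + 3)"
  "fib_len (d + 4) + fib_len (d + 2) \<notin> level_set (d + 4)"
  "fib_len (d + 5) + fib_len (d + 1) \<notin> level_set (d + 4)"
proof -
  note li = level_initial[of d]
  show "fib_len (d + 4) + fib_len (d + 2) \<in> level_set (d + 3)"
    "fib_len (d + 5) + fib_len (d + 1) \<in> level_set (d + 3)"
    "fib_len (d + 5) + fib_len (d + 3) \<in> level_set (d + 4)"
    unfolding level_set_def using li by blast+
  then show "fib_len (d + 5) + fib_len (d + 3) \<in> level_set (d + 3)"
    using level_set_antimono[of "d + 3" "d + 4"] by auto
  have "n \<notin> level_set (d + 4)" if "level n (d + 3)" for n
  proof
    assume "n \<in> level_set (d + 4)"
    then obtain k where "d + 4 \<le> k" "level n k" unfolding level_set_def by blast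
    then show False using level_unique[OF that, of k] by simp
  qed
  then show "fib_len (d + 4) + fib_len (d + 2) \<notin> level_set (d + 4)"
    "fib_len (d + 5) + fib_len (d + 1) \<notin> level_set (d + 4)" using li by blast+
qed

lemma consec_initial:
  assumes c: "consec (level_set (d + 3)) a b" and a: "a < fib_len (d + 6)"
  shows "(a, b) \<in> {(fib_len (d + 3), fib_len (d + 4)),
    (fib_len (d + 4), fib_len (d + 4) + fib_len (d + 2)),
    (fib_len (d + 4) + fib_len (d + 2), fib_len (d + 5)),
    (fib_len (d + 5), fib_len (d + 5) + fib_len (d + 1)),
    (fib_len (d + 5) + fib_len (d + 1), fib_len (d + 5) + fib_len (d + 3)),
    (fib_len (d + 5) + fib_len (d + 3), fib_len (d + 6))}"
proof -
  have ab: "a \<in> level_set (d + 3)" "b \<in> level_set (d + 3)" "a < b" using consecD[OF c] by auto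
  note st = fib_len_steps[of d]
  have f: "fib_len (d + 4) \<in> level_set (d + 3)" "fib_len (d + 5) \<in> level_set (d + 3)"
    "fib_len (d + 6) \<in> level_set (d + 3)"
    by (rule fib_len_in_level_set; simp)+
  note r = consec_right_le[OF c f(1)] consec_right_le[OF c f(2)] consec_right_le[OF c f(3)]
    consec_right_le[OF c level_set_initial_mem(1)] consec_right_le[OF c level_set_initial_mem(2)]
    consec_right_le[OF c level_set_initial_mem(4)]
  have shape: "n \<in> {fib_len (d + 3), fib_len (d + 4), fib_len (d + 4) + fib_len (d + 2), fib_len (d + 5),
      fib_len (d + 5) + fib_len (d + 1), fib_len (d + 5) + fib_len (d + 3), fib_len (d + 6)}"
    if n: "n \<in> level_set (d + 3)" "n \<le> fib_len (d + 6)" for n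
  proof -
    consider "n < fib_len (d + 4)" | "n = fib_len (d + 4)" | "fib_len (d + 4) < n" "n < fib_len (d + 5)"
      | "n = fib_len (d + 5)" | "fib_len (d + 5) < n" "n < fib_len (d + 6)" | "n = fib_len (d + 6)"
      using n(2) by linarith
    then show ?thesis
      using level_set_initial_0[OF n(1)] level_set_initial_1[OF n(1)] level_set_initial_2[OF n(1)]
      by cases blast+
  qed
  have "b \<le> fib_len (d + 6)" using r a by blast
  note sa = shape[OF ab(1)] and sb = shape[OF ab(2) this]
  consider "a = fib_len (d + 3)" | "a = fib_len (d + 4)" | "a = fib_len (d + 4) + fib_len (d + 2)"
    | "a = fib_len (d + 5)" | "a = fib_len (d + 5) + fib_len (d + 1)" | "a = fib_len (d + 5) + fib_len (d + 3)"
    using sa a by auto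
  then show ?thesis
  proof cases
    case 1 with r(1) sb ab(3) st show ?thesis by auto
  next
    case 2 with r(4) sb ab(3) st show ?thesis by auto
  next
    case 3 with r(2) sb ab(3) st show ?thesis by auto
  next
    case 4 with r(5) sb ab(3) st show ?thesis by auto
  next
    case 5 with r(6) sb ab(3) st show ?thesis by auto
  next
    case 6 with r(3) sb ab(3) st show ?thesis by auto
  qed
qed

lemma fib_len_neq_0 [simp]: "fib_len i \<noteq> 0"
  using fib_len_pos[of i] by linarith

lemma level_set_interval:
  assumes "n \<in> level_set (d + 3)" "fib_len (d + 6) \<le> n"
  obtains i where "d + 3 \<le> i" "fib_len (i + 3) \<le> n" "n < fib_len (i + 4)"
proof -
  obtain j where j: "1 \<le> j" "fib_len j \<le> n" "n < fib_len (j + 1)"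
    using fib_len_interval[of n] assms(2) fib_len_pos[of "d + 6"] by (metis One_nat_def Suc_leI le_trans)
  have "fib_len (d + 6) < fib_len (j + 1)" using assms(2) j by linarith
  then have "d + 6 < j + 1" using fib_len_less_iff[of "d + 6" "j + 1"] by simp
  then have "d + 3 \<le> j - 3" "j - 3 + 3 = j" "j - 3 + 4 = j + 1" by auto
  then show ?thesis using that[of "j - 3"] j by metis
qed

text \<open>Beyond F_(d+6) each consecutive pair of S_(d+3) is the translate of an earlier pair by
  some 2 F_(i+1) with i at least d + 3. Only the six pairs of the initial list are left as base
  cases.\<close>

lemma consec_induct [consumes 1, case_names 0 1 2 3 4 5 translate]:
  assumes "consec (level_set (d + 3)) a b"
    and "P (fib_len (d + 3)) (fib_len (d + 4))"
    and "P (fib_len (d + 4)) (fib_len (d + 4) + fib_len (d + 2))"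
    and "P (fib_len (d + 4) + fib_len (d + 2)) (fib_len (d + 5))"
    and "P (fib_len (d + 5)) (fib_len (d + 5) + fib_len (d + 1))"
    and "P (fib_len (d + 5) + fib_len (d + 1)) (fib_len (d + 5) + fib_len (d + 3))"
    and "P (fib_len (d + 5) + fib_len (d + 3)) (fib_len (d + 6))"
    and step: "\<And>i a b. d + 3 \<le> i \<Longrightarrow> consec (level_set (d + 3)) a b \<Longrightarrow> fib_len i \<le> a \<Longrightarrow>
      b \<le> fib_len (i + 2) + fib_len i \<Longrightarrow> P a b \<Longrightarrow>
      P (a + 2 * fib_len (i + 1)) (b + 2 * fib_len (i + 1))"
  shows "P a b"
  using assms(1)
proof (induction a arbitrary: b rule: less_induct)
  case (less a)
  show ?case
  proof (cases "a < fib_len (d + 6)")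
    case True
    from consec_initial[OF less.prems True] show ?thesis using assms by auto
  next
    case False
    then obtain i where i: "d + 3 \<le> i" "fib_len (i + 3) \<le> a" "a < fib_len (i + 4)"
      using level_set_interval[of a d] consecD[OF less.prems] by auto
    let ?s = "2 * fib_len (i + 1)"
    note sb = fib_len_shift_bounds[of i]
    have "b \<le> fib_len (i + 4)" "consec (level_set (d + 3)) (a - ?s) (b - ?s)"
      using consec_translate[OF less.prems, of i] i by auto
    moreover have "a < b" using consecD[OF less.prems] by auto
    moreover have "a - ?s < a" using i sb fib_len_pos[of i] fib_len_pos[of "i + 1"] by linarith
    ultimately have "P (a - ?s + ?s) (b - ?s + ?s)"
      using i sb less.IH[of "a - ?s" "b - ?s"] by (intro step) linarith+
    then show ?thesis using i sb \<open>a < b\<close> by simp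
  qed
qed

lemma consec_gap:
  assumes "consec (level_set (d + 3)) a b"
  shows "b = a + fib_len (d + 2) \<or> b = a + fib_len (d + 1)"
  using assms by (induction rule: consec_induct) (use fib_len_steps[of d] in \<open>auto simp del: fib.simps\<close>)

lemma chain_triple:
  fixes x0 x1 x2 x3 x4 x5 x6 :: nat
  assumes "x0 < x1" "x1 < x2" "x2 < x3" "x3 < x4" "x4 < x5" "x5 < x6"
    and "(a, n) \<in> {(x0, x1), (x1, x2), (x2, x3), (x3, x4), (x4, x5), (x5, x6)}"
    and "(n, b) \<in> {(x0, x1), (x1, x2), (x2, x3), (x3, x4), (x4, x5), (x5, x6)}"
  shows "(a, n, b) \<in> {(x0, x1, x2), (x1, x2, x3), (x2, x3, x4), (x3, x4, x5), (x4, x5, x6)}"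
proof -
  have "distinct [x0, x1, x2, x3, x4, x5, x6]" using assms(1-6) by simp
  then show ?thesis using assms(7,8) by (elim insertE emptyE) simp_all
qed

lemma consec_triple_initial:
  fixes f1 f2 f3 f4 f5 f6 a n b :: nat
  assumes "f3 = f2 + f1" "f4 = f3 + f2" "f5 = f4 + f3" "f6 = f5 + f4" "0 < f1" "f1 < f2"
    and "(a, n) \<in> {(f3, f4), (f4, f4 + f2), (f4 + f2, f5), (f5, f5 + f1), (f5 + f1, f5 + f3), (f5 + f3, f6)}"
    and "(n, b) \<in> {(f3, f4), (f4, f4 + f2), (f4 + f2, f5), (f5, f5 + f1), (f5 + f1, f5 + f3), (f5 + f3, f6)}"
    and "f4 \<in> A" "f5 \<in> A" "f6 \<in> A" "f5 + f3 \<in> A" "f4 + f2 \<notin> A" "f5 + f1 \<notin> A"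
  shows "(n \<in> A \<longleftrightarrow> n - a = b - n) \<and> (n \<notin> A \<longrightarrow> a \<in> A \<and> b \<in> A)"
proof -
  consider "a = f3" "n = f4" "b = f4 + f2" | "a = f4" "n = f4 + f2" "b = f5" | "a = f4 + f2" "n = f5" "b = f5 + f1"
    | "a = f5" "n = f5 + f1" "b = f5 + f3" | "a = f5 + f1" "n = f5 + f3" "b = f6"
  proof -
    have "f3 < f4" "f4 < f4 + f2" "f4 + f2 < f5" "f5 < f5 + f1" "f5 + f1 < f5 + f3" "f5 + f3 < f6"
      using assms(1-6) by linarith+
    from chain_triple[OF this assms(7,8)] show ?thesis using that by blast
  qed
  then show ?thesis using assms(1-6,9-14) by cases auto
qed

text \<open>Inside a block both gaps and all memberships come from the translated triple. The
  delicate point is the boundary n = F_(i+3) of two blocks, where the left and right gaps are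
  translated by different amounts.\<close>

lemma consec_triple:
  assumes "consec (level_set (d + 3)) a n" "consec (level_set (d + 3)) n b"
  shows "(n \<in> level_set (d + 4) \<longleftrightarrow> n - a = b - n) \<and>
    (n \<notin> level_set (d + 4) \<longrightarrow> a \<in> level_set (d + 4) \<and> b \<in> level_set (d + 4))"
  using assms
proof (induction n arbitrary: a b rule: less_induct)
  case (less n)
  note st = fib_len_steps[of d] and mem = level_set_initial_mem[of d]
  have fl: "fib_len j \<in> level_set (d + 4)" if "d + 4 \<le> j" for j
    using that by (intro fib_len_in_level_set) auto
  have fl3: "fib_len j \<in> level_set (d + 3)" if "d + 3 \<le> j" for j
    using that by (intro fib_len_in_level_set) auto
  have an: "a \<in> level_set (d + 3)" "n \<in> level_set (d + 3)" "a < n"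
    and nb: "b \<in> level_set (d + 3)" "n < b"
    using consecD[OF less.prems(1)] consecD[OF less.prems(2)] by auto
  show ?case
  proof (cases "n < fib_len (d + 6)")
    case True
    then have "a < fib_len (d + 6)" using an by simp
    have "fib_len (d + 1) < fib_len (d + 2)" by (rule fib_len_strict_mono) auto
    then show ?thesis
      by (rule consec_triple_initial[OF st(2-5) fib_len_pos _ consec_initial[OF less.prems(1) \<open>a < fib_len (d + 6)\<close>]
          consec_initial[OF less.prems(2) True] fl fl fl mem(3,5,6)]) auto
  next
    case False
    then obtain i where i: "d + 3 \<le> i" "fib_len (i + 3) \<le> n" "n < fib_len (i + 4)"
      using level_set_interval[of n d] an by auto
    let ?s = "2 * fib_len (i + 1)"
    note sb = fib_len_shift_bounds[of i]
    have R: "b \<le> fib_len (i + 4)" "consec (level_set (d + 3)) (n - ?s) (b - ?s)"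
      using consec_translate[OF less.prems(2), of i] i by auto
    have small: "n - ?s < n" using i sb fib_len_pos[of i] fib_len_pos[of "i + 1"] by linarith
    show ?thesis
    proof (cases "n = fib_len (i + 3)")
      case False
      then have ai: "fib_len (i + 3) \<le> a"
        using consec_left_ge[OF less.prems(1) fl3[of "i + 3"]] i by auto
      have L: "consec (level_set (d + 3)) (a - ?s) (n - ?s)"
        using consec_translate[OF less.prems(1), of i] i ai an by auto
      have IH: "(n - ?s \<in> level_set (d + 4) \<longleftrightarrow> n - ?s - (a - ?s) = b - ?s - (n - ?s)) \<and>
        (n - ?s \<notin> level_set (d + 4) \<longrightarrow> a - ?s \<in> level_set (d + 4) \<and> b - ?s \<in> level_set (d + 4))"
        by (rule less.IH[OF small L R(2)])
      have "n \<in> level_set (d + 4) \<longleftrightarrow> n - ?s \<in> level_set (d + 4)"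
        by (rule level_set_interior) (use i False in auto)
      moreover have "a - ?s \<in> level_set (d + 4) \<longrightarrow> a \<in> level_set (d + 4)"
        using level_set_interior[of i a "d + 4"] fl[of "i + 3"] ai an i
        by (cases "a = fib_len (i + 3)") auto
      moreover have "b - ?s \<in> level_set (d + 4) \<longrightarrow> b \<in> level_set (d + 4)"
        using level_set_interior[of i b "d + 4"] fl[of "i + 4"] R nb i
        by (cases "b = fib_len (i + 4)") auto
      moreover have "n - ?s - (a - ?s) = n - a" "b - ?s - (n - ?s) = b - n"
        using ai an nb sb by linarith+
      ultimately show ?thesis using IH by simp
    next
      \<comment> \<open>The right gap descends to the right gap of F_i. The left gap lies in the
        block below: one translation takes it to the left of F_(i+1) + F_(i-1), and a second one, by
        2 F_(i-1), to the left of F_i. So both are compared at F_i by the induction hypothesis. For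
        i = d + 3 and i = d + 4 the initial list is read off instead.\<close>
      case n: True
      have nL: "n \<in> level_set (d + 4)" using fl[of "i + 3"] i n by simp
      have ns: "n - ?s = fib_len i" using n sb by simp
      have bn: "b - n = b - ?s - fib_len i" using n sb nb by simp
      have R': "consec (level_set (d + 3)) (fib_len i) (b - ?s)" using R ns by simp
      have "n - a = b - n"
      proof (cases "i = d + 3")
        case True
        then have n6: "n = fib_len (d + 6)" using n by (simp add: numeral_eq_Suc)
        have "a < fib_len (d + 6)" using an n6 by simp
        from consec_initial[OF less.prems(1) this] have "a = fib_len (d + 5) + fib_len (d + 3)"
          using n6 st by auto
        moreover have "b - ?s = fib_len (d + 4)"
          using consec_initial[OF R'] True st by auto
        ultimately show ?thesis using bn n6 True st by simp
      next
        case False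
        then obtain k where k: "i = k + 1" "d + 3 \<le> k" using i by (cases i) auto
        let ?t = "2 * fib_len (k + 1)"
        note sk = fib_len_shift_bounds[of k]
        have n4: "n = fib_len (k + 4)" using n k by (simp add: numeral_eq_Suc)
        have "fib_len (k + 3) \<le> a"
          using consec_left_ge[OF less.prems(1) fl3[of "k + 3"]] k n4 fib_len_strict_mono[of "k + 3" "k + 4"] by simp
        then have "consec (level_set (d + 3)) (a - ?t) (n - ?t)"
          using consec_translate(2)[OF less.prems(1), of k] k n4 an by simp
        moreover have "n - ?t = fib_len (k + 2) + fib_len k" using n4 sk by linarith
        ultimately have L: "consec (level_set (d + 3)) (a - ?t) (fib_len (k + 2) + fib_len k)"
          by (simp only:)
        have ak: "?t \<le> a" using \<open>fib_len (k + 3) \<le> a\<close> sk by linarith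
        have na: "n - a = fib_len (k + 2) + fib_len k - (a - ?t)" using ak n4 sk by linarith
        have ak2: "fib_len (k + 2) \<le> a - ?t"
          using consec_left_ge[OF L fl3[of "k + 2"]] k by auto
        show ?thesis
        proof (cases "k = d + 3")
          case True
          have L': "consec (level_set (d + 3)) (a - ?t) (fib_len (d + 5) + fib_len (d + 3))"
            using L True by (simp add: numeral_eq_Suc)
          have "a - ?t < fib_len (d + 6)" using consecD[OF L'] st by linarith
          from consec_initial[OF L' this] have "a - ?t = fib_len (d + 5) + fib_len (d + 1)"
            using st by auto
          moreover have "fib_len i = fib_len (d + 4)" using k True by (simp add: numeral_eq_Suc)
          moreover from this have "b - ?s = fib_len (d + 4) + fib_len (d + 2)"
            using consec_initial[OF R'] st by auto
          moreover have "fib_len (k + 2) + fib_len k = fib_len (d + 5) + fib_len (d + 3)"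
            using True by (simp add: numeral_eq_Suc)
          ultimately show ?thesis using bn na st by simp
        next
          case False
          then obtain m where m: "k = m + 1" "d + 3 \<le> m" using k by (cases k) auto
          let ?u = "2 * fib_len (m + 1)"
          note sm = fib_len_shift_bounds[of m]
          have e: "fib_len (k + 2) = fib_len (m + 3)" "fib_len k = fib_len (m + 1)"
            "fib_len i = fib_len (m + 2)"
            using m k by (simp_all add: numeral_eq_Suc)
          have e2: "fib_len (m + 3) + fib_len (m + 1) - ?u = fib_len (m + 2)"
            "fib_len (m + 4) = fib_len (m + 3) + fib_len (m + 2)"
            "fib_len (m + 1) \<le> fib_len (m + 2)"
            by (simp_all add: numeral_eq_Suc)
          have e3: "fib_len (m + 1) < fib_len (m + 2)" by (rule fib_len_strict_mono) auto
          have L2: "consec (level_set (d + 3)) (a - ?t) (fib_len (m + 3) + fib_len (m + 1))"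
            using L e by simp
          have "consec (level_set (d + 3)) (a - ?t - ?u) (fib_len (m + 2))"
            using consec_translate(2)[OF L2, of m] ak2 e e2 e3 m consecD[OF L2] by auto
          moreover have "consec (level_set (d + 3)) (fib_len (m + 2)) (b - ?s)" using R' e by simp
          moreover have "fib_len (m + 2) < n" using small ns e by simp
          ultimately have "fib_len (m + 2) - (a - ?t - ?u) = b - ?s - fib_len (m + 2)"
            using less.IH[of "fib_len (m + 2)" "a - ?t - ?u" "b - ?s"] fl[of "m + 2"] m by simp
          moreover have "?u \<le> a - ?t" using ak2 e sm by linarith
          then have "fib_len (m + 2) - (a - ?t - ?u) = fib_len (m + 3) + fib_len (m + 1) - (a - ?t)"
            unfolding e2(1)[symmetric] by arith
          ultimately show ?thesis using na bn e by metis
        qed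
      qed
      then show ?thesis using nL by simp
    qed
  qed
qed

section \<open>Zeckendorf expansions with digits of index at least d\<close>

inductive zeck :: "nat \<Rightarrow> nat \<Rightarrow> nat \<Rightarrow> bool" for d where
  base: "d \<le> i \<Longrightarrow> zeck d i (fib_len i)"
| step: "zeck d j q \<Longrightarrow> j + 2 \<le> i \<Longrightarrow> zeck d i (fib_len i + q)"

lemma zeck_bounds: "zeck d i n \<Longrightarrow> 1 \<le> d \<Longrightarrow> d \<le> i \<and> fib_len i \<le> n \<and> n < fib_len (i + 1)"
proof (induction rule: zeck.induct)
  case (base i)
  then show ?case using fib_len_strict_mono[of i "i + 1"] by auto
next
  case (step j q i)
  have "fib_len (j + 1) \<le> fib_len (i - 1)" using step by (intro fib_len_mono) auto
  moreover have "i = Suc (i - 1)" using step by auto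
  moreover have "fib_len (Suc (i - 1) + 1) = fib_len (Suc (i - 1)) + fib_len (i - 1)" by simp
  ultimately have "q < fib_len (i - 1) \<and> fib_len (i + 1) = fib_len i + fib_len (i - 1)"
    using step by (metis less_le_trans)
  then show ?case using step by linarith
qed

text \<open>A carry occurs only if q has top digit i - 1. Then F_i + F_(i-1) = F_(i+1), and the next
  digit of q is at most i - 3, so the carry does not propagate and creates no digit below d.\<close>

lemma zeck_add:
  assumes "zeck d j q" "1 \<le> d" "q < fib_len i"
  shows "\<exists>k. zeck d k (fib_len i + q)"
proof -
  have "j < i"
    using zeck_bounds[OF assms(1,2)] assms(2,3) fib_len_less_iff[of j i] by linarith
  show ?thesis
  proof (cases "j + 2 \<le> i")
    case True then show ?thesis using assms zeck.step by blast
  next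
    case False
    then have ij: "i = Suc j" using \<open>j < i\<close> by simp
    have c: "fib_len i + fib_len j = fib_len (Suc i)" unfolding ij by simp
    from assms(1) show ?thesis
    proof cases
      case base
      then have "zeck d (Suc i) (fib_len i + q)" using c zeck.base[of d "Suc i"] ij by simp
      then show ?thesis by blast
    next
      case (step j' q')
      then have "zeck d (Suc i) (fib_len (Suc i) + q')" using ij by (intro zeck.step[of d j']) auto
      then show ?thesis using c step by (metis add.assoc)
    qed
  qed
qed

text \<open>The second conjunct is there for the induction. The translate of n may have a leading
  term other than F_(i-3); the remainder n - F_i is then recovered from the remainder of the
  translate with an additional Fibonacci number in front.\<close>

lemma level_set_zeck:
  assumes "n \<in> level_set (d + 3)" "1 \<le> d" "fib_len i < n" "n < fib_len (i + 1)"
  shows "(\<exists>j. zeck d j (n - fib_len i)) \<and> (\<exists>j. zeck d j (fib_len (i - 2) + (n - fib_len i)))"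
  using assms(1,3,4)
proof (induction n arbitrary: i rule: less_induct)
  case (less n)
  have dn: "fib_len (d + 3) \<le> n" using level_set_ge less.prems by blast
  have "d + 4 \<le> i"
  proof -
    have "fib_len (d + 3) < fib_len (i + 1)" using dn less.prems by linarith
    then have "d + 3 \<le> i" using fib_len_less_iff[of "d + 3" "i + 1"] by simp
    moreover have "i \<noteq> d + 3"
      using level_set_initial_0[of n d] less.prems by (auto simp: numeral_eq_Suc)
    ultimately show ?thesis by simp
  qed
  then obtain k where k: "i = k + 4" "d \<le> k" 
    using le_Suc_ex[of "d + 4" i] by (metis add.assoc add.commute le_add1)
  have F: "fib_len (k + 4) = fib_len (k + 3) + fib_len (k + 2)" "fib_len (k + 5) = fib_len (k + 4) + fib_len (k + 3)"
    "fib_len (k + 3) = fib_len (k + 2) + fib_len (k + 1)" "fib_len (k + 2) = fib_len (k + 1) + fib_len k"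
    "0 < fib_len k" "0 < fib_len (k + 1)" "fib_len k \<le> fib_len (k + 1)"
    using fib_len_steps[of k] by auto
  let ?n = "n - 2 * fib_len (k + 2)"
  define q where "q = n - fib_len i"
  have q: "n = fib_len (k + 4) + q" "0 < q" "q < fib_len (k + 3)"
    using less.prems k F unfolding q_def by (auto simp: numeral_eq_Suc)
  have nq: "?n = fib_len (k + 1) + q" using q F by linarith
  have nL: "?n \<in> level_set (d + 3)"
    using level_set_interior[of "k + 1" n] less.prems k by (simp add: numeral_eq_Suc)
  have lt: "?n < n" using q F by linarith
  have i2: "i - 2 = k + 2" using k by simp
  have "(\<exists>j. zeck d j q) \<and> (\<exists>j. zeck d j (fib_len (k + 2) + q))"
  proof -
    consider "?n < fib_len (k + 2)" | "?n = fib_len (k + 2)" | "fib_len (k + 2) < ?n" "?n < fib_len (k + 3)"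
      | "?n = fib_len (k + 3)" | "fib_len (k + 3) < ?n" by linarith
    then show ?thesis
    proof cases
      case 1
      have "fib_len (k + 1) < ?n" "?n < fib_len (k + 1 + 1)" using 1 nq q by simp_all
      then have "\<exists>j. zeck d j (?n - fib_len (k + 1))" using less.IH[OF lt nL, of "k + 1"] by blast
      moreover have "?n - fib_len (k + 1) = q" using nq by linarith
      ultimately have "\<exists>j. zeck d j q" by simp
      moreover have "q < fib_len (k + 2)" using 1 nq by linarith
      ultimately show ?thesis using zeck_add assms(2) by blast
    next
      case 2
      then have "q = fib_len k" using nq F by linarith
      then have "zeck d k q" using zeck.base k by simp
      then show ?thesis using zeck_add[of d k q "k + 2"] assms(2) \<open>q = fib_len k\<close> F by auto
    next
      \<comment> \<open>Here q is the remainder of the translate plus F_k, which is exactly the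
        second conjunct for the translate.\<close>
      case 3
      have "\<exists>j. zeck d j (fib_len k + (?n - fib_len (k + 2)))"
        using less.IH[OF lt nL, of "k + 2"] 3 by (simp add: numeral_eq_Suc)
      moreover have "fib_len k + (?n - fib_len (k + 2)) = q" using nq F 3 by linarith
      ultimately have "\<exists>j. zeck d j q" by simp
      moreover have "q < fib_len (k + 2)" using 3 nq F by linarith
      ultimately show ?thesis using zeck_add assms(2) by blast
    next
      case 4
      then have "q = fib_len (k + 2)" using nq F by linarith
      moreover have "zeck d (k + 2) (fib_len (k + 2))" using k by (intro zeck.base) auto
      moreover have "zeck d (k + 3) (fib_len (k + 3) + fib_len k)"
        using k by (intro zeck.step[OF zeck.base]) auto
      moreover have "fib_len (k + 2) + fib_len (k + 2) = fib_len (k + 3) + fib_len k" using F by linarith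
      ultimately show ?thesis by metis
    next
      \<comment> \<open>Now 2 F_(k+2) + q' = F_(k+3) + (F_k + q'), and F_k + q' is obtained by
        translating a second time, so it is again an element of the level set.\<close>
      case 5
      define q' where "q' = ?n - fib_len (k + 3)"
      have q': "q = fib_len (k + 2) + q'" "?n = fib_len (k + 3) + q'" "0 < q'" "q' < fib_len (k + 1)"
        using 5 nq F q unfolding q'_def by linarith+
      have n4: "?n < fib_len (k + 4)" using q' F by linarith
      have "\<exists>j. zeck d j q'"
        using less.IH[OF lt nL, of "k + 3"] 5 n4 unfolding q'_def by (simp add: numeral_eq_Suc)
      moreover have "q' < fib_len (k + 2)" using q' F by linarith
      ultimately have A: "\<exists>j. zeck d j q" using zeck_add assms(2) q'(1) by metis
      have n3: "?n - 2 * fib_len (k + 1) = fib_len k + q'" using q' F by linarith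
      have m: "fib_len k + q' \<in> level_set (d + 3)"
        using level_set_interior[of k ?n] 5 n4 nL n3 by simp
      have mn: "fib_len k + q' < n" using q' q F by linarith
      have "\<exists>j. zeck d j (fib_len k + q')"
      proof -
        obtain e where e: "1 \<le> e" "fib_len e \<le> fib_len k + q'" "fib_len k + q' < fib_len (e + 1)"
          using fib_len_interval[of "fib_len k + q'"] q' by auto
        show ?thesis
        proof (cases "fib_len e = fib_len k + q'")
          case True
          have "fib_len (d + 3) < fib_len (e + 1)" using level_set_ge[OF m] e by linarith
          then have "d + 3 < e + 1" using fib_len_less_iff[of "d + 3" "e + 1"] by simp
          then show ?thesis using zeck.base[of d e] True by auto
        next
          case False
          then have "\<exists>j. zeck d j (fib_len k + q' - fib_len e)"
            using less.IH[OF mn m, of e] e by auto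
          moreover have "fib_len k + q' - fib_len e < fib_len e"
            using e fib_len_rec[of "e - 1"] fib_len_mono[of "e - 1" e] by (simp add: Suc_diff_Suc) 
          ultimately have "\<exists>j. zeck d j (fib_len e + (fib_len k + q' - fib_len e))"
            using zeck_add assms(2) by blast
          then show ?thesis using e by simp
        qed
      qed
      moreover have "fib_len k + q' < fib_len (k + 3)" using q' F by linarith
      ultimately have "\<exists>j. zeck d j (fib_len (k + 3) + (fib_len k + q'))"
        using zeck_add assms(2) by blast
      moreover have "fib_len (k + 3) + (fib_len k + q') = fib_len (k + 2) + q" using q' F by linarith
      ultimately have "\<exists>j. zeck d j (fib_len (k + 2) + q)" by (simp only:)
      then show ?thesis using A by blast
    qed
  qed
  then show ?case unfolding q_def i2 .
qed

lemma level_set_imp_zeck: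
  assumes "n \<in> level_set (d + 3)" "1 \<le> d"
  shows "\<exists>j. zeck d j n"
proof -
  have "1 \<le> n" using level_set_ge[OF assms(1)] fib_len_pos[of "d + 3"] by linarith
  then obtain e where e: "1 \<le> e" "fib_len e \<le> n" "n < fib_len (e + 1)"
    using fib_len_interval by blast
  show ?thesis
  proof (cases "fib_len e = n")
    case True
    have "fib_len (d + 3) < fib_len (e + 1)" using level_set_ge[OF assms(1)] e by linarith
    then have "d + 3 < e + 1" using fib_len_less_iff[of "d + 3" "e + 1"] by simp
    then show ?thesis using zeck.base[of d e] True by auto
  next
    case False
    then have "\<exists>j. zeck d j (n - fib_len e)"
      using level_set_zeck[OF assms, of e] e by auto
    moreover have "n - fib_len e < fib_len e"
      using e fib_len_rec[of "e - 1"] fib_len_mono[of "e - 1" e] by (simp add: Suc_diff_Suc)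
    ultimately have "\<exists>j. zeck d j (fib_len e + (n - fib_len e))"
      using zeck_add assms(2) by blast
    then show ?thesis using e by simp
  qed
qed

section \<open>Matrices of prefixes\<close>

lemma fib_len_ge_1: "1 \<le> fib_len i"
  using fib_len_pos[of i] by linarith

lemma last_fib_word: "last (fib_word i) = (if even i then LetterB else LetterA)"
proof (induction i rule: fib_word.induct)
  case (3 i)
  have "fib_word i \<noteq> []" using length_fib_word[of i] fib_len_neq_0[of i] by (metis list.size(3))
  then show ?case using 3 by simp
qed auto

lemma matrix_inv_works:
  fixes A :: "int^'n^'n"
  assumes "invertible A"
  shows "A ** matrix_inv A = mat 1" "matrix_inv A ** A = mat 1"
  using assms unfolding invertible_def matrix_inv_def by (metis (mono_tags, lifting) someI_ex)+

lemma invertible_mult_int: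
  fixes A B :: "int^'n^'n"
  assumes "invertible A" "invertible B"
  shows "invertible (A ** B)"
  using assms unfolding invertible_def by (metis matrix_mul_assoc matrix_mul_lid)

lemma invertible_cancel:
  fixes A :: "int^'n^'n"
  assumes "invertible A" "A ** B = A ** C"
  shows "B = C"
  using assms unfolding invertible_def by (metis matrix_mul_assoc matrix_mul_lid)

lemma invertible_det_int:
  fixes A :: "int^2^2"
  assumes "invertible A"
  shows "\<bar>det A\<bar> = 1"
proof -
  obtain B where "A ** B = mat 1" using assms unfolding invertible_def by blast
  then have "det A * det B = 1" by (metis det_mul det_I)
  then show ?thesis by (metis abs_zmult_eq_1 abs_1)
qed

lemma invertible_base_mat: "invertible (base_mat m)" "invertible (transpose (base_mat m))"
proof -
  have "base_mat m ** vector [vector [0, - 1], vector [1, m]] = mat 1"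
    "vector [vector [0, - 1], vector [1, m]] ** base_mat m = mat 1"
    "transpose (base_mat m) ** vector [vector [0, 1], vector [- 1, m]] = mat 1"
    "vector [vector [0, 1], vector [- 1, m]] ** transpose (base_mat m) = mat 1"
    by (simp_all add: vec_eq_iff forall_2 matrix_matrix_mult_def sum_2 base_mat_def transpose_def mat_def)
  then show "invertible (base_mat m)" "invertible (transpose (base_mat m))"
    unfolding invertible_def by blast+
qed

lemma phi_append: "phi W (u @ v) = phi W u ** phi W v"
  by (induction u) (auto simp: phi_def matrix_mul_lid matrix_mul_assoc)

lemma phi_Nil: "phi W [] = mat 1"
  by (simp add: phi_def)

locale admissible =
  fixes m :: int and \<xi> :: real and W :: "nat \<Rightarrow> int^2^2"
  assumes m: "m \<ge> 1" and adm: "admissible_seq m \<xi> W"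
begin

lemma W_inv: "1 \<le> i \<Longrightarrow> invertible (W i)"
  using adm by (simp add: admissible_seq_def)

lemma W_rec: "1 \<le> i \<Longrightarrow> W (i + 2) = W (i + 1) ** W i"
  using adm by (simp add: admissible_seq_def)

definition X :: "nat \<Rightarrow> int^2^2" where
  "X i = W i ** matrix_inv (base_mat_seq m i)"

lemma X_sym: "1 \<le> i \<Longrightarrow> transpose (X i) = X i"
  using adm unfolding admissible_seq_def X_def by blast

lemma base_mat_seq_inv:
  "base_mat_seq m i ** matrix_inv (base_mat_seq m i) = mat 1"
  "matrix_inv (base_mat_seq m i) ** base_mat_seq m i = mat 1"
  using matrix_inv_works[OF invertible_base_mat(1)] matrix_inv_works[OF invertible_base_mat(2)]
  by (auto simp: base_mat_seq_def)

lemma W_eq: "W i = X i ** base_mat_seq m i"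
  by (metis X_def base_mat_seq_inv(2) matrix_mul_assoc matrix_mul_rid)

lemma base_mat_seq_Suc: "base_mat_seq m (Suc i) = transpose (base_mat_seq m i)"
  by (simp add: base_mat_seq_def)

lemma base_mat_seq_add2: "base_mat_seq m (i + 2) = base_mat_seq m i"
  by (simp add: base_mat_seq_def)

lemma X_rec:
  assumes "1 \<le> i"
  shows "X (i + 2) = W (i + 1) ** X i"
  unfolding X_def base_mat_seq_add2 W_rec[OF assms] by (simp add: matrix_mul_assoc)

text \<open>Transposing \<open>X_rec\<close> reverses the product, since its factors are symmetric
  up to base matrices and neighbouring base matrices are transposes of each other. For words this
  reflects that w_(i+1) w_i and w_i w_(i+1) agree except for their last two letters.\<close>

lemma X_rec':
  assumes "1 \<le> i"
  shows "X (i + 2) = W i ** X (i + 1)"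
proof -
  have "X (i + 2) = X (i + 1) ** transpose (base_mat_seq m i) ** X i"
    using X_rec[OF assms] W_eq[of "i + 1"] by (simp add: base_mat_seq_Suc)
  then have "transpose (X (i + 2)) = X i ** (base_mat_seq m i ** X (i + 1))"
    using X_sym[of i] X_sym[of "i + 1"] assms by (simp add: matrix_transpose_mul)
  then show ?thesis using X_sym[of "i + 2"] assms W_eq[of i] by (simp add: matrix_mul_assoc)
qed

lemma X_inv: "1 \<le> i \<Longrightarrow> invertible (X i)"
  unfolding X_def
proof (rule invertible_mult_int)
  show "invertible (matrix_inv (base_mat_seq m i))"
    unfolding invertible_def using base_mat_seq_inv by blast
qed (rule W_inv)

definition Phi :: "nat \<Rightarrow> int^2^2" where "Phi n = phi W (pre n)"
definition N :: "nat \<Rightarrow> int^2^2" where "N n = end_mat m (pre n)"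
text \<open>The matrix from which the point of the prefix of length \<open>n\<close> takes its first
  column; at Fibonacci lengths it is the symmetric matrix \<open>X i\<close>.\<close>

definition Y :: "nat \<Rightarrow> int^2^2" where "Y n = Phi n ** matrix_inv (N n)"

lemma N_cases: "N n = base_mat m \<or> N n = transpose (base_mat m)"
  by (auto simp: N_def end_mat_def)

lemma N_inv: "N n ** matrix_inv (N n) = mat 1" "matrix_inv (N n) ** N n = mat 1"
  using N_cases[of n] matrix_inv_works[OF invertible_base_mat(1)] matrix_inv_works[OF invertible_base_mat(2)]
  by auto

lemma Phi_eq: "Phi n = Y n ** N n"
  by (metis N_inv(2) Y_def matrix_mul_assoc matrix_mul_rid)

lemma phi_fib_word: "1 \<le> i \<Longrightarrow> phi W (fib_word i) = W i"
proof (induction i rule: fib_word.induct)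
  case (3 i)
  show ?case
  proof (cases "i = 0")
    case True
    have "phi W [LetterA, LetterB] = W 1 ** (matrix_inv (W 1) ** W 2)"
      by (simp add: phi_def matrix_mul_rid)
    also have "\<dots> = W 2" using matrix_inv_works(1)[OF W_inv[of 1]] by (simp add: matrix_mul_assoc matrix_mul_lid)
    finally show ?thesis using True by (simp add: numeral_2_eq_2)
  next
    case False
    then show ?thesis using 3 W_rec[of i] by (simp add: phi_append)
  qed
qed (auto simp: phi_def matrix_mul_rid)

lemma Phi_fib_len: "1 \<le> i \<Longrightarrow> Phi (fib_len i) = W i"
  by (simp add: Phi_def pre_fib_len phi_fib_word)

lemma Phi_0: "Phi 0 = mat 1"
  by (simp add: Phi_def pre_def phi_Nil)

lemma Phi_add: "2 \<le> i \<Longrightarrow> q \<le> fib_len (i - 1) \<Longrightarrow> Phi (fib_len i + q) = W i ** Phi q"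
  by (simp add: Phi_def pre_add phi_append phi_fib_word)

lemma N_fib_len: "1 \<le> i \<Longrightarrow> N (fib_len i) = base_mat_seq m i"
  by (simp add: N_def pre_fib_len end_mat_def last_fib_word base_mat_seq_def)

lemma N_add: 
  assumes "2 \<le> i" "1 \<le> q" "q \<le> fib_len (i - 1)" 
  shows "N (fib_len i + q) = N q"
proof -
  have "pre q \<noteq> []" using length_pre[of q] assms(2) by (metis list.size(3) not_one_le_zero)
  then show ?thesis using assms by (simp add: N_def pre_add end_mat_def)
qed

lemma Y_fib_len: "1 \<le> i \<Longrightarrow> Y (fib_len i) = X i"
  by (simp add: Y_def Phi_fib_len N_fib_len X_def)

lemma Y_add: "2 \<le> i \<Longrightarrow> 1 \<le> q \<Longrightarrow> q \<le> fib_len (i - 1) \<Longrightarrow> Y (fib_len i + q) = W i ** Y q"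
  by (simp add: Y_def Phi_add N_add matrix_mul_assoc)

lemma shift_cases:
  assumes "1 \<le> j" "1 \<le> q" "q \<le> fib_len (j + 1)"
  obtains (low) "2 \<le> j" "q \<le> fib_len (j - 1)"
    | (mid) q1 where "2 \<le> j" "1 \<le> q1" "q1 < fib_len j" "q = fib_len (j - 1) + q1"
        "fib_len j + q = fib_len (j + 1) + q1"
    | (top) "q = fib_len (j + 1)" | (one) "j = 1" "q = 1"
proof (cases "j = 1")
  case True
  then have "q = 1 \<or> q = fib_len (j + 1)" using assms by (auto simp: numeral_2_eq_2)
  then show ?thesis using True top one by blast
next
  case False
  then have j: "2 \<le> j" using assms by simp
  have r: "fib_len (j + 1) = fib_len j + fib_len (j - 1)" using j by (cases j) auto
  consider "q \<le> fib_len (j - 1)" | "q = fib_len (j + 1)" | "fib_len (j - 1) < q" "q < fib_len (j + 1)"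
    using assms by linarith
  then show ?thesis
  proof cases
    case 1 then show ?thesis using low j by blast
  next
    case 2 then show ?thesis using top by blast
  next
    case 3
    have "1 \<le> q - fib_len (j - 1)" "q - fib_len (j - 1) < fib_len j"
      "q = fib_len (j - 1) + (q - fib_len (j - 1))"
      "fib_len j + q = fib_len (j + 1) + (q - fib_len (j - 1))"
      using 3 r by linarith+
    then show ?thesis using mid[OF j] by blast
  qed
qed

text \<open>The words w_j w_(j+1) and w_(j+2) agree except for their last two letters, so for q + 1
  < F_(j+1) this is a concatenation of words. At q = F_(j+1) the words disagree but the matrices
  agree, by \<open>X_rec'\<close>. Only the length in between is lost.\<close>

lemma Y_shift:
  assumes "1 \<le> j" "1 \<le> q" "q \<le> fib_len (j + 1)" "q + 1 \<noteq> fib_len (j + 1)"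
  shows "Y (fib_len j + q) = W j ** Y q"
  using assms
proof (induction j arbitrary: q rule: less_induct)
  case (less j)
  from less.prems(1-3) show ?case
  proof (cases rule: shift_cases)
    case low
    then show ?thesis using Y_add less.prems by blast
  next
    case (mid q1)
    have r: "fib_len (j + 1) = fib_len j + fib_len (j - 1)" using mid by (cases j) auto
    have e: "j - 1 + 1 = j" using mid by simp
    have "Y (fib_len (j - 1) + q1) = W (j - 1) ** Y q1"
      using less.IH[of "j - 1" q1] mid less.prems r e by simp
    moreover have "Y (fib_len (j + 1) + q1) = W (j + 1) ** Y q1"
      using mid by (intro Y_add) auto
    moreover have "W (j + 1) = W j ** W (j - 1)" using W_rec[of "j - 1"] mid e by simp
    ultimately have "Y (fib_len (j + 1) + q1) = W j ** Y (fib_len (j - 1) + q1)"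
      by (simp only: matrix_mul_assoc)
    then show ?thesis using mid(4,5) by (simp only:)
  next
    case top
    have e: "fib_len j + q = fib_len (j + 2)" using top by simp
    have "Y (fib_len j + q) = X (j + 2)" unfolding e by (rule Y_fib_len) simp
    moreover have "Y q = X (j + 1)" unfolding top by (rule Y_fib_len) simp
    ultimately show ?thesis using X_rec'[of j] less.prems by simp
  next
    case one
    then show ?thesis using less.prems by (simp add: numeral_2_eq_2)
  qed
qed

lemma N_shift:
  assumes "1 \<le> j" "1 \<le> q" "q + 1 < fib_len (j + 1)"
  shows "N (fib_len j + q) = N q"
  using assms
proof (induction j arbitrary: q rule: less_induct)
  case (less j)
  from less.prems have "q \<le> fib_len (j + 1)" by simp
  with less.prems(1,2) show ?case
  proof (cases rule: shift_cases)
    case low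
    then show ?thesis using N_add less.prems by blast
  next
    case (mid q1)
    have r: "fib_len (j + 1) = fib_len j + fib_len (j - 1)" using mid by (cases j) auto
    have e: "j - 1 + 1 = j" using mid by simp
    have "N (fib_len (j - 1) + q1) = N q1"
      using less.IH[of "j - 1" q1] mid less.prems r e by simp
    moreover have "N (fib_len (j + 1) + q1) = N q1"
      using mid by (intro N_add) auto
    ultimately show ?thesis using mid(4,5) by (simp only:)
  next
    case top
    then show ?thesis using less.prems by simp
  next
    case one
    then show ?thesis using less.prems by (simp add: numeral_2_eq_2)
  qed
qed

lemma Phi_shift:
  assumes "1 \<le> j" "q + 1 < fib_len (j + 1)"
  shows "Phi (fib_len j + q) = W j ** Phi q"
proof (cases "q = 0")
  case True
  then show ?thesis using assms Phi_fib_len[of j] Phi_0 by (simp add: matrix_mul_rid)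
next
  case False
  then show ?thesis
    using Y_shift[of j q] N_shift[of j q] assms by (simp add: Phi_eq matrix_mul_assoc)
qed

text \<open>The six initial pairs reduce to \<open>X_rec\<close> and \<open>X_rec'\<close>. Passing
  to a translated pair changes only a left factor common to both sides: it is cancelled by
  invertibility and replaced by W_(i+3).\<close>

lemma consec_gap_matrix:
  assumes "consec (level_set (d + 3)) a b" and d: "1 \<le> d"
  shows "\<exists>k\<in>{d + 1, d + 2}. b = a + fib_len k \<and> Y b = Phi a ** X k"
proof -
  have pf: "Phi (fib_len (d + 1)) = W (d + 1)" "Phi (fib_len (d + 2)) = W (d + 2)"
    "Phi (fib_len (d + 3)) = W (d + 3)" "Phi (fib_len (d + 4)) = W (d + 4)" "Phi (fib_len (d + 5)) = W (d + 5)"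
    "Y (fib_len (d + 1)) = X (d + 1)" "Y (fib_len (d + 2)) = X (d + 2)" "Y (fib_len (d + 3)) = X (d + 3)"
    "Y (fib_len (d + 5)) = X (d + 5)" "Y (fib_len (d + 6)) = X (d + 6)"
    by (rule Phi_fib_len Y_fib_len; simp)+
  from assms(1) show ?thesis
  proof (induction rule: consec_induct)
    case 0
    have "Y (fib_len (d + 4)) = Phi (fib_len (d + 3)) ** X (d + 2)"
    proof -
      have "X (d + 4) = W (d + 3) ** X (d + 2)" using X_rec[of "d + 2"] by (simp add: numeral_eq_Suc)
      then show ?thesis by (simp only: Y_fib_len Phi_fib_len le_add2 one_le_numeral trans_le_add2)
    qed
    then show ?case using fib_len_steps[of d] by (intro bexI[of _ "d + 2"]) auto
  next
    case 1
    have "Y (fib_len (d + 4) + fib_len (d + 2)) = W (d + 4) ** Y (fib_len (d + 2))"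
      by (rule Y_add; (rule fib_len_mono fib_len_ge_1)?; simp)
    then show ?case using pf by (intro bexI[of _ "d + 2"]) (auto simp del: fib.simps)
  next
    case 2
    have "Phi (fib_len (d + 4) + fib_len (d + 2)) = W (d + 4) ** Phi (fib_len (d + 2))"
      by (rule Phi_add; (rule fib_len_mono)?; simp)
    moreover have "X (d + 5) = W (d + 4) ** X (d + 3)" "X (d + 3) = W (d + 2) ** X (d + 1)"
      using X_rec[of "d + 3"] X_rec[of "d + 1"] by (simp_all add: numeral_eq_Suc)
    ultimately show ?case using fib_len_steps[of d] pf
      by (intro bexI[of _ "d + 1"]) (auto simp: matrix_mul_assoc simp del: fib.simps)
  next
    case 3
    have "Y (fib_len (d + 5) + fib_len (d + 1)) = W (d + 5) ** Y (fib_len (d + 1))"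
      by (rule Y_add; (rule fib_len_mono fib_len_ge_1)?; simp)
    then show ?case using pf by (intro bexI[of _ "d + 1"]) (auto simp del: fib.simps)
  next
    case 4
    have "Y (fib_len (d + 5) + fib_len (d + 3)) = W (d + 5) ** Y (fib_len (d + 3))"
      by (rule Y_add; (rule fib_len_mono fib_len_ge_1)?; simp)
    moreover have "Phi (fib_len (d + 5) + fib_len (d + 1)) = W (d + 5) ** Phi (fib_len (d + 1))"
      by (rule Phi_add; (rule fib_len_mono)?; simp)
    moreover have "X (d + 3) = W (d + 1) ** X (d + 2)"
      using X_rec'[of "d + 1"] by (simp add: numeral_eq_Suc)
    ultimately show ?case using fib_len_steps[of d] pf
      by (intro bexI[of _ "d + 2"]) (auto simp: matrix_mul_assoc simp del: fib.simps)
  next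
    case 5
    have "Phi (fib_len (d + 5) + fib_len (d + 3)) = W (d + 5) ** Phi (fib_len (d + 3))"
      by (rule Phi_add; (rule fib_len_mono)?; simp)
    moreover have "X (d + 6) = W (d + 5) ** X (d + 4)" "X (d + 4) = W (d + 3) ** X (d + 2)"
      using X_rec[of "d + 4"] X_rec[of "d + 2"] by (simp_all add: numeral_eq_Suc)
    ultimately show ?case using fib_len_steps[of d] pf
      by (intro bexI[of _ "d + 2"]) (auto simp: matrix_mul_assoc simp del: fib.simps)
  next
    case (translate i a b)
    then obtain k where k: "k \<in> {d + 1, d + 2}" "b = a + fib_len k" "Y b = Phi a ** X k" by blast
    note c = translate.hyps(2)
    have i: "2 \<le> i" "1 \<le> i" using translate.hyps(1) by auto
    have ab: "a < b" "b \<in> level_set (d + 3)" "a \<in> level_set (d + 3)" using consecD[OF c] by auto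
    define q where "q = a - fib_len i"
    define q' where "q' = b - fib_len i"
    have q: "a = fib_len i + q" "b = fib_len i + q'" "q < q'" "q' \<le> fib_len (i + 2)"
      unfolding q_def q'_def using translate.hyps(3,4) ab by linarith+
    have rec2: "fib_len (i + 2) = fib_len (i + 1) + fib_len i" by (rule fib_len_rec)
    have mem: "fib_len (i + 2) \<in> level_set (d + 3)"
      using translate.hyps(1) by (intro fib_len_in_level_set) auto
    have big: "2 \<le> fib_len (d + 1)" using fib_len_ge[of "d + 1"] d by linarith
    then have big2: "2 \<le> fib_len (d + 2)" using fib_len_steps[of d] by linarith
    \<comment> \<open>Gaps of the level set are at least 2, so the exceptional length of
      \<open>Y_shift\<close> and \<open>Phi_shift\<close> is never met.\<close>
    have ne: "z + 1 \<noteq> fib_len (i + 2)" if "z \<in> level_set (d + 3)" for z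
    proof
      assume z: "z + 1 = fib_len (i + 2)"
      then have "consec (level_set (d + 3)) z (fib_len (i + 2))"
        unfolding consec_def using mem that by auto
      then show False using consec_gap[of d z "fib_len (i + 2)"] big big2 z by linarith
    qed
    have e1: "a + 2 * fib_len (i + 1) = fib_len (i + 3) + q" "b + 2 * fib_len (i + 1) = fib_len (i + 3) + q'"
      using q fib_len_shift_bounds[of i] by linarith+
    have PA: "Phi (fib_len (i + 3) + q) = W (i + 3) ** Phi q" 
      by (rule Phi_add) (use q in auto)
    have YB: "Y (fib_len (i + 3) + q') = W (i + 3) ** Y q'" 
      by (rule Y_add) (use q in auto)
    have "Y q' = Phi q ** X k"
    proof (cases "q' \<le> fib_len (i + 1)")
      case True
      have "q' + 1 \<noteq> fib_len (i + 1)" "q + 1 \<noteq> fib_len (i + 1)"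
        using ne[of b] ne[of a] ab q rec2 by auto
      then have "Y b = W i ** Y q'" "Phi a = W i ** Phi q"
        using Y_shift[of i q'] Phi_shift[of i q] q True i by auto
      then have "W i ** Y q' = W i ** (Phi q ** X k)" using k by (simp add: matrix_mul_assoc)
      then show ?thesis using invertible_cancel W_inv i by blast
    next
      case False
      then have "fib_len (i + 2) < b" using q rec2 by linarith
      then have "fib_len (i + 2) \<le> a" by (rule consec_left_ge[OF c mem])
      define r where "r = a - fib_len (i + 2)"
      define r' where "r' = b - fib_len (i + 2)"
      have r: "a = fib_len (i + 2) + r" "b = fib_len (i + 2) + r'" "q = fib_len (i + 1) + r" "q' = fib_len (i + 1) + r'"
        "r < r'" "r' \<le> fib_len i" "fib_len i \<le> fib_len (i + 1)"
        unfolding r_def r'_def using ab q rec2 \<open>fib_len (i + 2) \<le> a\<close> fib_len_mono[of i "i + 1"] by simp_all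
      have "Y b = W (i + 2) ** Y r'" "Y q' = W (i + 1) ** Y r'"
        unfolding r(2,4) by (rule Y_add; use r i in simp)+
      moreover have "Phi a = W (i + 2) ** Phi r" "Phi q = W (i + 1) ** Phi r"
        unfolding r(1,3) by (rule Phi_add; use r i in simp)+
      ultimately have "W (i + 2) ** Y r' = W (i + 2) ** (Phi r ** X k)" using k by (simp add: matrix_mul_assoc)
      then have "Y r' = Phi r ** X k" using invertible_cancel W_inv[of "i + 2"] by auto
      then show ?thesis using \<open>Y q' = _\<close> \<open>Phi q = _\<close> by (simp add: matrix_mul_assoc)
    qed
    then have "Y (fib_len (i + 3) + q') = Phi (fib_len (i + 3) + q) ** X k"
      using PA YB by (simp add: matrix_mul_assoc)
    then show ?case unfolding e1 using k q by (intro bexI[of _ k]) auto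
  qed
qed

end

lemma abs_entry_le_max_norm: "\<bar>A $ i $ j\<bar> \<le> max_norm A"
  unfolding max_norm_def by (rule Max_ge) (auto simp: image_iff)

lemma max_norm_le: "(\<And>i j. \<bar>A $ i $ j\<bar> \<le> B) \<Longrightarrow> max_norm A \<le> B"
  unfolding max_norm_def by (subst Max_le_iff) auto

text \<open>With J = (0 1; -1 0), three symmetric matrices A, B, C have determinant tr(J A J C J B),
  and A J A = det(A) J. For C = A M' B this collapses to a multiple of tr(M' J), which sees only the
  skew part of M'; hence the factor 2 s, free of m. The symmetry of the product enters as the two
  expressions for \<open>Q\<close>.\<close>

lemma x_det_identity:
  fixes a b c d e f m s P Q S :: int
  assumes "P = (d * m - e * s) * a + d * s * b" "Q = (d * m - e * s) * b + d * s * c"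
    and "Q = (e * m - f * s) * a + e * s * b" "S = (e * m - f * s) * b + e * s * c"
    and "s = 1 \<or> s = - 1"
  shows "a * (e * S - f * Q) - b * (d * S - f * P) + c * (d * Q - e * P) =
    - 2 * s * (a * c - b * b) * (d * f - e * e)"
proof -
  have rel: "(d * m - e * s) * b + d * s * c = (e * m - f * s) * a + e * s * b" using assms by simp
  show ?thesis using assms(5)
  proof
    assume "s = 1"
    then show ?thesis using rel assms(1,2,4) by algebra
  next
    assume "s = - 1"
    then show ?thesis using rel assms(1,2,4) by algebra
  qed
qed

section \<open>Recursions and minors for the first two coordinates\<close>

context admissible
begin

definition p :: "nat \<Rightarrow> int" where "p n = Y n $ 1 $ 1"
definition r :: "nat \<Rightarrow> int" where "r n = Y n $ 2 $ 1"
definition x0 :: "nat \<Rightarrow> int" where "x0 i = X i $ 1 $ 1"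
definition x1 :: "nat \<Rightarrow> int" where "x1 i = X i $ 1 $ 2"
definition x2 :: "nat \<Rightarrow> int" where "x2 i = X i $ 2 $ 2"

lemma X_21: "1 \<le> i \<Longrightarrow> X i $ 2 $ 1 = x1 i"
proof -
  assume "1 \<le> i"
  then have "transpose (X i) $ 1 $ 2 = X i $ 1 $ 2" using X_sym by simp
  then show ?thesis by (simp only: transpose_def vec_lambda_beta x1_def)
qed

lemma p_fib_len: "1 \<le> i \<Longrightarrow> p (fib_len i) = x0 i"
  and r_fib_len: "1 \<le> i \<Longrightarrow> r (fib_len i) = x1 i"
  by (simp_all add: p_def r_def x0_def Y_fib_len X_21)

lemma x_det: "1 \<le> i \<Longrightarrow> \<bar>x0 i * x2 i - x1 i * x1 i\<bar> = 1"
  using invertible_det_int[OF X_inv[of i]] X_21[of i]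
  by (simp add: det_2 x0_def x1_def x2_def)

lemma mult_entries:
  fixes A B :: "int^2^2"
  shows "(A ** B) $ i $ j = A $ i $ 1 * B $ 1 $ j + A $ i $ 2 * B $ 2 $ j"
  by (simp add: matrix_matrix_mult_def sum_2)

lemma base_entries:
  "base_mat m $ 1 $ 1 = m" "base_mat m $ 1 $ 2 = 1" "base_mat m $ 2 $ 1 = - 1" "base_mat m $ 2 $ 2 = 0"
  "transpose (base_mat m) $ 1 $ 1 = m" "transpose (base_mat m) $ 1 $ 2 = - 1"
  "transpose (base_mat m) $ 2 $ 1 = 1" "transpose (base_mat m) $ 2 $ 2 = 0"
  by (simp_all add: base_mat_def transpose_def)

lemma Phi_inv: "invertible (Phi n)"
proof -
  have "invertible (phi W v)" for v
  proof (induction v)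
    case Nil
    then show ?case by (auto simp: phi_Nil invertible_def intro!: exI[of _ "mat 1"] matrix_mul_lid)
  next
    case (Cons x v)
    have "invertible (matrix_inv (W 1))"
      using matrix_inv_works[OF W_inv[of 1]] unfolding invertible_def by blast
    then have "invertible (phi W [x])"
      using W_inv[of 1] W_inv[of 2]
      by (cases x) (auto simp: phi_def matrix_mul_rid intro: invertible_mult_int)
    then show ?case using Cons phi_append[of W "[x]" v] by (auto intro: invertible_mult_int)
  qed
  then show ?thesis by (simp add: Phi_def)
qed

text \<open>The base matrix and its transpose both have a second column of the form (1, 0) up to
  sign. So the point of a prefix is visible in the matrix of the prefix, which links each point to
  its successor.\<close>

lemma Phi_col2: "\<exists>s. (s = 1 \<or> s = - 1) \<and> Phi n $ 1 $ 2 = s * p n \<and> Phi n $ 2 $ 2 = s * r n"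
proof (cases "N n = base_mat m")
  case True
  then show ?thesis by (intro exI[of _ 1]) (auto simp: Phi_eq mult_entries base_entries p_def r_def)
next
  case False
  then have "N n = transpose (base_mat m)" using N_cases[of n] by blast
  then show ?thesis by (intro exI[of _ "- 1"]) (auto simp: Phi_eq mult_entries base_entries p_def r_def)
qed

text \<open>The first column of \<open>Y b\<close> is \<open>Phi a\<close> applied to (x0 k, x1 k);
  the component along the second column of \<open>Phi a\<close>, that is along (p a, r a), drops out
  of the minor, and det \<open>Phi a\<close> is 1 up to sign.\<close>

lemma gap_det:
  assumes "Y b = Phi a ** X k" "1 \<le> k"
  shows "\<bar>p a * r b - r a * p b\<bar> = \<bar>x0 k\<bar>"
proof -
  obtain s where s: "s = 1 \<or> s = - 1" "Phi a $ 1 $ 2 = s * p a" "Phi a $ 2 $ 2 = s * r a"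
    using Phi_col2[of a] by blast
  let ?A = "Phi a $ 1 $ 1" and ?C = "Phi a $ 2 $ 1"
  have b: "p b = ?A * x0 k + s * p a * x1 k" "r b = ?C * x0 k + s * r a * x1 k"
    using assms X_21[of k] s by (simp_all add: p_def r_def mult_entries x0_def)
  have "\<bar>?A * (s * r a) - s * p a * ?C\<bar> = 1"
    using invertible_det_int[OF Phi_inv[of a]] s by (simp add: det_2)
  moreover have "\<bar>p a * r b - r a * p b\<bar> = \<bar>?A * (s * r a) - s * p a * ?C\<bar> * \<bar>x0 k\<bar>"
    unfolding abs_mult[symmetric] b using s(1) by (auto simp: algebra_simps abs_minus_commute)
  ultimately show ?thesis by simp
qed

text \<open>The Cayley-Hamilton relation is made explicit: the first column of
  \<open>X k ** N n ** X k\<close> is m x0 k times that of \<open>X k\<close>, plus a unit times the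
  second basis vector, which \<open>Phi a\<close> sends to (p a, r a) up to sign.\<close>

lemma equal_gaps:
  assumes "Y n = Phi a ** X k" "Y b = Phi n ** X k" "1 \<le> k"
  shows "\<exists>s. (s = 1 \<or> s = - 1) \<and> p b = m * x0 k * p n + s * p a \<and> r b = m * x0 k * r n + s * r a"
proof -
  obtain s where s: "s = 1 \<or> s = - 1" "Phi a $ 1 $ 2 = s * p a" "Phi a $ 2 $ 2 = s * r a"
    using Phi_col2[of a] by blast
  define \<delta> where "\<delta> = x0 k * x2 k - x1 k * x1 k"
  have \<delta>: "\<delta> = 1 \<or> \<delta> = - 1" using x_det[OF assms(3)] unfolding \<delta>_def by linarith
  have Yb: "Y b = Phi a ** (X k ** N n ** X k)"
    using assms Phi_eq[of n] by (simp add: matrix_mul_assoc)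
  let ?D = "X k ** N n ** X k"
  obtain t where t: "t = 1 \<or> t = - 1" "?D $ 1 $ 1 = m * x0 k * x0 k" "?D $ 2 $ 1 = m * x0 k * x1 k + t * \<delta>"
  proof -
    consider "N n = base_mat m" | "N n = transpose (base_mat m)" using N_cases by blast
    then show ?thesis
    proof cases
      case 1
      then show ?thesis using that[of "- 1"] X_21[OF assms(3)]
        by (simp add: mult_entries base_entries x0_def x1_def x2_def \<delta>_def algebra_simps)
    next
      case 2
      then show ?thesis using that[of 1] X_21[OF assms(3)]
        by (simp add: mult_entries base_entries x0_def x1_def x2_def \<delta>_def algebra_simps)
    qed
  qed
  have n: "p n = Phi a $ 1 $ 1 * x0 k + s * p a * x1 k" "r n = Phi a $ 2 $ 1 * x0 k + s * r a * x1 k"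
    using assms X_21[of k] s by (simp_all add: p_def r_def mult_entries x0_def)
  have b: "p b = Phi a $ 1 $ 1 * (m * x0 k * x0 k) + s * p a * (m * x0 k * x1 k + t * \<delta>)"
    "r b = Phi a $ 2 $ 1 * (m * x0 k * x0 k) + s * r a * (m * x0 k * x1 k + t * \<delta>)"
    unfolding p_def r_def Yb mult_entries[of "Phi a"] t(2,3) s(2,3) by (simp_all add: p_def r_def)
  have "s * t * \<delta> = 1 \<or> s * t * \<delta> = - 1" using s(1) t(1) \<delta> by auto
  moreover have "p b = m * x0 k * p n + (s * t * \<delta>) * p a" "r b = m * x0 k * r n + (s * t * \<delta>) * r a"
    unfolding b n by (simp_all add: algebra_simps)
  ultimately show ?thesis by blast
qed

text \<open>The first part is near multiplicativity: the bracket is x0 i times p q times the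
  difference of two good approximations of \<xi>. The second part says how little the slope r / p
  moves when w_i is put in front.\<close>

lemma prefix_step:
  assumes "2 \<le> i" "1 \<le> q" "q \<le> fib_len (i - 1)"
  shows "\<exists>s. (s = 1 \<or> s = - 1) \<and> p (fib_len i + q) = m * x0 i * p q + s * (x0 i * r q - x1 i * p q)"
    "\<bar>x0 i * r (fib_len i + q) - x1 i * p (fib_len i + q)\<bar> = \<bar>p q\<bar>"
proof -
  have i: "1 \<le> i" using assms by simp
  have e: "Y (fib_len i + q) = X i ** base_mat_seq m i ** Y q" using Y_add[OF assms] W_eq[of i] by simp
  define \<delta> where "\<delta> = x0 i * x2 i - x1 i * x1 i"
  have \<delta>: "\<bar>\<delta>\<bar> = 1" using x_det[OF i] unfolding \<delta>_def .
  have e': "p (fib_len i + q) = (X i ** base_mat_seq m i ** Y q) $ 1 $ 1"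
    "r (fib_len i + q) = (X i ** base_mat_seq m i ** Y q) $ 2 $ 1"
    by (simp_all only: p_def r_def e)
  obtain t where t: "t = 1 \<or> t = - 1" "p (fib_len i + q) = m * x0 i * p q + t * (x0 i * r q - x1 i * p q)"
    "r (fib_len i + q) = m * x1 i * p q + t * (x1 i * r q - x2 i * p q)"
  proof (cases "even i")
    case True
    show ?thesis
      by (rule that[of 1], simp, unfold e')
        (use True X_21[OF i] in \<open>simp_all add: p_def r_def mult_entries base_mat_seq_def base_entries
          x0_def x1_def x2_def algebra_simps\<close>)
  next
    case False
    show ?thesis
      by (rule that[of "- 1"], simp, unfold e')
        (use False X_21[OF i] in \<open>simp_all add: p_def r_def mult_entries base_mat_seq_def base_entries
          x0_def x1_def x2_def algebra_simps\<close>)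
  qed
  show "\<exists>s. (s = 1 \<or> s = - 1) \<and> p (fib_len i + q) = m * x0 i * p q + s * (x0 i * r q - x1 i * p q)"
    using t(1,2) by blast
  have "x0 i * r (fib_len i + q) - x1 i * p (fib_len i + q) = - t * \<delta> * p q"
    unfolding t(2,3) \<delta>_def by (simp add: algebra_simps)
  then show "\<bar>x0 i * r (fib_len i + q) - x1 i * p (fib_len i + q)\<bar> = \<bar>p q\<bar>"
    using t(1) \<delta> by (auto simp: abs_mult)
qed

lemma x_triple_det:
  assumes "1 \<le> l"
  shows "\<bar>x0 l * (x1 (l + 1) * x2 (l + 2) - x2 (l + 1) * x1 (l + 2)) -
    x1 l * (x0 (l + 1) * x2 (l + 2) - x2 (l + 1) * x0 (l + 2)) +
    x2 l * (x0 (l + 1) * x1 (l + 2) - x1 (l + 1) * x0 (l + 2))\<bar> = 2"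
proof -
  have e: "X (l + 2) = X (l + 1) ** base_mat_seq m (l + 1) ** X l"
    using X_rec[OF assms] W_eq[of "l + 1"] by simp
  define s :: int where "s = (if even (l + 1) then 1 else - 1)"
  have s: "s = 1 \<or> s = - 1" by (simp add: s_def)
  note X21 = X_21[of l] X_21[of "l + 1"] X_21[of "l + 2"]
  have M: "base_mat_seq m (l + 1) $ 1 $ 1 = m" "base_mat_seq m (l + 1) $ 1 $ 2 = s"
    "base_mat_seq m (l + 1) $ 2 $ 1 = - s" "base_mat_seq m (l + 1) $ 2 $ 2 = 0"
    by (auto simp: base_mat_seq_def s_def base_entries)
  have 0: "X l $ 1 $ 1 = x0 l" "X l $ 1 $ 2 = x1 l" "X l $ 2 $ 1 = x1 l" "X l $ 2 $ 2 = x2 l"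
    "X (l+1) $ 1 $ 1 = x0 (l+1)" "X (l+1) $ 1 $ 2 = x1 (l+1)" "X (l+1) $ 2 $ 1 = x1 (l+1)"
    "X (l+1) $ 2 $ 2 = x2 (l+1)"
    using X21 assms by (auto simp: x0_def x1_def x2_def)
  have ent: "X (l + 2) $ i $ j = (X (l + 1) $ i $ 1 * m - X (l + 1) $ i $ 2 * s) * X l $ 1 $ j
      + X (l + 1) $ i $ 1 * s * X l $ 2 $ j" for i j
    unfolding e mult_entries M by (simp add: algebra_simps)
  have 1: "x0 (l + 2) = (x0 (l + 1) * m - x1 (l + 1) * s) * x0 l + x0 (l + 1) * s * x1 l"
    "x1 (l + 2) = (x0 (l + 1) * m - x1 (l + 1) * s) * x1 l + x0 (l + 1) * s * x2 l"
    "x1 (l + 2) = (x1 (l + 1) * m - x2 (l + 1) * s) * x0 l + x1 (l + 1) * s * x1 l"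
    "x2 (l + 2) = (x1 (l + 1) * m - x2 (l + 1) * s) * x1 l + x1 (l + 1) * s * x2 l"
    using ent[of 1 1] ent[of 1 2] ent[of 2 1] ent[of 2 2] X21(3) unfolding 0
    unfolding x0_def[of "l+2"] x1_def[of "l+2"] x2_def[of "l+2"] by simp_all
  have "\<bar>- 2 * s * (x0 l * x2 l - x1 l * x1 l) * (x0 (l+1) * x2 (l+1) - x1 (l+1) * x1 (l+1))\<bar> = 2"
    using x_det[of l] x_det[of "l+1"] assms s by (auto simp: abs_mult)
  then show ?thesis using x_det_identity[OF 1 s] by (simp only:)
qed

lemma x_mat_pre:
  assumes "\<bar>real_of_int (r n) * \<xi> - real_of_int z\<bar> < 1 / 2"
  shows "x_point m \<xi> W (pre n) = vector [real_of_int (p n), real_of_int (r n), real_of_int z]"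
proof -
  have Yn: "phi W (pre n) ** matrix_inv (end_mat m (pre n)) = Y n"
    by (simp add: Y_def Phi_def N_def)
  have "x_mat m \<xi> W (pre n) = vector [vector [p n, r n], vector [r n, z]]" (is "_ = ?Z")
    unfolding x_mat_def Yn
  proof (rule the_equality)
    show "transpose ?Z = ?Z \<and> column 1 ?Z = column 1 (Y n) \<and>
        \<bar>real_of_int (?Z $ 1 $ 2) * \<xi> - real_of_int (?Z $ 2 $ 2)\<bar> < 1 / 2"
      using assms by (simp add: vec_eq_iff forall_2 transpose_def column_def p_def r_def)
    fix Z assume Z: "transpose Z = Z \<and> column 1 Z = column 1 (Y n) \<and>
        \<bar>real_of_int (Z $ 1 $ 2) * \<xi> - real_of_int (Z $ 2 $ 2)\<bar> < 1 / 2"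
    then have "transpose Z $ 1 $ 2 = Z $ 1 $ 2" "column 1 Z $ 1 = column 1 (Y n) $ 1"
      "column 1 Z $ 2 = column 1 (Y n) $ 2" by simp_all
    then have e: "Z $ 1 $ 1 = p n" "Z $ 2 $ 1 = r n" "Z $ 1 $ 2 = Z $ 2 $ 1"
      by (simp_all only: transpose_def column_def p_def r_def vec_lambda_beta)
    have "\<bar>real_of_int (r n) * \<xi> - real_of_int (Z $ 2 $ 2)\<bar> < 1 / 2" using Z e by simp
    then have "\<bar>real_of_int (Z $ 2 $ 2) - real_of_int z\<bar> < 1" using assms by linarith
    then have "Z $ 2 $ 2 = z" by linarith
    then show "Z = ?Z" using e by (simp add: vec_eq_iff forall_2)
  qed
  then show ?thesis by (simp add: x_point_def Let_def)
qed

section \<open>Size of the entries of W and X\<close>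

definition nrm :: "nat \<Rightarrow> real" where "nrm i = max_norm (real_mat (W i))"

lemma nrm_entry: "\<bar>real_of_int (W i $ a $ b)\<bar> \<le> nrm i"
  using abs_entry_le_max_norm[of "real_mat (W i)" a b] by (simp add: nrm_def map_matrix_def)

lemma nrm_ge_1: "1 \<le> i \<Longrightarrow> 1 \<le> nrm i"
proof -
  assume "1 \<le> i"
  then have "\<bar>det (W i)\<bar> = 1" using W_inv invertible_det_int by blast
  then have "W i $ 1 $ 1 \<noteq> 0 \<or> W i $ 1 $ 2 \<noteq> 0" by (auto simp: det_2)
  then obtain b where "W i $ 1 $ b \<noteq> 0" by auto
  then have "1 \<le> \<bar>real_of_int (W i $ 1 $ b)\<bar>" by linarith
  then show ?thesis using nrm_entry[of i 1 b] by linarith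
qed

lemma growth:
  obtains c :: real where "1 \<le> c" "\<And>i. 1 \<le> i \<Longrightarrow> nrm (i + 1) * nrm i / c \<le> nrm (i + 2)"
    "\<And>i. 1 \<le> i \<Longrightarrow> nrm (i + 2) \<le> c * (nrm (i + 1) * nrm i)"
    "\<And>i j. 1 \<le> i \<Longrightarrow> \<bar>\<xi> * real_of_int (W i $ 1 $ j) - real_of_int (W i $ 2 $ j)\<bar> \<le> c / nrm i"
proof -
  obtain c :: real where c: "1 \<le> c" "\<And>i. 1 \<le> i \<Longrightarrow>
        inverse c * (max_norm (real_mat (W (i + 1))) * max_norm (real_mat (W i)))
          \<le> max_norm (real_mat (W (i + 2))) \<and>
        max_norm (real_mat (W (i + 2)))
          \<le> c * (max_norm (real_mat (W (i + 1))) * max_norm (real_mat (W i))) \<and>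
        max_norm (rowvector (vector [\<xi>, - 1] :: real^2) ** real_mat (W i) :: real^2^1)
          \<le> c * inverse (max_norm (real_mat (W i)))"
    using adm unfolding admissible_seq_def by blast
  show ?thesis
  proof (rule that[OF c(1)])
    fix i :: nat assume i: "1 \<le> i"
    show "nrm (i + 1) * nrm i / c \<le> nrm (i + 2)" "nrm (i + 2) \<le> c * (nrm (i + 1) * nrm i)"
      using c(2)[OF i] by (auto simp: nrm_def field_simps)
    fix j
    have "\<bar>(rowvector (vector [\<xi>, - 1] :: real^2) ** real_mat (W i) :: real^2^1) $ 1 $ j\<bar> \<le> c / nrm i"
      using c(2)[OF i] abs_entry_le_max_norm[of "rowvector (vector [\<xi>, - 1] :: real^2) ** real_mat (W i) :: real^2^1" 1 j]
      by (simp add: nrm_def divide_inverse)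
    then show "\<bar>\<xi> * real_of_int (W i $ 1 $ j) - real_of_int (W i $ 2 $ j)\<bar> \<le> c / nrm i"
      by (simp add: matrix_matrix_mult_def sum_2 rowvector_def map_matrix_def)
  qed
qed

lemma nrm_unbounded: "\<exists>i\<ge>1. nrm i > B"
  using adm unfolding admissible_seq_def nrm_def by blast

lemma W_entries:
  assumes "1 \<le> i"
  obtains s :: int where "s = 1 \<or> s = - 1"
    "W i $ 1 $ 1 = m * x0 i - s * x1 i" "W i $ 1 $ 2 = s * x0 i"
    "W i $ 2 $ 1 = m * x1 i - s * x2 i" "W i $ 2 $ 2 = s * x1 i"
proof (cases "even i")
  case True
  then show ?thesis using that[of 1] X_21[OF assms]
    by (simp add: W_eq[of i] mult_entries base_mat_seq_def base_entries x0_def x1_def x2_def)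
next
  case False
  then show ?thesis using that[of "- 1"] X_21[OF assms]
    by (simp add: W_eq[of i] mult_entries base_mat_seq_def base_entries x0_def x1_def x2_def)
qed

lemma x0_le_nrm: "1 \<le> i \<Longrightarrow> \<bar>real_of_int (x0 i)\<bar> \<le> nrm i"
proof -
  assume i: "1 \<le> i"
  obtain s :: int where "s = 1 \<or> s = - 1" "W i $ 1 $ 2 = s * x0 i" using W_entries[OF i] by blast
  then show ?thesis using nrm_entry[of i 1 2] by (auto simp: abs_mult)
qed

text \<open>Condition (E3) controls the row vector (\<xi>, -1) W_i. Its second entry is x_0 \<xi> -
  x_1 up to sign; its first is m times that minus a signed x_1 \<xi> - x_2, whence the factor m +
  1.\<close>

lemma eta_theta_bound:
  obtains C :: real where "0 < C"
    "\<And>i. 1 \<le> i \<Longrightarrow> \<bar>x0 i * \<xi> - x1 i\<bar> \<le> C / nrm i"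
    "\<And>i. 1 \<le> i \<Longrightarrow> \<bar>x1 i * \<xi> - x2 i\<bar> \<le> C / nrm i"
proof -
  obtain c :: real where c: "1 \<le> c" "\<And>i j. 1 \<le> i \<Longrightarrow> \<bar>\<xi> * real_of_int (W i $ 1 $ j) - real_of_int (W i $ 2 $ j)\<bar> \<le> c / nrm i"
    by (rule growth) blast
  define C where "C = (m + 1) * c"
  have Cc: "c \<le> C" "0 < C" using m c(1) by (auto simp: C_def mult_le_cancel_right1)
  show ?thesis
  proof (rule that[OF Cc(2)])
    fix i :: nat assume i: "1 \<le> i"
    obtain s where s: "s = 1 \<or> s = - 1"
      "W i $ 1 $ 1 = m * x0 i - s * x1 i" "W i $ 1 $ 2 = s * x0 i"
      "W i $ 2 $ 1 = m * x1 i - s * x2 i" "W i $ 2 $ 2 = s * x1 i" using W_entries[OF i] by blast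
    have n: "0 < nrm i" using nrm_ge_1[OF i] by linarith
    have "\<bar>s * (x0 i * \<xi> - x1 i)\<bar> \<le> c / nrm i"
      using c(2)[OF i, of 2] unfolding s by (simp add: algebra_simps)
    then have 1: "\<bar>x0 i * \<xi> - x1 i\<bar> \<le> c / nrm i" using s(1) by auto
    then show "\<bar>x0 i * \<xi> - x1 i\<bar> \<le> C / nrm i" using Cc n by (smt (verit) divide_right_mono)
    have "\<bar>m * (x0 i * \<xi> - x1 i) - s * (x1 i * \<xi> - x2 i)\<bar> \<le> c / nrm i"
      using c(2)[OF i, of 1] unfolding s by (simp add: algebra_simps)
    moreover have "\<bar>m * (x0 i * \<xi> - x1 i)\<bar> \<le> m * (c / nrm i)"
    proof -
      have "\<bar>m * (x0 i * \<xi> - x1 i)\<bar> = m * \<bar>x0 i * \<xi> - x1 i\<bar>" using m by (simp add: abs_mult)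
      also have "\<dots> \<le> m * (c / nrm i)" using 1 m by (intro mult_left_mono) auto
      finally show ?thesis .
    qed
    ultimately have "\<bar>s * (x1 i * \<xi> - x2 i)\<bar> \<le> c / nrm i + m * (c / nrm i)" by linarith
    also have "\<dots> = C / nrm i" by (simp add: C_def algebra_simps add_divide_distrib)
    finally show "\<bar>x1 i * \<xi> - x2 i\<bar> \<le> C / nrm i" using s(1) by auto
  qed
qed

text \<open>As x_1 and x_2 are within bounded distance of multiples of x_0, a large norm forces a
  large x_0. The constants \<open>A\<close> and \<open>B\<close> collect the coefficient of |x_0|
  and the bounded remainder.\<close>

lemma x0_lower:
  obtains c I where "0 < c" "\<And>i. 1 \<le> i \<Longrightarrow> I \<le> nrm i \<Longrightarrow> c * nrm i \<le> \<bar>real_of_int (x0 i)\<bar>"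
proof -
  obtain C :: real where C: "0 < C"
    "\<And>i. 1 \<le> i \<Longrightarrow> \<bar>x0 i * \<xi> - x1 i\<bar> \<le> C / nrm i"
    "\<And>i. 1 \<le> i \<Longrightarrow> \<bar>x1 i * \<xi> - x2 i\<bar> \<le> C / nrm i" by (rule eta_theta_bound) blast
  define h where "h = \<bar>\<xi>\<bar>"
  have h: "0 \<le> h" by (simp add: h_def)
  define A where "A = (1 + h) * (1 + h) * (m + 1)"
  define B where "B = (C + (1 + h) * C) * (m + 1)"
  have A: "0 < A" using m h by (simp add: A_def)
  have B: "0 < B" using m C(1) h by (simp add: B_def add_pos_nonneg)
  have key: "nrm i \<le> A * \<bar>real_of_int (x0 i)\<bar> + B" if i: "1 \<le> i" for i
  proof -
    let ?a = "\<bar>real_of_int (x0 i)\<bar>" and ?b = "\<bar>real_of_int (x1 i)\<bar>" and ?c = "\<bar>real_of_int (x2 i)\<bar>"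
    have n: "C / nrm i \<le> C" using nrm_ge_1[OF i] C(1) by (simp add: divide_le_eq mult_le_cancel_left1)
    have "?b \<le> ?a * h + C" using C(2)[OF i] n abs_mult[of "real_of_int (x0 i)" \<xi>] unfolding h_def by linarith
    then have b: "?b \<le> (1 + h) * ?a + C" by (simp add: algebra_simps)
    have "?c \<le> ?b * h + C" using C(3)[OF i] n abs_mult[of "real_of_int (x1 i)" \<xi>] unfolding h_def by linarith
    also have "\<dots> \<le> ((1 + h) * ?a + C) * h + C" using b h by (intro add_mono mult_right_mono) auto
    finally have c: "?c \<le> (1 + h) * h * ?a + (1 + h) * C" by (simp add: algebra_simps)
    define D where "D = (1 + h) * (1 + h) * ?a + (C + (1 + h) * C)"
    have nn: "0 \<le> h * ?a" "0 \<le> h * h * ?a" "0 \<le> h * C" using C(1) h by auto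
    have De: "D = ?a + 2 * (h * ?a) + h * h * ?a + 2 * C + h * C" by (simp add: D_def algebra_simps)
    have "?b \<le> ?a + h * ?a + C" "?c \<le> h * ?a + h * h * ?a + C + h * C"
      using b c by (simp_all add: algebra_simps)
    then have D: "?a \<le> D" "?b \<le> D" "?c \<le> D"
      unfolding De using nn C(1) abs_ge_zero[of "real_of_int (x0 i)"] by linarith+
    obtain s :: int where s: "s = 1 \<or> s = - 1"
      "W i $ 1 $ 1 = m * x0 i - s * x1 i" "W i $ 1 $ 2 = s * x0 i"
      "W i $ 2 $ 1 = m * x1 i - s * x2 i" "W i $ 2 $ 2 = s * x1 i" using W_entries[OF i] by blast
    have mm: "\<bar>real_of_int (m * u - s * v)\<bar> \<le> (m + 1) * D" "\<bar>real_of_int (s * u)\<bar> \<le> (m + 1) * D"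
      if "\<bar>real_of_int u\<bar> \<le> D" "\<bar>real_of_int v\<bar> \<le> D" for u v
    proof -
      have "\<bar>real_of_int (m * u)\<bar> \<le> m * D" using m that by (simp add: abs_mult mult_left_mono)
      moreover have "\<bar>real_of_int (s * v)\<bar> \<le> D" "\<bar>real_of_int (s * u)\<bar> \<le> D" using s(1) that by auto
      moreover have "(m + 1) * D = m * D + D" by (simp add: algebra_simps)
      moreover have "0 \<le> m * D" using m that by (intro mult_nonneg_nonneg) auto
      ultimately show "\<bar>real_of_int (m * u - s * v)\<bar> \<le> (m + 1) * D" "\<bar>real_of_int (s * u)\<bar> \<le> (m + 1) * D"
        by (simp_all only: of_int_diff)
    qed
    have "\<bar>real_of_int (W i $ a $ b)\<bar> \<le> (m + 1) * D" for a b :: 2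
      using exhaust_2[of a] exhaust_2[of b] s(2-5) mm D by auto
    then have "nrm i \<le> (m + 1) * D" unfolding nrm_def by (intro max_norm_le) (simp add: map_matrix_def)
    also have "\<dots> = A * ?a + B" by (simp add: A_def B_def D_def algebra_simps)
    finally show ?thesis .
  qed
  show ?thesis
  proof (rule that[of "1 / (2 * A)" "2 * B"])
    fix i :: nat assume "1 \<le> i" "2 * B \<le> nrm i"
    then have "nrm i / 2 \<le> A * \<bar>real_of_int (x0 i)\<bar>" using key[of i] by linarith
    then show "1 / (2 * A) * nrm i \<le> \<bar>real_of_int (x0 i)\<bar>" using A by (simp add: field_simps)
  qed (use A in auto)
qed

end

section \<open>Growth of the first coordinate\<close>

text \<open>The recursion has one growing and one decaying mode, and they are treated in turn: the
  growing one determines \<rho>, the decaying one makes the remaining error summable.\<close>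

lemma fib_perturbation:
  fixes u :: "nat \<Rightarrow> real"
  assumes rec: "\<And>i. d \<le> i \<Longrightarrow> \<bar>u (i + 2) - u (i + 1) - u i\<bar> \<le> A * q ^ i"
    and q: "0 < q" "q < 1" and A: "0 \<le> A"
  shows "\<exists>\<rho>. summable (\<lambda>i. \<bar>u (i + d) - \<rho> * real (fib_len (i + d))\<bar>)"
proof -
  define \<phi> :: real where "\<phi> = (1 + sqrt 5) / 2"
  have s5: "2 < sqrt 5" "sqrt 5 < 3" by (auto intro: real_less_rsqrt real_less_lsqrt)
  have phi: "1 < \<phi>" "\<phi> < 2" using s5 by (auto simp: \<phi>_def)
  have sq: "\<phi> * (\<phi> - 1) = 1" by (simp add: \<phi>_def field_simps)
  define v where "v i = u (i + d)" for i
  define e where "e i = v (i + 2) - v (i + 1) - v i" for i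
  have e: "\<bar>e i\<bar> \<le> A * q ^ i" for i
  proof -
    have "\<bar>e i\<bar> \<le> A * q ^ (i + d)" using rec[of "i + d"] by (simp add: e_def v_def)
    also have "\<dots> \<le> A * q ^ i" using q A by (intro mult_left_mono power_decreasing) auto
    finally show ?thesis .
  qed
  \<comment> \<open>As \<phi> - 1 = 1 / \<phi>, this combination annihilates the decaying mode and
    obeys a first-order recursion with factor \<phi>.\<close>
  define s where "s i = v (i + 1) + (\<phi> - 1) * v i" for i
  have s_Suc: "s (Suc i) = \<phi> * s i + e i" for i
  proof -
    have "\<phi> * s i = \<phi> * v (i + 1) + (\<phi> * (\<phi> - 1)) * v i" by (simp add: s_def algebra_simps)
    then show ?thesis unfolding sq by (simp add: s_def e_def algebra_simps)
  qed
  define a where "a j = e j / \<phi> ^ (j + 1)" for j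
  have sg: "summable (\<lambda>j. A * q ^ j)" using q by (intro summable_mult summable_geometric) auto
  have a_le: "\<bar>a j\<bar> \<le> A * q ^ j" for j
  proof -
    have "1 \<le> \<phi> ^ (j + 1)" using phi by (intro one_le_power) auto
    then have "\<bar>a j\<bar> \<le> \<bar>e j\<bar>" by (simp add: a_def abs_divide divide_le_eq mult_le_cancel_left1)
    then show ?thesis using e[of j] by linarith
  qed
  have sa: "summable a" by (rule summable_comparison_test'[OF sg, of 0]) (use a_le in auto)
  have s_sum: "s i = \<phi> ^ i * (s 0 + sum a {..<i})" for i
  proof (induction i)
    case (Suc i)
    have "\<phi> * (\<phi> ^ i * a i) = e i" using phi by (simp add: a_def)
    then show ?case unfolding s_Suc Suc by (simp add: algebra_simps)
  qed simp
  \<comment> \<open>The limit of \<open>s i / \<phi> ^ i\<close>. Summing the tail of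
    \<open>a\<close> backwards from infinity keeps the error of \<open>s i\<close> geometric instead
    of letting it grow like \<phi>^i.\<close>
  define \<sigma> where "\<sigma> = s 0 + suminf a"
  define B where "B = A / (1 - q)"
  have tau: "\<bar>s i - \<sigma> * \<phi> ^ i\<bar> \<le> B * q ^ i" for i
  proof -
    have "suminf a = (\<Sum>j. a (j + i)) + sum a {..<i}" by (rule suminf_split_initial_segment[OF sa])
    then have "s i - \<sigma> * \<phi> ^ i = - (\<phi> ^ i * (\<Sum>j. a (j + i)))"
      unfolding s_sum[of i] \<sigma>_def by (simp add: algebra_simps)
    also have "\<dots> = - (\<Sum>j. \<phi> ^ i * a (j + i))"
      using sa by (subst suminf_mult) (auto intro: summable_ignore_initial_segment)
    finally have eq: "\<bar>s i - \<sigma> * \<phi> ^ i\<bar> = \<bar>\<Sum>j. \<phi> ^ i * a (j + i)\<bar>" by simp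
    have tm: "\<bar>\<phi> ^ i * a (j + i)\<bar> \<le> A * q ^ i * q ^ j" for j
    proof -
      have "\<phi> ^ i * a (j + i) = e (j + i) / \<phi> ^ (j + 1)" using phi by (simp add: a_def power_add field_simps)
      moreover have "1 \<le> \<phi> ^ (j + 1)" using phi by (intro one_le_power) auto
      ultimately have "\<bar>\<phi> ^ i * a (j + i)\<bar> \<le> \<bar>e (j + i)\<bar>"
        by (simp add: abs_divide divide_le_eq mult_le_cancel_left1)
      then show ?thesis using e[of "j + i"] by (simp add: power_add algebra_simps)
    qed
    have sgi: "summable (\<lambda>j. A * q ^ i * q ^ j)" using q by (intro summable_mult summable_geometric) auto
    have sabs: "summable (\<lambda>j. \<bar>\<phi> ^ i * a (j + i)\<bar>)"
      by (rule summable_comparison_test'[OF sgi, of 0]) (use tm in auto)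
    have "\<bar>\<Sum>j. \<phi> ^ i * a (j + i)\<bar> \<le> (\<Sum>j. \<bar>\<phi> ^ i * a (j + i)\<bar>)"
      by (rule summable_rabs[OF sabs])
    also have "\<dots> \<le> (\<Sum>j. A * q ^ i * q ^ j)" by (rule suminf_le[OF tm sabs sgi])
    also have "\<dots> = A * q ^ i * (1 / (1 - q))" using q by (subst suminf_mult) (auto simp: suminf_geometric)
    finally show ?thesis using eq by (simp add: B_def)
  qed
  have fib: "real (fib_len (i + 1)) + (\<phi> - 1) * real (fib_len i) = \<phi> ^ (i + 1)" for i
  proof (induction i)
    case (Suc i)
    have "real (fib_len (i + 2)) + (\<phi> - 1) * real (fib_len (i + 1))
        = \<phi> * real (fib_len (i + 1)) + (\<phi> * (\<phi> - 1)) * real (fib_len i)"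
      unfolding sq by (simp add: algebra_simps)
    also have "\<dots> = \<phi> * (real (fib_len (i + 1)) + (\<phi> - 1) * real (fib_len i))"
      by (simp add: algebra_simps)
    finally show ?case unfolding Suc by simp
  qed simp
  \<comment> \<open>Chosen so that \<rho> F_(i+d) has the same growing component \<sigma> \<phi>^i
    as v; the difference \<delta> then satisfies a contracting recursion of factor \<phi> -
    1.\<close>
  define \<rho> where "\<rho> = \<sigma> / \<phi> ^ (d + 1)"
  define \<delta> where "\<delta> i = v i - \<rho> * real (fib_len (i + d))" for i
  have dl: "\<delta> (Suc i) + (\<phi> - 1) * \<delta> i = s i - \<sigma> * \<phi> ^ i" for i
  proof -
    have "\<delta> (Suc i) + (\<phi> - 1) * \<delta> i
        = s i - \<rho> * (real (fib_len (i + d + 1)) + (\<phi> - 1) * real (fib_len (i + d)))"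
      by (simp add: \<delta>_def s_def algebra_simps)
    also have "\<dots> = s i - \<rho> * \<phi> ^ (i + d + 1)" unfolding fib[of "i + d"] ..
    also have "\<rho> * \<phi> ^ (i + d + 1) = \<sigma> * \<phi> ^ i" using phi by (simp add: \<rho>_def power_add field_simps)
    finally show ?thesis .
  qed
  have dle: "\<bar>\<delta> (Suc i)\<bar> \<le> (\<phi> - 1) * \<bar>\<delta> i\<bar> + B * q ^ i" for i
  proof -
    have "\<delta> (Suc i) = (s i - \<sigma> * \<phi> ^ i) - (\<phi> - 1) * \<delta> i" using dl[of i] by simp
    then have "\<bar>\<delta> (Suc i)\<bar> \<le> \<bar>s i - \<sigma> * \<phi> ^ i\<bar> + \<bar>(\<phi> - 1) * \<delta> i\<bar>" by linarith
    moreover have "\<bar>(\<phi> - 1) * \<delta> i\<bar> = (\<phi> - 1) * \<bar>\<delta> i\<bar>" using phi by (simp add: abs_mult)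
    ultimately show ?thesis using tau[of i] by linarith
  qed
  define G where "G = B / (1 - q)"
  have Bq: "(\<Sum>i<n. B * q ^ i) \<le> G" for n
  proof -
    have "0 \<le> B" using A q by (simp add: B_def)
    have "(\<Sum>i<n. B * q ^ i) \<le> (\<Sum>i. B * q ^ i)"
      using q \<open>0 \<le> B\<close> by (intro sum_le_suminf summable_mult summable_geometric) auto
    also have "\<dots> = G" using q by (subst suminf_mult) (auto simp: suminf_geometric G_def)
    finally show ?thesis .
  qed
  \<comment> \<open>Summing \<open>dle\<close> bounds the partial sum by \<phi> - 1 times itself
    plus a constant; absorbing it leaves the factor 2 - \<phi>.\<close>
  have "(\<Sum>i<n. \<bar>\<delta> i\<bar>) \<le> (\<bar>\<delta> 0\<bar> + G) / (2 - \<phi>)" for n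
  proof -
    have "(\<Sum>i<Suc n. \<bar>\<delta> i\<bar>) = \<bar>\<delta> 0\<bar> + (\<Sum>i<n. \<bar>\<delta> (Suc i)\<bar>)" by (rule sum.lessThan_Suc_shift)
    also have "(\<Sum>i<n. \<bar>\<delta> (Suc i)\<bar>) \<le> (\<Sum>i<n. (\<phi> - 1) * \<bar>\<delta> i\<bar> + B * q ^ i)"
      by (intro sum_mono dle)
    also have "\<dots> = (\<phi> - 1) * (\<Sum>i<n. \<bar>\<delta> i\<bar>) + (\<Sum>i<n. B * q ^ i)"
      by (simp add: sum.distrib sum_distrib_left)
    finally have "(\<Sum>i<n. \<bar>\<delta> i\<bar>) \<le> \<bar>\<delta> 0\<bar> + (\<phi> - 1) * (\<Sum>i<n. \<bar>\<delta> i\<bar>) + G"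
      using Bq[of n] by simp
    then have "(\<Sum>i<n. \<bar>\<delta> i\<bar>) * (2 - \<phi>) \<le> \<bar>\<delta> 0\<bar> + G" by (simp add: algebra_simps)
    then show ?thesis using phi by (simp add: pos_le_divide_eq)
  qed
  then have "summable (\<lambda>i. \<bar>\<delta> i\<bar>)" by (intro summableI_nonneg_bounded) auto
  then show ?thesis unfolding \<delta>_def v_def by blast
qed

lemma ln_one_plus_bound:
  fixes y :: real
  assumes "\<bar>y\<bar> \<le> 1 / 2"
  shows "\<bar>ln (1 + y)\<bar> \<le> 2 * \<bar>y\<bar>"
proof -
  have "\<bar>ln (1 + y) - y\<bar> \<le> 2 * y\<^sup>2" using assms by (rule abs_ln_one_plus_x_minus_x_bound)
  moreover have "2 * y\<^sup>2 \<le> \<bar>y\<bar>"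
    using mult_right_mono[OF assms, of "\<bar>y\<bar>"] by (simp add: power2_eq_square flip: abs_mult)
  ultimately show ?thesis by linarith
qed

context admissible
begin

lemma nrm_growth:
  obtains J where "1 \<le> J" "\<And>j. exp (real j / 2) \<le> nrm (J + j)"
proof -
  obtain c :: real where c: "1 \<le> c" "\<And>i. 1 \<le> i \<Longrightarrow> nrm (i + 1) * nrm i / c \<le> nrm (i + 2)"
    by (rule growth) blast
  define l where "l i = ln (nrm i) - ln c" for i
  have c0: "0 \<le> ln c" using c by simp
  have pos: "0 < nrm i" if "1 \<le> i" for i using nrm_ge_1[OF that] by linarith
  have l_rec: "l (i + 1) + l i \<le> l (i + 2)" if "1 \<le> i" for i
  proof -
    have "0 < nrm (i + 1)" "0 < nrm i" using pos that by auto
    then have "ln (nrm (i + 1) * nrm i / c) = ln (nrm (i + 1)) + ln (nrm i) - ln c"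
      using c(1) by (simp add: ln_div ln_mult)
    moreover have "ln (nrm (i + 1) * nrm i / c) \<le> ln (nrm (i + 2))"
      using c that pos[of "i + 2"] \<open>0 < nrm (i + 1)\<close> \<open>0 < nrm i\<close> by (intro ln_mono) auto
    ultimately show ?thesis by (simp add: l_def)
  qed
  have l_ge: "- ln c \<le> l i" if "1 \<le> i" for i using nrm_ge_1[OF that] by (simp add: l_def)
  \<comment> \<open>Two applications of \<open>l_rec\<close> lose at most 2 ln c, through the lower
    bound - ln c for \<open>l (i0 + 1)\<close>. The threshold is chosen so that two consecutive
    values of \<open>l\<close> are still at least 1.\<close>
  obtain i0 where i0: "1 \<le> i0" "nrm i0 > exp (3 * ln c + 2)" using nrm_unbounded by blast
  have "ln (exp (3 * ln c + 2)) < ln (nrm i0)" using i0 pos[of i0] by (subst ln_less_cancel_iff) auto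
  then have b: "2 * ln c + 2 \<le> l i0" by (simp add: l_def)
  define J where "J = i0 + 2"
  have "1 \<le> l J" using l_rec[of i0] l_ge[of "i0 + 1"] b i0 c0 unfolding J_def by simp
  moreover have "1 \<le> l (J + 1)"
    using l_rec[of "i0 + 1"] l_rec[of i0] l_ge[of "i0 + 1"] b i0 c0 unfolding J_def by (simp add: numeral_eq_Suc)
  ultimately have lj: "real j + 1 \<le> 2 * l (J + j) \<and> real j + 2 \<le> 2 * l (J + j + 1)" for j
  proof (induction j)
    case (Suc j)
    have "l (J + j + 1) + l (J + j) \<le> l (J + j + 2)" using l_rec[of "J + j"] by (simp add: J_def)
    then show ?case using Suc by simp
  qed simp
  show ?thesis
  proof (rule that[of J])
    fix j
    have ar: "t / 2 \<le> a" if "t + 1 \<le> 2 * (a - c')" "0 \<le> c'" for t a c' :: real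
      using that by (simp add: field_simps)
    have "real j / 2 \<le> ln (nrm (J + j))" using conjunct1[OF lj[of j]] c0 unfolding l_def by (rule ar)
    then have "exp (real j / 2) \<le> exp (ln (nrm (J + j)))" by (simp only: exp_le_cancel_iff)
    also have "\<dots> = nrm (J + j)" using pos[of "J + j"] by (simp add: J_def)
    finally show "exp (real j / 2) \<le> nrm (J + j)" .
  qed (simp add: J_def)
qed

definition h :: "nat \<Rightarrow> real" where "h n = \<xi> - real_of_int (r n) / real_of_int (p n)"

lemma x_bounds:
  obtains d C A q :: real and J :: nat where "0 < d" "0 < C" "0 < q" "q < 1" "0 < A" "1 \<le> J"
    "\<And>i. J \<le> i \<Longrightarrow> x0 i \<noteq> 0" "\<And>i. J \<le> i \<Longrightarrow> 1 / (real_of_int (x0 i))\<^sup>2 \<le> A * q ^ i"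
    "\<And>i. J \<le> i \<Longrightarrow> d * nrm i \<le> \<bar>real_of_int (x0 i)\<bar>"
    "\<And>i. J \<le> i \<Longrightarrow> \<bar>x0 i * \<xi> - x1 i\<bar> \<le> C / \<bar>real_of_int (x0 i)\<bar>"
    "\<And>i. J \<le> i \<Longrightarrow> \<bar>x1 i * \<xi> - x2 i\<bar> \<le> C / \<bar>real_of_int (x0 i)\<bar>"
proof -
  obtain J0 where J0: "1 \<le> J0" "\<And>j. exp (real j / 2) \<le> nrm (J0 + j)" by (rule nrm_growth) blast
  obtain d I where d: "0 < d" "\<And>i. 1 \<le> i \<Longrightarrow> I \<le> nrm i \<Longrightarrow> d * nrm i \<le> \<bar>real_of_int (x0 i)\<bar>"
    by (rule x0_lower) blast
  obtain C :: real where C: "0 < C"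
    "\<And>i. 1 \<le> i \<Longrightarrow> \<bar>x0 i * \<xi> - x1 i\<bar> \<le> C / nrm i"
    "\<And>i. 1 \<le> i \<Longrightarrow> \<bar>x1 i * \<xi> - x2 i\<bar> \<le> C / nrm i" by (rule eta_theta_bound) blast
  obtain k :: nat where "2 * I \<le> real k" using real_arch_simple by blast
  then have k: "I \<le> real k / 2" by linarith
  define J where "J = J0 + k"
  \<comment> \<open>The lower bound for |x_0| grows like exp (i / 2), so its inverse square decays
    like exp (- i).\<close>
  define q :: real where "q = exp (- 1)"
  define A where "A = exp (real J0) / d\<^sup>2"
  have lower: "d * exp ((real i - real J0) / 2) \<le> \<bar>real_of_int (x0 i)\<bar>" "d * nrm i \<le> \<bar>real_of_int (x0 i)\<bar>"
    if "J \<le> i" for i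
  proof -
    have i: "i = J0 + (i - J0)" "1 \<le> i" "real (i - J0) = real i - real J0" using that J0 by (auto simp: J_def)
    have n: "exp ((real i - real J0) / 2) \<le> nrm i" using J0(2)[of "i - J0"] i by simp
    have "I \<le> (real i - real J0) / 2" using k that by (simp add: J_def)
    also have "\<dots> \<le> exp ((real i - real J0) / 2)" using exp_ge_add_one_self[of "(real i - real J0) / 2"] by linarith
    finally show "d * nrm i \<le> \<bar>real_of_int (x0 i)\<bar>" using d(2)[OF i(2)] n by linarith
    then show "d * exp ((real i - real J0) / 2) \<le> \<bar>real_of_int (x0 i)\<bar>"
      using mult_left_mono[OF n, of d] d(1) by linarith
  qed
  have nz: "x0 i \<noteq> 0" if "J \<le> i" for i
  proof -
    have "0 < d * exp ((real i - real J0) / 2)" using d(1) by simp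
    then show ?thesis using lower(1)[OF that] by auto
  qed
  show ?thesis
  proof (rule that[of d C q A J])
    fix i assume i: "J \<le> i"
    then have i1: "1 \<le> i" using J0 by (simp add: J_def)
    show "x0 i \<noteq> 0" by (rule nz[OF i])
    have "(d * exp ((real i - real J0) / 2))\<^sup>2 \<le> (real_of_int (x0 i))\<^sup>2"
      using lower(1)[OF i] d(1) by (subst abs_le_square_iff[symmetric]) (simp add: abs_mult)
    moreover have "(d * exp ((real i - real J0) / 2))\<^sup>2 = d\<^sup>2 * exp (real i - real J0)"
      by (simp add: power_mult_distrib flip: exp_of_nat_mult)
    ultimately have "1 / (real_of_int (x0 i))\<^sup>2 \<le> 1 / (d\<^sup>2 * exp (real i - real J0))"
      using d(1) by (intro divide_left_mono) (auto simp: nz[OF i])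
    also have "\<dots> = A * q ^ i"
      unfolding A_def q_def exp_of_nat_mult[symmetric] by (simp add: exp_diff exp_minus field_simps)
    finally show "1 / (real_of_int (x0 i))\<^sup>2 \<le> A * q ^ i" .
    show "d * nrm i \<le> \<bar>real_of_int (x0 i)\<bar>" by (rule lower(2)[OF i])
    have "C / nrm i \<le> C / \<bar>real_of_int (x0 i)\<bar>"
      using x0_le_nrm[OF i1] nz[OF i] C(1) by (intro divide_left_mono) auto
    then show "\<bar>x0 i * \<xi> - x1 i\<bar> \<le> C / \<bar>real_of_int (x0 i)\<bar>" "\<bar>x1 i * \<xi> - x2 i\<bar> \<le> C / \<bar>real_of_int (x0 i)\<bar>"
      using C(2,3)[OF i1] by linarith+
  qed (use d C J0 in \<open>auto simp: q_def A_def J_def\<close>)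
qed

text \<open>The exact recursion reads m p(n) = (m x0 i) (m p q) (1 + y), where y is a difference of
  values of \<open>h\<close> divided by m, up to sign. Multiplying coordinates by m thus turns the
  logarithm into an almost additive function.\<close>

lemma prefix_step_real:
  assumes i: "2 \<le> i" "1 \<le> q" "q \<le> fib_len (i - 1)" and nz: "x0 i \<noteq> 0" "p q \<noteq> 0"
    and h: "\<bar>h (fib_len i)\<bar> \<le> 1 / 4" "\<bar>h q\<bar> \<le> 1 / 4"
  shows "p (fib_len i + q) \<noteq> 0"
    "\<bar>h (fib_len i + q)\<bar> \<le> \<bar>h (fib_len i)\<bar> + 2 / (real_of_int (x0 i))\<^sup>2"
    "\<bar>ln (m * \<bar>real_of_int (p (fib_len i + q))\<bar>) - ln (m * \<bar>real_of_int (x0 i)\<bar>) - ln (m * \<bar>real_of_int (p q)\<bar>)\<bar>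
      \<le> 2 * (\<bar>h (fib_len i)\<bar> + \<bar>h q\<bar>)"
proof -
  let ?n = "fib_len i + q"
  let ?x = "real_of_int (x0 i)" and ?p = "real_of_int (p q)" and ?pn = "real_of_int (p ?n)"
  obtain s where s: "s = 1 \<or> s = - 1" "p ?n = m * x0 i * p q + s * (x0 i * r q - x1 i * p q)"
    using prefix_step(1)[OF i] by blast
  have hi: "h (fib_len i) = \<xi> - x1 i / x0 i" using i by (simp add: h_def p_fib_len r_fib_len)
  define y where "y = s * (h (fib_len i) - h q) / m"
  have m1: "1 \<le> real_of_int m" using m by simp
  have "?pn = m * ?x * ?p + s * (?x * r q - x1 i * ?p)" using s(2) by simp
  also have "?x * r q - x1 i * ?p = ?x * ?p * (h (fib_len i) - h q)"
    using nz by (simp add: hi h_def[of q] field_simps)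
  finally have "?pn = ?x * ?p * (m + s * (h (fib_len i) - h q))" by (simp add: algebra_simps)
  also have "m + s * (h (fib_len i) - h q) = m * (1 + y)" using m1 by (simp add: y_def field_simps)
  finally have pn: "?pn = m * ?x * ?p * (1 + y)" by (simp only: ac_simps)
  have "\<bar>y\<bar> = \<bar>h (fib_len i) - h q\<bar> / m" using s(1) m1 by (auto simp: y_def abs_mult abs_divide)
  also have "\<dots> \<le> \<bar>h (fib_len i) - h q\<bar>" using m1 by (simp add: divide_le_eq mult_le_cancel_left1)
  finally have y: "\<bar>y\<bar> \<le> \<bar>h (fib_len i)\<bar> + \<bar>h q\<bar>" by linarith
  then have y2: "\<bar>y\<bar> \<le> 1 / 2" using h by linarith
  then have y3: "1 / 2 \<le> 1 + y" by linarith
  show pnz: "p ?n \<noteq> 0" using pn nz m1 y3 by auto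
  have "m * \<bar>?pn\<bar> = (m * \<bar>?x\<bar>) * (m * \<bar>?p\<bar>) * (1 + y)"
    unfolding pn using m1 y3 by (simp add: abs_mult)
  then have "ln (m * \<bar>?pn\<bar>) = ln (m * \<bar>?x\<bar>) + ln (m * \<bar>?p\<bar>) + ln (1 + y)"
    using m1 y3 nz by (simp add: ln_mult)
  then show "\<bar>ln (m * \<bar>?pn\<bar>) - ln (m * \<bar>?x\<bar>) - ln (m * \<bar>?p\<bar>)\<bar> \<le> 2 * (\<bar>h (fib_len i)\<bar> + \<bar>h q\<bar>)"
    using ln_one_plus_bound[OF y2] y by simp
  have "\<bar>h (fib_len i) - h ?n\<bar> = \<bar>?x * r ?n - x1 i * ?pn\<bar> / (\<bar>?x\<bar> * \<bar>?pn\<bar>)"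
    unfolding hi h_def[of ?n] using nz pnz by (simp add: field_simps flip: abs_mult abs_divide)
  also have "\<bar>?x * r ?n - x1 i * ?pn\<bar> = \<bar>?p\<bar>"
    using prefix_step(2)[OF i] by (metis of_int_abs of_int_diff of_int_mult)
  also have "\<bar>?p\<bar> / (\<bar>?x\<bar> * \<bar>?pn\<bar>) \<le> 2 / ?x\<^sup>2"
  proof -
    have "\<bar>?x\<bar> * \<bar>?p\<bar> * (1 / 2) \<le> m * \<bar>?x\<bar> * \<bar>?p\<bar> * (1 + y)"
      using m1 y3 by (intro mult_mono) (auto simp: mult_le_cancel_right1)
    also have "\<dots> = \<bar>?pn\<bar>" unfolding pn using m1 y3 by (simp add: abs_mult)
    finally have "\<bar>?x\<bar> * (\<bar>?x\<bar> * \<bar>?p\<bar> * (1 / 2)) \<le> \<bar>?x\<bar> * \<bar>?pn\<bar>" by (intro mult_left_mono) auto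
    then show ?thesis using nz pnz by (simp add: divide_le_eq le_divide_eq power2_eq_square field_simps abs_mult_self_eq)
  qed
  finally show "\<bar>h ?n\<bar> \<le> \<bar>h (fib_len i)\<bar> + 2 / ?x\<^sup>2" by linarith
qed

lemma asymptotics:
  obtains \<rho> K :: real and d :: nat where "0 < \<rho>" "1 \<le> d" "0 < K"
    "\<And>i n. zeck d i n \<Longrightarrow> p n \<noteq> 0 \<and> \<bar>ln \<bar>real_of_int (p n)\<bar> - \<rho> * real n\<bar> \<le> K"
    "\<And>i. d \<le> i \<Longrightarrow> x0 i \<noteq> 0 \<and> \<bar>ln \<bar>real_of_int (x0 i)\<bar> - \<rho> * real (fib_len i)\<bar> \<le> K \<and>
      \<bar>x0 i * \<xi> - x1 i\<bar> \<le> K / \<bar>real_of_int (x0 i)\<bar> \<and> \<bar>x1 i * \<xi> - x2 i\<bar> \<le> K / \<bar>real_of_int (x0 i)\<bar>"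
proof -
  obtain c C A q :: real and J :: nat where c: "0 < c" "0 < C" "0 < q" "q < 1" "0 < A" "1 \<le> J"
    and nz: "\<And>i. J \<le> i \<Longrightarrow> x0 i \<noteq> 0" and sq: "\<And>i. J \<le> i \<Longrightarrow> 1 / (real_of_int (x0 i))\<^sup>2 \<le> A * q ^ i"
    and low: "\<And>i. J \<le> i \<Longrightarrow> c * nrm i \<le> \<bar>real_of_int (x0 i)\<bar>"
    and eta: "\<And>i. J \<le> i \<Longrightarrow> \<bar>x0 i * \<xi> - x1 i\<bar> \<le> C / \<bar>real_of_int (x0 i)\<bar>"
    and theta: "\<And>i. J \<le> i \<Longrightarrow> \<bar>x1 i * \<xi> - x2 i\<bar> \<le> C / \<bar>real_of_int (x0 i)\<bar>"
    by (rule x_bounds) blast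
  \<comment> \<open>The summand C covers the slope error at F_i, the summand 2 the displacement in
    \<open>prefix_step_real\<close>. Hence \<open>G i\<close> bounds |h n| for every n with top
    digit i, regardless of its lower digits.\<close>
  define G where "G i = (C + 2) * (1 / (real_of_int (x0 i))\<^sup>2)" for i
  have G0: "0 \<le> G i" for i using c by (simp add: G_def)
  have Gq: "G i \<le> (C + 2) * A * q ^ i" if "J \<le> i" for i
    using mult_left_mono[OF sq[OF that], of "C + 2"] c by (simp add: G_def mult.assoc)
  have hG: "\<bar>h (fib_len i)\<bar> + 2 / (real_of_int (x0 i))\<^sup>2 \<le> G i" if "J \<le> i" for i
  proof -
    have "h (fib_len i) = (x0 i * \<xi> - x1 i) / x0 i"
      using nz[OF that] that c by (simp add: h_def p_fib_len r_fib_len field_simps)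
    then have "\<bar>h (fib_len i)\<bar> \<le> C / \<bar>real_of_int (x0 i)\<bar> / \<bar>real_of_int (x0 i)\<bar>"
      using divide_right_mono[OF eta[OF that], of "\<bar>real_of_int (x0 i)\<bar>"] by (simp add: abs_divide)
    also have "\<dots> = C * (1 / (real_of_int (x0 i))\<^sup>2)" by (simp add: power2_eq_square abs_mult_self_eq)
    finally show ?thesis by (simp add: G_def algebra_simps add_divide_distrib)
  qed
  have "(\<lambda>i. (C + 2) * A * q ^ i) \<longlonglongrightarrow> (C + 2) * A * 0"
    using c by (intro tendsto_mult_left LIMSEQ_realpow_zero) auto
  then have "\<forall>\<^sub>F i in sequentially. (C + 2) * A * q ^ i < 1 / 4"
    by (rule order_tendstoD) simp
  then obtain d1 where d1: "\<And>i. d1 \<le> i \<Longrightarrow> (C + 2) * A * q ^ i < 1 / 4"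
    by (auto simp: eventually_sequentially)
  define d where "d = max d1 (max J 2)"
  have d: "2 \<le> d" "J \<le> d" by (auto simp: d_def)
  have G4: "G i \<le> 1 / 4" if "d \<le> i" for i using Gq[of i] d1[of i] that by (simp add: d_def)
  have hi: "\<bar>h (fib_len i)\<bar> \<le> G i" if "d \<le> i" for i
  proof -
    have "0 \<le> 2 / (real_of_int (x0 i))\<^sup>2" by simp
    then show ?thesis using hG[of i] that d by linarith
  qed
  define u where "u i = ln (m * \<bar>real_of_int (x0 i)\<bar>)" for i
  define U where "U n = ln (m * \<bar>real_of_int (p n)\<bar>)" for n
  have m1: "1 \<le> real_of_int m" using m by simp
  have Uu: "U (fib_len i) = u i" if "d \<le> i" for i using that d by (simp add: U_def u_def p_fib_len)
  have rec: "\<bar>u (i + 2) - u (i + 1) - u i\<bar> \<le> 4 * ((C + 2) * A) * q ^ i" if "d \<le> i" for i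
  proof -
    have i: "J \<le> i" "1 \<le> i" "d \<le> i" "d \<le> i + 1" using that d by auto
    have "\<bar>U (fib_len (i + 1) + fib_len i) - u (i + 1) - U (fib_len i)\<bar>
        \<le> 2 * (\<bar>h (fib_len (i + 1))\<bar> + \<bar>h (fib_len i)\<bar>)"
      unfolding U_def u_def
      by (rule prefix_step_real(3))
        (use i hi[OF i(3)] hi[OF i(4)] G4[OF i(3)] G4[OF i(4)] nz[of i] nz[of "i + 1"] fib_len_ge_1[of i] in
          \<open>auto simp: p_fib_len simp del: fib.simps\<close>)
    also have "\<dots> \<le> 2 * (G (i + 1) + G i)" using hi[OF i(3)] hi[OF i(4)] by (intro mult_left_mono add_mono) auto
    also have "\<dots> \<le> 2 * ((C + 2) * A * q ^ i + (C + 2) * A * q ^ i)"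
    proof -
      have "(C + 2) * A * q ^ (i + 1) \<le> (C + 2) * A * q ^ i"
        using c by (intro mult_left_mono power_decreasing) auto
      then show ?thesis using Gq[of i] Gq[of "i + 1"] i by (intro mult_left_mono add_mono) auto
    qed
    also have "fib_len (i + 1) + fib_len i = fib_len (i + 2)" by simp
    finally show ?thesis using Uu[of i] Uu[of "i + 2"] i by (simp add: algebra_simps)
  qed
  obtain \<rho> where sum\<delta>: "summable (\<lambda>i. \<bar>u (i + d) - \<rho> * real (fib_len (i + d))\<bar>)"
    using fib_perturbation[of d u "4 * ((C + 2) * A)" q, OF rec] c by auto
  define E where "E i = \<bar>u (i + d) - \<rho> * real (fib_len (i + d))\<bar> + 4 * G (i + d)" for i
  have E0: "0 \<le> E i" for i using G0[of "i + d"] by (simp add: E_def)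
  have sumE: "summable E"
    unfolding E_def
  proof (intro summable_add sum\<delta> summable_mult)
    show "summable (\<lambda>i. G (i + d))"
    proof (rule summable_comparison_test'[of "\<lambda>i. (C + 2) * A * q ^ (i + d)" 0])
      show "summable (\<lambda>i. (C + 2) * A * q ^ (i + d))"
        using c by (intro summable_mult summable_ignore_initial_segment summable_geometric) auto
      show "norm (G (i + d)) \<le> (C + 2) * A * q ^ (i + d)" if "0 \<le> i" for i
        using Gq[of "i + d"] G0[of "i + d"] d by simp
    qed
  qed
  define K1 where "K1 = suminf E"
  have K1: "(\<Sum>k<n. E k) \<le> K1" for n unfolding K1_def by (intro sum_le_suminf sumE) (auto simp: E0)
  \<comment> \<open>The term 2 G i is a reserve. Putting a digit i on top of one with top digit j
    costs 2 G i + 2 G j besides the error of u_i: the part 2 G j is paid by the old reserve, while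
    the 4 G i inside E pays the new error and the new reserve. Distinct digits use distinct terms of
    E.\<close>
  have zb: "p n \<noteq> 0 \<and> \<bar>h n\<bar> \<le> G i \<and> \<bar>U n - \<rho> * real n\<bar> + 2 * G i \<le> (\<Sum>k<Suc (i - d). E k)"
    if "zeck d i n" for i n
    using that
  proof (induction rule: zeck.induct)
    case (base i)
    have "E (i - d) \<le> (\<Sum>k<Suc (i - d). E k)" using E0 by (intro member_le_sum) auto
    moreover have "E (i - d) = \<bar>u i - \<rho> * real (fib_len i)\<bar> + 4 * G i" using base by (simp add: E_def)
    moreover have "p (fib_len i) \<noteq> 0" using base nz[of i] d by (simp add: p_fib_len)
    ultimately show ?case using Uu[OF base] hi[OF base] G0[of i] by auto
  next
    case (step j q' i)
    have zj: "d \<le> j" "fib_len j \<le> q'" "q' < fib_len (j + 1)" using zeck_bounds[OF step(1)] d by auto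
    then have i: "2 \<le> i" "d \<le> i" "J \<le> i" using step d by auto
    have "fib_len (j + 1) \<le> fib_len (i - 1)" using step by (intro fib_len_mono) auto
    then have q': "1 \<le> q'" "q' \<le> fib_len (i - 1)" using zj fib_len_ge_1[of j] by linarith+
    have hq: "\<bar>h q'\<bar> \<le> 1 / 4" "\<bar>h (fib_len i)\<bar> \<le> 1 / 4"
      using step G4[OF zj(1)] hi[OF i(2)] G4[OF i(2)] by linarith+
    note ps = prefix_step_real[OF i(1) q' nz[OF i(3)] _ hq(2,1)]
    have "\<bar>U (fib_len i + q') - u i - U q'\<bar> \<le> 2 * (\<bar>h (fib_len i)\<bar> + \<bar>h q'\<bar>)"
      unfolding U_def u_def using ps(3) step by blast
    also have "\<dots> \<le> 2 * (G i + G j)" using step hi[OF i(2)] by (intro mult_left_mono add_mono) auto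
    finally have a: "\<bar>U (fib_len i + q') - u i - U q'\<bar> \<le> 2 * G i + 2 * G j" by simp
    have "\<bar>U (fib_len i + q') - \<rho> * real (fib_len i + q')\<bar>
        \<le> \<bar>U (fib_len i + q') - u i - U q'\<bar> + \<bar>u i - \<rho> * real (fib_len i)\<bar> + \<bar>U q' - \<rho> * real q'\<bar>"
      by (simp add: algebra_simps)
    moreover have "E (i - d) = \<bar>u i - \<rho> * real (fib_len i)\<bar> + 4 * G i" using i by (simp add: E_def)
    moreover have "(\<Sum>k<Suc (j - d). E k) + E (i - d) \<le> (\<Sum>k<Suc (i - d). E k)"
    proof -
      have "(\<Sum>k<Suc (j - d). E k) \<le> (\<Sum>k<i - d. E k)"
        by (rule sum_mono2) (use step zj E0 in auto)
      then show ?thesis by simp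
    qed
    ultimately have "\<bar>U (fib_len i + q') - \<rho> * real (fib_len i + q')\<bar> + 2 * G i \<le> (\<Sum>k<Suc (i - d). E k)"
      using a step by linarith
    moreover have "p (fib_len i + q') \<noteq> 0" using ps(1) step by blast
    moreover have "\<bar>h (fib_len i + q')\<bar> \<le> G i" using ps(2) step hG[OF i(3)] by force
    ultimately show ?case by blast
  qed
  define K where "K = K1 + ln m + C + 1"
  have K1p: "0 \<le> K1" using K1[of 0] by simp
  have lnm: "0 \<le> ln m" using m1 by simp
  have Kp: "0 < K" "C \<le> K" using K1p lnm c by (auto simp: K_def)
  have main: "p n \<noteq> 0 \<and> \<bar>ln \<bar>real_of_int (p n)\<bar> - \<rho> * real n\<bar> \<le> K" if "zeck d i n" for i n
  proof -
    have nzp: "p n \<noteq> 0" using zb[OF that] by blast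
    have "\<bar>U n - \<rho> * real n\<bar> \<le> K1" using zb[OF that] K1[of "Suc (i - d)"] G0[of i] by linarith
    moreover have "U n = ln m + ln \<bar>real_of_int (p n)\<bar>" using nzp m1 by (simp add: U_def ln_mult)
    ultimately have "\<bar>ln \<bar>real_of_int (p n)\<bar> - \<rho> * real n\<bar> \<le> K1 + ln m" using lnm by linarith
    then show ?thesis using nzp c by (simp add: K_def)
  qed
  have xmain: "x0 i \<noteq> 0 \<and> \<bar>ln \<bar>real_of_int (x0 i)\<bar> - \<rho> * real (fib_len i)\<bar> \<le> K" if "d \<le> i" for i
    using main[OF zeck.base[OF that]] that d by (simp add: p_fib_len)
  \<comment> \<open>Otherwise x_0, and with it the norm, would stay bounded, against the
    unboundedness of W.\<close>
  have rho: "0 < \<rho>"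
  proof (rule ccontr)
    assume "\<not> 0 < \<rho>"
    then have r0: "\<rho> * real (fib_len i) \<le> 0" for i by (simp add: mult_nonpos_nonneg)
    have le: "nrm i \<le> exp K / c" if "d \<le> i" for i
    proof -
      have "ln \<bar>real_of_int (x0 i)\<bar> \<le> K" using xmain[OF that] r0[of i] by linarith
      then have "exp (ln \<bar>real_of_int (x0 i)\<bar>) \<le> exp K" by simp
      then have "\<bar>real_of_int (x0 i)\<bar> \<le> exp K" using xmain[OF that] by simp
      then have "c * nrm i \<le> exp K" using low[of i] that d by linarith
      then show ?thesis using c by (simp add: le_divide_eq mult.commute)
    qed
    have "nrm i \<le> exp K / c + (\<Sum>k<d. \<bar>nrm k\<bar>)" for i
    proof (cases "d \<le> i")
      case True
      have "0 \<le> (\<Sum>k<d. \<bar>nrm k\<bar>)" by (rule sum_nonneg) simp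
      then show ?thesis using le[OF True] by linarith
    next
      case False
      then have "\<bar>nrm i\<bar> \<le> (\<Sum>k<d. \<bar>nrm k\<bar>)" by (intro member_le_sum) auto
      moreover have "0 \<le> exp K / c" using c by simp
      ultimately show ?thesis by linarith
    qed
    moreover obtain i where "nrm i > exp K / c + (\<Sum>k<d. \<bar>nrm k\<bar>)" using nrm_unbounded by blast
    ultimately show False by (meson linorder_not_le)
  qed
  show ?thesis
  proof (rule that[OF rho _ Kp(1) main])
    show "1 \<le> d" using d by simp
    fix i assume i: "d \<le> i"
    have "C / \<bar>real_of_int (x0 i)\<bar> \<le> K / \<bar>real_of_int (x0 i)\<bar>" using Kp by (intro divide_right_mono) auto
    moreover have "J \<le> i" using i d by simp
    ultimately show "x0 i \<noteq> 0 \<and> \<bar>ln \<bar>real_of_int (x0 i)\<bar> - \<rho> * real (fib_len i)\<bar> \<le> K \<and>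
      \<bar>x0 i * \<xi> - x1 i\<bar> \<le> K / \<bar>real_of_int (x0 i)\<bar> \<and> \<bar>x1 i * \<xi> - x2 i\<bar> \<le> K / \<bar>real_of_int (x0 i)\<bar>"
      using xmain[OF i] eta[of i] theta[of i] by (meson order_trans)
  qed
qed

end

section \<open>Determinants and the third coordinate\<close>

lemma consec_next:
  assumes "n \<in> level_set l"
  obtains b where "consec (level_set l) n b"
proof -
  let ?Q = "\<lambda>z. z \<in> level_set l \<and> n < z"
  have "?Q (fib_len (l + n + 2))"
    using fib_len_ge[of "l + n + 2"] fib_len_in_level_set[of "l + n + 2" l] by auto
  then have "?Q (Least ?Q)" by (rule LeastI)
  moreover have "\<not> (n < z \<and> z < Least ?Q)" if "z \<in> level_set l" for z
    using not_less_Least[of z ?Q] that by blast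
  ultimately show ?thesis using that[of "Least ?Q"] assms unfolding consec_def by blast
qed

lemma consec_prev:
  assumes "n \<in> level_set l" "a \<in> level_set l" "a < n"
  obtains a' where "consec (level_set l) a' n" "a \<le> a'"
proof -
  let ?Q = "{z \<in> level_set l. z < n}"
  have fin: "finite ?Q" by simp
  have mem: "Max ?Q \<in> ?Q" using Max_in[OF fin] assms by blast
  moreover have "z \<le> Max ?Q" if "z \<in> ?Q" for z using Max_ge[OF fin that] .
  ultimately have "consec (level_set l) (Max ?Q) n" "a \<le> Max ?Q"
    using assms unfolding consec_def by (auto simp: not_less)
  then show ?thesis using that by blast
qed

lemma level_set_gap:
  assumes "a \<in> level_set (d + 3)" "b \<in> level_set (d + 3)" "a < b"
  shows "a + fib_len (d + 1) \<le> b"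
proof -
  obtain a' where "consec (level_set (d + 3)) a' b" "a \<le> a'" using consec_prev assms by blast
  then show ?thesis using consec_gap[of d a' b] fib_len_mono[of "d + 1" "d + 2"] by auto
qed

lemma zeck_mono: "zeck d i n \<Longrightarrow> d' \<le> d \<Longrightarrow> zeck d' i n"
  by (induction rule: zeck.induct) (auto intro: zeck.intros)

lemma fib_len_inj: "fib_len i = fib_len j \<Longrightarrow> 1 \<le> i \<Longrightarrow> 1 \<le> j \<Longrightarrow> i = j"
  using fib_len_less_iff by (metis less_irrefl nat_neq_iff)

text \<open>The assumption \<open>large\<close> bundles the finitely many thresholds of
  \<open>E_large\<close>. Its summands are nonnegative, so each is bounded separately;
  \<open>exp K\<close>, \<open>K + 3\<close> and the repeated bracket are the later
  \<open>k\<close>, \<open>T\<close> and \<open>B\<close>.\<close>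

locale asymptotic = admissible +
  fixes \<rho> K :: real and d0 :: nat
  assumes rho: "0 < \<rho>" and d0: "1 \<le> d0" and K: "0 < K"
    and p_ln: "\<And>i n. zeck d0 i n \<Longrightarrow> p n \<noteq> 0 \<and> \<bar>ln \<bar>real_of_int (p n)\<bar> - \<rho> * real n\<bar> \<le> K"
    and x_ln: "\<And>i. d0 \<le> i \<Longrightarrow> x0 i \<noteq> 0 \<and> \<bar>ln \<bar>real_of_int (x0 i)\<bar> - \<rho> * real (fib_len i)\<bar> \<le> K \<and>
      \<bar>x0 i * \<xi> - x1 i\<bar> \<le> K / \<bar>real_of_int (x0 i)\<bar> \<and> \<bar>x1 i * \<xi> - x2 i\<bar> \<le> K / \<bar>real_of_int (x0 i)\<bar>"
    and large: "2 * (4 * (m + 1) * (K + 3) * exp K ^ 2 + (2 * exp K ^ 3 + K * exp K ^ 2) * exp K ^ 3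
      + \<bar>\<xi>\<bar> * exp K ^ 2 * (2 * exp K ^ 3 + K * exp K ^ 2) + 1) \<le> exp (\<rho> * real (fib_len d0))"
begin

definition k :: real where "k = exp K"
definition E :: "nat \<Rightarrow> real" where "E n = exp (\<rho> * real n)"
text \<open>The bound K serves the Fibonacci lengths, the bound 3 all other points, where it comes
  from a determinant of absolute value 2.\<close>

definition T :: real where "T = K + 3"
definition B :: real where "B = 2 * k ^ 3 + K * k ^ 2"

lemma k1: "1 < k" using K by (simp add: k_def)
lemma E_pos [simp]: "0 < E n" by (simp add: E_def)
lemma E_nonneg [simp]: "0 \<le> E n" "E n \<noteq> 0" by (simp_all add: E_def)
lemma E_add: "E (a + b) = E a * E b" by (simp add: E_def algebra_simps exp_add)
lemma E_mono: "a \<le> b \<Longrightarrow> E a \<le> E b" using rho by (simp add: E_def)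
lemma T3: "3 < T" "K < T" using K by (auto simp: T_def)
lemma B_pos: "0 < B" using K k1 by (simp add: B_def add_pos_pos)

lemma E_large:
  assumes "d0 \<le> i"
  shows "8 * (m + 1) * T * k ^ 2 \<le> E (fib_len i)" "2 * B * k ^ 3 \<le> E (fib_len i)"
    "2 * \<bar>\<xi>\<bar> * k ^ 2 * B \<le> E (fib_len i)" "2 \<le> E (fib_len i)"
proof -
  have "E (fib_len d0) \<le> E (fib_len i)" using assms by (intro E_mono fib_len_mono)
  moreover have "2 * (4 * (m + 1) * T * k ^ 2 + B * k ^ 3 + \<bar>\<xi>\<bar> * k ^ 2 * B + 1) \<le> E (fib_len d0)"
    using large by (simp add: T_def k_def B_def E_def)
  moreover have "0 \<le> 4 * (m + 1) * T * k ^ 2" "0 \<le> B * k ^ 3" "0 \<le> \<bar>\<xi>\<bar> * k ^ 2 * B"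
    using m T3 B_pos k1 by auto
  ultimately show "8 * (m + 1) * T * k ^ 2 \<le> E (fib_len i)" "2 * B * k ^ 3 \<le> E (fib_len i)"
    "2 * \<bar>\<xi>\<bar> * k ^ 2 * B \<le> E (fib_len i)" "2 \<le> E (fib_len i)" by (simp_all add: algebra_simps)
qed

lemma ln_bounds:
  fixes y :: real
  assumes "y \<noteq> 0" "\<bar>ln \<bar>y\<bar> - \<rho> * real n\<bar> \<le> K"
  shows "\<bar>y\<bar> \<le> k * E n" "E n \<le> k * \<bar>y\<bar>"
proof -
  have "exp (ln \<bar>y\<bar>) \<le> exp (K + \<rho> * real n)" "exp (\<rho> * real n) \<le> exp (K + ln \<bar>y\<bar>)"
    unfolding exp_le_cancel_iff using assms(2) by linarith+
  then show "\<bar>y\<bar> \<le> k * E n" "E n \<le> k * \<bar>y\<bar>" using assms(1) by (simp_all add: exp_add k_def E_def)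
qed

lemma x0_bounds:
  assumes "d0 \<le> i"
  shows "x0 i \<noteq> 0" "\<bar>real_of_int (x0 i)\<bar> \<le> k * E (fib_len i)" "E (fib_len i) \<le> k * \<bar>real_of_int (x0 i)\<bar>"
  using x_ln[OF assms] ln_bounds[of "real_of_int (x0 i)" "fib_len i"] by auto

lemma p_bounds:
  assumes "n \<in> level_set (d0 + 3)"
  shows "p n \<noteq> 0" "\<bar>real_of_int (p n)\<bar> \<le> k * E n" "E n \<le> k * \<bar>real_of_int (p n)\<bar>"
proof -
  obtain i where "zeck d0 i n" using level_set_imp_zeck[OF assms d0] by blast
  then show "p n \<noteq> 0" "\<bar>real_of_int (p n)\<bar> \<le> k * E n" "E n \<le> k * \<bar>real_of_int (p n)\<bar>"
    using p_ln ln_bounds[of "real_of_int (p n)" n] by auto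
qed

text \<open>The difference of slopes is the minor x0 i over p a p b. Since E b = E a E(F_i), the
  size of x0 i cancels against that of the gap and only E(a)^2 is left.\<close>

lemma h_diff:
  assumes "consec (level_set (d0 + 3)) a b"
  shows "\<bar>h a - h b\<bar> \<le> k ^ 3 / (E a)\<^sup>2" "1 / (k ^ 3 * (E a)\<^sup>2) \<le> \<bar>h a - h b\<bar>"
proof -
  obtain i where i: "i \<in> {d0 + 1, d0 + 2}" "b = a + fib_len i" "Y b = Phi a ** X i"
    using consec_gap_matrix[OF assms d0] by blast
  have i0: "d0 \<le> i" "1 \<le> i" using i d0 by auto
  have ab: "a \<in> level_set (d0 + 3)" "b \<in> level_set (d0 + 3)" using consecD[OF assms] by auto
  let ?a = "\<bar>real_of_int (p a)\<bar>" and ?b = "\<bar>real_of_int (p b)\<bar>" and ?x = "\<bar>real_of_int (x0 i)\<bar>"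
  note pa = p_bounds[OF ab(1)] and pb = p_bounds[OF ab(2)] and xb = x0_bounds[OF i0(1)]
  have "\<bar>h a - h b\<bar> = \<bar>p a * r b - r a * p b\<bar> / (?a * ?b)"
    using pa(1) pb(1) by (simp add: h_def field_simps flip: abs_mult abs_divide)
  also have "real_of_int \<bar>p a * r b - r a * p b\<bar> = ?x" using gap_det[OF i(3) i0(2)] by simp
  finally have eq: "\<bar>h a - h b\<bar> = ?x / (?a * ?b)" by simp
  have Eb: "E b = E a * E (fib_len i)" unfolding i(2) by (rule E_add)
  have pos: "0 < ?a" "0 < ?b" "0 < ?x" "0 < k" using pa(1) pb(1) xb(1) k1 by auto
  have "?x * (E a * E b) \<le> (k * E (fib_len i)) * ((k * ?a) * (k * ?b))"
    using xb pa pb pos by (intro mult_mono) auto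
  then have "?x * (E a)\<^sup>2 * E (fib_len i) \<le> k ^ 3 * (?a * ?b) * E (fib_len i)"
    unfolding Eb by (simp add: power2_eq_square power3_eq_cube algebra_simps)
  then have "?x * (E a)\<^sup>2 \<le> k ^ 3 * (?a * ?b)" by (rule mult_right_le_imp_le) simp
  then show "\<bar>h a - h b\<bar> \<le> k ^ 3 / (E a)\<^sup>2" unfolding eq using pos by (simp add: field_simps)
  have "E (fib_len i) * (?a * ?b) \<le> (k * ?x) * ((k * E a) * (k * E b))"
    using xb pa pb pos by (intro mult_mono) auto
  then have "(?a * ?b) * E (fib_len i) \<le> (?x * (k ^ 3 * (E a)\<^sup>2)) * E (fib_len i)"
    unfolding Eb by (simp add: power2_eq_square power3_eq_cube algebra_simps)
  then have "?a * ?b \<le> ?x * (k ^ 3 * (E a)\<^sup>2)" by (rule mult_right_le_imp_le) simp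
  then show "1 / (k ^ 3 * (E a)\<^sup>2) \<le> \<bar>h a - h b\<bar>" unfolding eq using pos by (simp add: field_simps)
qed

lemma h_fib_len:
  assumes "d0 \<le> i"
  shows "\<bar>h (fib_len i)\<bar> \<le> K * k ^ 2 / (E (fib_len i))\<^sup>2"
proof -
  let ?x = "\<bar>real_of_int (x0 i)\<bar>"
  have x: "0 < ?x" using x0_bounds[OF assms] by simp
  have "h (fib_len i) = (x0 i * \<xi> - x1 i) / x0 i"
    using x assms d0 by (simp add: h_def p_fib_len r_fib_len field_simps)
  then have "\<bar>h (fib_len i)\<bar> \<le> K / ?x / ?x"
    using divide_right_mono[of "\<bar>x0 i * \<xi> - x1 i\<bar>" "K / ?x" ?x] x_ln[OF assms] by (simp add: abs_divide)
  also have "\<dots> = K / ?x\<^sup>2" by (simp add: power2_eq_square)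
  also have "\<dots> \<le> K * k ^ 2 / (E (fib_len i))\<^sup>2"
  proof -
    have "(E (fib_len i))\<^sup>2 \<le> (k * ?x)\<^sup>2" using x0_bounds[OF assms] by (intro power_mono) (auto intro: less_imp_le)
    then have "K * (E (fib_len i))\<^sup>2 \<le> K * (k\<^sup>2 * ?x\<^sup>2)" using K by (simp add: power_mult_distrib)
    then show ?thesis using x by (simp add: field_simps)
  qed
  finally show ?thesis .
qed

lemma E_gap:
  assumes "a \<in> level_set (d0 + 3)" "b \<in> level_set (d0 + 3)" "a < b"
  shows "2 * B * k ^ 3 * E a \<le> E b" "2 * \<bar>\<xi>\<bar> * k ^ 2 * B * E a \<le> E b" "2 * E a \<le> E b"
proof -
  have "E (fib_len (d0 + 1)) * E a \<le> E b"
    unfolding E_add[symmetric] using level_set_gap[OF assms] by (intro E_mono) simp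
  moreover have "t * E a \<le> E (fib_len (d0 + 1)) * E a" if "t \<le> E (fib_len (d0 + 1))" for t
    using that by (intro mult_right_mono) (auto intro: less_imp_le)
  ultimately show "2 * B * k ^ 3 * E a \<le> E b" "2 * \<bar>\<xi>\<bar> * k ^ 2 * B * E a \<le> E b" "2 * E a \<le> E b"
    using E_large[of "d0 + 1"] by (meson le_add1 order_trans)+
qed

text \<open>Telescoping from n to a Fibonacci length beyond it, where h is known. As E at least
  doubles at each gap, the tail contributes at most half of B, so B must dominate 2 k^3 for the step
  and K k^2 at the start.\<close>

lemma h_upper:
  assumes "n \<in> level_set (d0 + 3)"
  shows "\<bar>h n\<bar> \<le> B / (E n)\<^sup>2"
proof -
  define I where "I = d0 + 3 + n"
  have I: "n \<le> fib_len I" "d0 \<le> I" "fib_len I \<in> level_set (d0 + 3)"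
    using fib_len_ge[of I] fib_len_in_level_set[of I "d0 + 3"] by (auto simp: I_def)
  from assms I(1) show ?thesis
  proof (induction "fib_len I - n" arbitrary: n rule: less_induct)
    case less
    show ?case
    proof (cases "n = fib_len I")
      case True
      have "K * k ^ 2 \<le> B" using k1 by (simp add: B_def)
      then have "K * k ^ 2 / (E n)\<^sup>2 \<le> B / (E n)\<^sup>2" by (intro divide_right_mono) auto
      then show ?thesis using h_fib_len[OF I(2)] True by simp
    next
      case False
      obtain b where b: "consec (level_set (d0 + 3)) n b" using consec_next less.prems by blast
      have bI: "b \<le> fib_len I" using consec_right_le[OF b I(3)] False less.prems by simp
      have nb: "b \<in> level_set (d0 + 3)" "n < b" using consecD[OF b] by auto
      have hb: "\<bar>h b\<bar> \<le> B / (E b)\<^sup>2" using less.hyps[of b] nb bI by simp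
      have "(2 * E n) * (1 * E n) \<le> E b * E b"
        using E_gap(3)[OF less.prems(1) nb] E_mono[of n b] nb by (intro mult_mono) auto
      then have "B / (E b)\<^sup>2 \<le> B / (2 * (E n)\<^sup>2)"
        using B_pos by (intro divide_left_mono) (auto simp: power2_eq_square)
      then have "\<bar>h b\<bar> \<le> B / 2 / (E n)\<^sup>2" using hb by simp
      moreover have "\<bar>h n\<bar> \<le> k ^ 3 / (E n)\<^sup>2 + \<bar>h b\<bar>" using h_diff(1)[OF b] by linarith
      ultimately have "\<bar>h n\<bar> \<le> (k ^ 3 + B / 2) / (E n)\<^sup>2" by (simp add: add_divide_distrib)
      also have "\<dots> \<le> B / (E n)\<^sup>2"
        using K k1 by (intro divide_right_mono) (auto simp: B_def)
      finally show ?thesis .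
    qed
  qed
qed

text \<open>The step to the next point alone has size at least 1 / (k^3 E(n)^2), and h at that point
  is at most half as large, because the gap makes E there larger by the factor 2 B k^3.\<close>

lemma h_lower:
  assumes "n \<in> level_set (d0 + 3)"
  shows "1 / (2 * k ^ 3 * (E n)\<^sup>2) \<le> \<bar>h n\<bar>"
proof -
  obtain b where b: "consec (level_set (d0 + 3)) n b" using consec_next assms by blast
  have nb: "b \<in> level_set (d0 + 3)" "n < b" using consecD[OF b] by auto
  have "(2 * B * k ^ 3 * E n) * (1 * E n) \<le> E b * E b"
    using E_gap(1)[OF assms nb] E_mono[of n b] nb B_pos k1 by (intro mult_mono) auto
  then have "B / (E b)\<^sup>2 \<le> B / (2 * B * k ^ 3 * (E n)\<^sup>2)"
    using B_pos k1 by (intro divide_left_mono) (auto simp: power2_eq_square)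
  also have "\<dots> = 1 / (2 * k ^ 3 * (E n)\<^sup>2)" using B_pos by simp
  finally have "\<bar>h b\<bar> \<le> 1 / (2 * k ^ 3 * (E n)\<^sup>2)" using h_upper[OF nb(1)] by linarith
  moreover have "1 / (k ^ 3 * (E n)\<^sup>2) = 2 * (1 / (2 * k ^ 3 * (E n)\<^sup>2))" by simp
  ultimately show ?thesis using h_diff(2)[OF b] by linarith
qed

section \<open>The third coordinate and its error\<close>

definition z :: "nat \<Rightarrow> int" where "z n = round (real_of_int (r n) * \<xi>)"
definition \<theta> :: "nat \<Rightarrow> real" where "\<theta> n = real_of_int (r n) * \<xi> - real_of_int (z n)"

lemma z_eqI: "\<bar>real_of_int (r n) * \<xi> - real_of_int y\<bar> < 1 / 2 \<Longrightarrow> z n = y"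
  unfolding z_def by (rule round_unique') (simp add: abs_minus_commute)

definition D :: "nat \<Rightarrow> nat \<Rightarrow> nat \<Rightarrow> int" where
  "D a n b = p a * (r n * z b - z n * r b) - r a * (p n * z b - z n * p b) + z a * (p n * r b - r n * p b)"

text \<open>Replacing z by r \<xi> - \<theta> in the third column: the part r \<xi> is proportional
  to the second column and contributes nothing, and the rest is expanded along \<theta>.\<close>

lemma D_theta:
  "real_of_int (D a n b) = \<theta> n * real_of_int (p a * r b - r a * p b)
    - \<theta> b * real_of_int (p a * r n - r a * p n) - \<theta> a * real_of_int (p n * r b - r n * p b)"
  by (simp add: D_def \<theta>_def algebra_simps)

definition lin_rel :: "nat \<Rightarrow> nat \<Rightarrow> nat \<Rightarrow> bool" where
  "lin_rel a n b \<longleftrightarrow> (\<exists>t s. (s = 1 \<or> s = - 1) \<and> p b = t * p n + s * p a \<and> r b = t * r n + s * r a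
    \<and> z b = t * z n + s * z a)"

lemma level_set_level_ge: "level n j \<Longrightarrow> n \<in> level_set l \<Longrightarrow> l \<le> j"
  unfolding level_set_def using level_unique by blast

lemma theta_fib_len:
  assumes "d0 \<le> i"
  shows "z (fib_len i) = x2 i" "\<bar>\<theta> (fib_len i)\<bar> \<le> K / \<bar>real_of_int (x0 i)\<bar>"
proof -
  let ?x = "\<bar>real_of_int (x0 i)\<bar>"
  have x: "0 < ?x" "E (fib_len i) \<le> k * ?x" using x0_bounds[OF assms] by auto
  have rb: "\<bar>real_of_int (r (fib_len i)) * \<xi> - real_of_int (x2 i)\<bar> \<le> K / ?x"
    using x_ln[OF assms] assms d0 by (simp add: r_fib_len)
  have "8 * (m + 1) * T * k ^ 2 \<le> k * ?x" using E_large(1)[OF assms] x(2) by linarith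
  then have "(8 * (m + 1) * T * k) * k \<le> ?x * k" by (simp add: power2_eq_square algebra_simps)
  then have "8 * (m + 1) * T * k \<le> ?x" using k1 by simp
  moreover have "8 * 1 * K * 1 \<le> 8 * (m + 1) * T * k"
    using m T3 K k1 by (intro mult_mono) auto
  ultimately have "8 * K \<le> ?x" by simp
  then have "K / ?x < 1 / 2" using x K by (simp add: field_simps)
  then show "z (fib_len i) = x2 i" using rb by (intro z_eqI) linarith
  then show "\<bar>\<theta> (fib_len i)\<bar> \<le> K / ?x" using rb by (simp add: \<theta>_def)
qed

definition theta_ok :: "nat \<Rightarrow> bool" where
  "theta_ok n \<longleftrightarrow> (\<forall>j. level n j \<longrightarrow> \<bar>\<theta> n\<bar> \<le> T / \<bar>real_of_int (x0 j)\<bar>)"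

lemma theta_okD:
  assumes "theta_ok n" "n \<in> level_set l" "d0 \<le> l"
  shows "\<bar>\<theta> n\<bar> * E (fib_len l) \<le> T * k"
proof -
  obtain j where j: "l \<le> j" "level n j" using assms(2) by (auto simp: level_set_def)
  let ?x = "\<bar>real_of_int (x0 j)\<bar>"
  have x: "0 < ?x" "E (fib_len j) \<le> k * ?x" using x0_bounds[of j] j assms by auto
  have "\<bar>\<theta> n\<bar> * E (fib_len l) \<le> (T / ?x) * (k * ?x)"
  proof (rule mult_mono)
    show "\<bar>\<theta> n\<bar> \<le> T / ?x" using assms(1) j by (simp add: theta_ok_def)
    have "E (fib_len l) \<le> E (fib_len j)" using j by (intro E_mono fib_len_mono)
    then show "E (fib_len l) \<le> k * ?x" using x by linarith
  qed (use T3 x in \<open>auto intro: less_imp_le divide_nonneg_nonneg\<close>)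
  also have "\<dots> = T * k" using x by simp
  finally show ?thesis .
qed

text \<open>A point one level higher has error of order 1 / E(F_(d+4)), and F_(d+4) = F_(d+3) +
  F_(d+2). The factor E(F_(d+2)) absorbs x0 i, and E(F_(d+3)) absorbs all constants.\<close>

lemma theta_x0_small:
  assumes "theta_ok n" "n \<in> level_set (d + 4)" "d0 \<le> d" "i \<le> d + 2" "d0 \<le> i"
  shows "\<bar>\<theta> n\<bar> * \<bar>real_of_int (x0 i)\<bar> * (8 * (m + 1)) \<le> 1"
proof -
  have "\<bar>real_of_int (x0 i)\<bar> \<le> k * E (fib_len i)" using x0_bounds[OF assms(5)] by simp
  also have "\<dots> \<le> k * E (fib_len (d + 2))"
    using assms k1 by (intro mult_left_mono E_mono fib_len_mono) auto
  finally have x: "\<bar>real_of_int (x0 i)\<bar> \<le> k * E (fib_len (d + 2))" .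
  have e: "E (fib_len (d + 4)) = E (fib_len (d + 3)) * E (fib_len (d + 2))"
    unfolding E_add[symmetric] using fib_len_steps[of d] by simp
  have "\<bar>\<theta> n\<bar> * \<bar>real_of_int (x0 i)\<bar> * E (fib_len (d + 3)) \<le> \<bar>\<theta> n\<bar> * (k * E (fib_len (d + 2))) * E (fib_len (d + 3))"
    using x by (intro mult_right_mono mult_left_mono) (auto intro: less_imp_le)
  also have "\<dots> = k * (\<bar>\<theta> n\<bar> * E (fib_len (d + 4)))" unfolding e by simp
  also have "\<dots> \<le> k * (T * k)" using theta_okD[OF assms(1,2)] assms k1 by (intro mult_left_mono) auto
  finally have a: "\<bar>\<theta> n\<bar> * \<bar>real_of_int (x0 i)\<bar> * E (fib_len (d + 3)) \<le> T * k\<^sup>2"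
    by (simp add: power2_eq_square ac_simps)
  have "(\<bar>\<theta> n\<bar> * \<bar>real_of_int (x0 i)\<bar> * (8 * (m + 1))) * (T * k\<^sup>2)
      = \<bar>\<theta> n\<bar> * \<bar>real_of_int (x0 i)\<bar> * (8 * (m + 1) * T * k\<^sup>2)" by simp
  also have "\<dots> \<le> \<bar>\<theta> n\<bar> * \<bar>real_of_int (x0 i)\<bar> * E (fib_len (d + 3))"
    using E_large(1)[of "d + 3"] assms(3) by (intro mult_left_mono) auto
  also have "\<dots> \<le> 1 * (T * k\<^sup>2)" using a by simp
  finally show ?thesis using T3 k1 by (simp add: mult_le_cancel_right)
qed

lemma theta_small:
  assumes "theta_ok n" "n \<in> level_set l" "d0 \<le> l"
  shows "\<bar>\<theta> n\<bar> \<le> 1 / 8"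
proof -
  have "1 * 1 \<le> (m + 1) * k" using m k1 by (intro mult_mono) auto
  then have "1 * (8 * T * k) \<le> ((m + 1) * k) * (8 * T * k)"
    using T3 k1 by (intro mult_right_mono) auto
  then have "8 * T * k \<le> 8 * (m + 1) * T * k\<^sup>2" by (simp add: power2_eq_square algebra_simps)
  then have "8 * T * k \<le> E (fib_len l)" using E_large(1)[OF assms(3)] by simp
  then have "\<bar>\<theta> n\<bar> * (8 * T * k) \<le> \<bar>\<theta> n\<bar> * E (fib_len l)" by (intro mult_left_mono) auto
  also have "\<dots> \<le> T * k" by (rule theta_okD[OF assms])
  finally have "(8 * \<bar>\<theta> n\<bar>) * (T * k) \<le> 1 * (T * k)" by simp
  then have "8 * \<bar>\<theta> n\<bar> \<le> 1" using T3 k1 by (simp add: mult_le_cancel_right)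
  then show ?thesis by simp
qed

text \<open>The first two coordinates satisfy the relation exactly. The combination of the third
  coordinates then misses \<open>r b * \<xi>\<close> by at most 1/8 + 1/8, so it is the nearest
  integer \<open>z b\<close>.\<close>

lemma equal_gap_relation:
  assumes d: "d0 \<le> d" and c: "consec (level_set (d + 3)) a n" "consec (level_set (d + 3)) n b"
    and n: "n \<in> level_set (d + 4)" and ok: "theta_ok a" "theta_ok n"
  shows "lin_rel a n b"
proof -
  have d1: "1 \<le> d" using d d0 by simp
  obtain i where i: "i \<in> {d + 1, d + 2}" "n = a + fib_len i" "Y n = Phi a ** X i"
    using consec_gap_matrix[OF c(1) d1] by blast
  obtain j where j: "j \<in> {d + 1, d + 2}" "b = n + fib_len j" "Y b = Phi n ** X j"
    using consec_gap_matrix[OF c(2) d1] by blast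
  have "n - a = b - n" using consec_triple[OF c] n by blast
  then have "i = j" using i j fib_len_inj[of i j] by auto
  have i0: "1 \<le> i" "d0 \<le> i" "i \<le> d + 2" using i d d1 by auto
  obtain s where s: "s = 1 \<or> s = - 1" "p b = m * x0 i * p n + s * p a" "r b = m * x0 i * r n + s * r a"
    using equal_gaps[OF i(3) _ i0(1), of b] j(3) \<open>i = j\<close> by blast
  let ?t = "m * x0 i"
  have "\<bar>?t * \<theta> n\<bar> * 8 \<le> \<bar>\<theta> n\<bar> * \<bar>real_of_int (x0 i)\<bar> * (8 * (m + 1))"
    using m by (simp add: abs_mult algebra_simps)
  then have t: "\<bar>?t * \<theta> n\<bar> \<le> 1 / 8" using theta_x0_small[OF ok(2) n d i0(3,2)] by linarith
  have a: "\<bar>s * \<theta> a\<bar> \<le> 1 / 8"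
    using theta_small[OF ok(1), of "d + 3"] consecD[OF c(1)] d s(1) by auto
  have "real_of_int (r b) * \<xi> - real_of_int (?t * z n + s * z a) = ?t * \<theta> n + s * \<theta> a"
    unfolding s(3) by (simp add: \<theta>_def algebra_simps)
  then have "\<bar>real_of_int (r b) * \<xi> - real_of_int (?t * z n + s * z a)\<bar> < 1 / 2" using t a by linarith
  then have "z b = ?t * z n + s * z a" by (rule z_eqI)
  then show ?thesis unfolding lin_rel_def using s by blast
qed

text \<open>The multiple of the point of a drops out of the determinant, and n is replaced by a' up
  to sign. The next lemma does this in two rows at once.\<close>

lemma D_lin_rel_middle:
  assumes "lin_rel a' a n"
  shows "\<bar>D a n b\<bar> = \<bar>D a' a b\<bar>"
proof -
  obtain t s where s: "s = 1 \<or> s = - 1" "p n = t * p a + s * p a'" "r n = t * r a + s * r a'" "z n = t * z a + s * z a'"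
    using assms unfolding lin_rel_def by blast
  have "D a n b = - s * D a' a b" unfolding D_def s(2-4) by (simp add: algebra_simps)
  then show ?thesis using s(1) by auto
qed

lemma D_lin_rel_both:
  assumes "lin_rel a' a n" "lin_rel a'' a b"
  shows "\<bar>D a n b\<bar> = \<bar>D a'' a' a\<bar>"
proof -
  obtain t s where s: "s = 1 \<or> s = - 1" "p n = t * p a + s * p a'" "r n = t * r a + s * r a'" "z n = t * z a + s * z a'"
    using assms unfolding lin_rel_def by blast
  obtain t' s' where s': "s' = 1 \<or> s' = - 1" "p b = t' * p a + s' * p a''" "r b = t' * r a + s' * r a''" "z b = t' * z a + s' * z a''"
    using assms unfolding lin_rel_def by blast
  have "D a n b = - (s * s') * D a'' a' a" unfolding D_def s(2-4) s'(2-4) by (simp add: algebra_simps)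
  then show ?thesis using s(1) s'(1) by auto
qed

end

text \<open>The two gaps at n differ, so they are F_(d+1) and F_(d+2) in some order and add up to
  F_(d+3), one of the gaps of the next level.\<close>

lemma consec_skip:
  assumes c: "consec (level_set (d + 3)) a n" "consec (level_set (d + 3)) n b" and n: "n \<notin> level_set (d + 4)"
  shows "consec (level_set (d + 4)) a b" "b = a + fib_len (d + 3)"
proof -
  have t: "n - a \<noteq> b - n" "a \<in> level_set (d + 4)" "b \<in> level_set (d + 4)" using consec_triple[OF c] n by auto
  have sub: "level_set (d + 4) \<subseteq> level_set (d + 3)" by (rule level_set_antimono) simp
  have lt: "a < n" "n < b" using consecD[OF c(1)] consecD[OF c(2)] by auto
  have "\<not> (a < z \<and> z < b)" if "z \<in> level_set (d + 4)" for z
    using consec_left_ge[OF c(1), of z] consec_right_le[OF c(2), of z] that sub n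
    by (metis linorder_not_less nat_neq_iff subsetD)
  then show "consec (level_set (d + 4)) a b" using t lt by (auto simp: consec_def)
  show "b = a + fib_len (d + 3)"
    using consec_gap[OF c(1)] consec_gap[OF c(2)] t(1) fib_len_steps[of d] by auto
qed

lemma consec_left_unique: "consec A a b \<Longrightarrow> consec A a' b \<Longrightarrow> a = a'"
  by (metis consecD consec_left_ge le_antisym)

lemma consec_prev_skip:
  assumes c: "consec (level_set (d + 3)) a' a" and a': "a' \<notin> level_set (d + 4)"
    and c4: "consec (level_set (d + 4)) a0 a"
  shows "consec (level_set (d + 3)) a0 a'" "a = a0 + fib_len (d + 3)"
proof -
  have a0: "a0 \<in> level_set (d + 4)" "a0 < a" using consecD[OF c4] by auto
  have sub: "level_set (d + 4) \<subseteq> level_set (d + 3)" by (rule level_set_antimono) simp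
  have "a0 \<le> a'" using consec_left_ge[OF c, of a0] a0 sub by auto
  then have "a0 < a'" using a0 a' by (metis le_neq_implies_less)
  then obtain a'' where a'': "consec (level_set (d + 3)) a'' a'"
    using consec_prev[of a' "d + 3" a0] consecD[OF c] a0 sub by blast
  note s = consec_skip[OF a'' c a']
  then have "a'' = a0" using consec_left_unique c4 by blast
  then show "consec (level_set (d + 3)) a0 a'" "a = a0 + fib_len (d + 3)" using a'' s by auto
qed

lemma fib_len_level: "1 \<le> i \<Longrightarrow> level (fib_len i) j \<Longrightarrow> j = i"
  using level_unique level.base by blast

context asymptotic
begin

lemma theta_ok_fib_len:
  assumes "d0 \<le> i"
  shows "theta_ok (fib_len i)"
  unfolding theta_ok_def
proof (intro allI impI)
  fix j assume "level (fib_len i) j"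
  then have j: "j = i" using fib_len_level assms d0 by simp
  have "K / \<bar>real_of_int (x0 i)\<bar> \<le> T / \<bar>real_of_int (x0 i)\<bar>" using T3 by (intro divide_right_mono) auto
  then show "\<bar>\<theta> (fib_len i)\<bar> \<le> T / \<bar>real_of_int (x0 j)\<bar>" using theta_fib_len(2)[OF assms] j by simp
qed

lemma gap_minor:
  assumes "d0 \<le> d" "consec (level_set (d + 3)) a b"
  obtains i where "d + 1 \<le> i" "i \<le> d + 2" "b = a + fib_len i"
    "\<bar>real_of_int (p a * r b - r a * p b)\<bar> = \<bar>real_of_int (x0 i)\<bar>"
proof -
  have d1: "1 \<le> d" using assms d0 by simp
  obtain i where i: "i \<in> {d + 1, d + 2}" "b = a + fib_len i" "Y b = Phi a ** X i"
    using consec_gap_matrix[OF assms(2) d1] by blast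
  have "\<bar>p a * r b - r a * p b\<bar> = \<bar>x0 i\<bar>" using gap_det[OF i(3)] i(1) by auto
  then have "\<bar>real_of_int (p a * r b - r a * p b)\<bar> = \<bar>real_of_int (x0 i)\<bar>" by (metis of_int_abs)
  then show ?thesis using that[of i] i by auto
qed

text \<open>In \<open>D_theta\<close> the large minor x0 (d + 3) of the outer pair multiplies
  \<theta> n. The other two terms pair errors of points of S_(d+4) with the minors of shorter gaps
  and are at most 1/8 each, so the product is within 1/4 of 2.\<close>

lemma theta_from_det:
  assumes d: "d0 \<le> d" and c: "consec (level_set (d + 3)) a n" "consec (level_set (d + 3)) n b"
    and n: "n \<notin> level_set (d + 4)" and ok: "theta_ok a" "theta_ok b" and D: "\<bar>D a n b\<bar> = 2"
  shows "\<bar>\<theta> n\<bar> * \<bar>real_of_int (x0 (d + 3))\<bar> \<le> 3" "1 \<le> \<bar>\<theta> n\<bar> * \<bar>real_of_int (x0 (d + 3))\<bar>"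
proof -
  have ab: "a \<in> level_set (d + 4)" "b \<in> level_set (d + 4)" using consec_triple[OF c] n by auto
  note sk = consec_skip[OF c n]
  have "consec (level_set (d + 1 + 3)) a b" using sk(1) by (simp add: numeral_eq_Suc)
  then obtain i where i: "b = a + fib_len i" "1 \<le> i"
    "\<bar>real_of_int (p a * r b - r a * p b)\<bar> = \<bar>real_of_int (x0 i)\<bar>"
    using gap_minor[of "d + 1" a b] d by (metis le_add2 le_trans trans_le_add1 add_leD2)
  have "i = d + 3" using i(1,2) sk(2) fib_len_inj[of i "d + 3"] by simp
  obtain i1 where i1: "d + 1 \<le> i1" "i1 \<le> d + 2"
    "\<bar>real_of_int (p a * r n - r a * p n)\<bar> = \<bar>real_of_int (x0 i1)\<bar>"
    using gap_minor[OF d c(1)] by metis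
  obtain i2 where i2: "d + 1 \<le> i2" "i2 \<le> d + 2"
    "\<bar>real_of_int (p n * r b - r n * p b)\<bar> = \<bar>real_of_int (x0 i2)\<bar>"
    using gap_minor[OF d c(2)] by metis
  have small: "\<bar>\<theta> y\<bar> * \<bar>real_of_int (x0 j)\<bar> \<le> 1 / 8" if "theta_ok y" "y \<in> level_set (d + 4)" "d + 1 \<le> j" "j \<le> d + 2" for y j
  proof -
    have "\<bar>\<theta> y\<bar> * \<bar>real_of_int (x0 j)\<bar> * 8 \<le> \<bar>\<theta> y\<bar> * \<bar>real_of_int (x0 j)\<bar> * (8 * (m + 1))"
      using m by (intro mult_left_mono) auto
    also have "\<dots> \<le> 1" using theta_x0_small[OF that(1,2) d that(4)] that(3) d by simp
    finally show ?thesis by simp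
  qed
  have e: "\<bar>\<theta> b * real_of_int (p a * r n - r a * p n)\<bar> \<le> 1 / 8" "\<bar>\<theta> a * real_of_int (p n * r b - r n * p b)\<bar> \<le> 1 / 8"
    unfolding abs_mult i1(3) i2(3) using small ok ab i1 i2 by auto
  have "\<bar>real_of_int (D a n b)\<bar> = 2" using D by (metis of_int_abs of_int_numeral)
  then have "\<bar>\<bar>\<theta> n * real_of_int (p a * r b - r a * p b)\<bar> - 2\<bar> \<le> 1 / 4"
    using e D_theta[of a n b] by linarith
  then have "\<bar>\<bar>\<theta> n\<bar> * \<bar>real_of_int (x0 (d + 3))\<bar> - 2\<bar> \<le> 1 / 4"
    unfolding abs_mult i(3) \<open>i = d + 3\<close> .
  then show "\<bar>\<theta> n\<bar> * \<bar>real_of_int (x0 (d + 3))\<bar> \<le> 3" "1 \<le> \<bar>\<theta> n\<bar> * \<bar>real_of_int (x0 (d + 3))\<bar>"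
    by linarith+
qed

lemma D_fib_len:
  assumes "d0 \<le> l"
  shows "\<bar>D (fib_len l) (fib_len (l + 1)) (fib_len (l + 2))\<bar> = 2"
  using x_triple_det[of l] assms d0 theta_fib_len(1)[of l] theta_fib_len(1)[of "l + 1"] theta_fib_len(1)[of "l + 2"]
  by (simp add: D_def p_fib_len r_fib_len del: fib.simps)

text \<open>The window up to F_(d+3+e) is the same for (d, e + 1) and (d + 1, e), so the outer
  induction on e passes from level d + 4 to level d + 3. Error bounds and determinants are proved
  together because each feeds the other.\<close>

lemma theta_det:
  assumes "d0 \<le> d"
  shows "(\<forall>n\<in>level_set (d + 3). n \<le> fib_len (d + 3 + e) \<longrightarrow> theta_ok n) \<and>
    (\<forall>a n b. consec (level_set (d + 3)) a n \<longrightarrow> consec (level_set (d + 3)) n b \<longrightarrow> n \<notin> level_set (d + 4) \<longrightarrow>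
      b \<le> fib_len (d + 3 + e) \<longrightarrow> \<bar>D a n b\<bar> = 2)"
  using assms
proof (induction e arbitrary: d)
  case 0
  have "theta_ok n" if "n \<in> level_set (d + 3)" "n \<le> fib_len (d + 3)" for n
    using level_set_ge[OF that(1)] that(2) theta_ok_fib_len[of "d + 3"] 0 by simp
  moreover have False if "consec (level_set (d + 3)) a n" "consec (level_set (d + 3)) n b" "b \<le> fib_len (d + 3)" for a n b
    using level_set_ge[of a "d + 3"] consecD[OF that(1)] consecD[OF that(2)] that(3) by simp
  ultimately show ?case by auto
next
  case (Suc e)
  define I where "I = d + 3 + Suc e"
  have "d0 \<le> d + 1" using Suc.prems by simp
  note IH = Suc.IH[OF this]
  have S4: "d + 1 + 3 = d + 4" "d + 1 + 4 = d + 5" "d + 4 + e = I" by (simp_all add: I_def)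
  have IH1: "theta_ok n" if "n \<in> level_set (d + 4)" "n \<le> fib_len I" for n
    using IH that unfolding S4 by blast
  have IH2: "\<bar>D a n b\<bar> = 2" if "consec (level_set (d + 4)) a n" "consec (level_set (d + 4)) n b"
    "n \<notin> level_set (d + 5)" "b \<le> fib_len I" for a n b
    using IH that unfolding S4 by blast
  note d = Suc.prems
  have sub: "level_set (d + 4) \<subseteq> level_set (d + 3)" "level_set (d + 5) \<subseteq> level_set (d + 4)"
    by (rule level_set_antimono; simp)+
  have FI: "fib_len I \<in> level_set (d + 4)" by (rule fib_len_in_level_set) (auto simp: I_def)
  have main: "theta_ok n \<and> (\<forall>a b. consec (level_set (d + 3)) a n \<longrightarrow> consec (level_set (d + 3)) n b \<longrightarrow>
      n \<notin> level_set (d + 4) \<longrightarrow> b \<le> fib_len I \<longrightarrow> \<bar>D a n b\<bar> = 2)"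
    if "n \<in> level_set (d + 3)" "n \<le> fib_len I" for n
    using that
  proof (induction n rule: less_induct)
    case (less n)
    show ?case
    proof (cases "n \<in> level_set (d + 4)")
      case True
      then show ?thesis using IH1 less.prems by blast
    next
      case n4: False
      show ?thesis
      proof (cases "n = fib_len (d + 3)")
        case True
        have "\<not> consec (level_set (d + 3)) a n" for a
          using level_set_ge[of a "d + 3"] True consecD[of "level_set (d + 3)" a n] by fastforce
        then show ?thesis using theta_ok_fib_len[of "d + 3"] True d by simp
      next
        case False
        have F3: "fib_len (d + 3) \<in> level_set (d + 3)" by (rule fib_len_in_level_set) auto
        have "fib_len (d + 3) < n" using False level_set_ge[OF less.prems(1)] by simp
        then obtain a where a: "consec (level_set (d + 3)) a n" using consec_prev[OF less.prems(1) F3] by blast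
        obtain b where b: "consec (level_set (d + 3)) n b" using consec_next less.prems by blast
        have "n < fib_len I" using less.prems n4 FI by (metis le_neq_implies_less)
        then have bI: "b \<le> fib_len I" using consec_right_le[OF b] FI sub by blast
        have lt: "a < n" "n < b" using consecD[OF a] consecD[OF b] by auto
        have ab4: "a \<in> level_set (d + 4)" "b \<in> level_set (d + 4)" using consec_triple[OF a b] n4 by auto
        \<comment> \<open>Although b exceeds n, it belongs to S_(d+4) and to the window, so the
          outer hypothesis applies to it.\<close>
        have ok: "theta_ok a" "theta_ok b" using IH1 ab4 lt bI less.prems by auto
        have "fib_len (d + 3) < fib_len (d + 4)" by (rule fib_len_strict_mono) auto
        then have "fib_len (d + 3) < a" using level_set_ge[OF ab4(1)] by linarith
        then obtain a' where a': "consec (level_set (d + 3)) a' a"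
          using consec_prev[OF _ F3] ab4 sub by blast
        have a'lt: "a' < a" "a' \<in> level_set (d + 3)" using consecD[OF a'] by auto
        have ok': "theta_ok a'" using less.IH[of a'] a'lt lt less.prems by simp
        have rel: "lin_rel a' a n" by (rule equal_gap_relation[OF d a' a ab4(1) ok' ok(1)])
        have cab: "consec (level_set (d + 4)) a b" "b = a + fib_len (d + 3)"
          by (rule consec_skip[OF a b n4])+
        have cab': "consec (level_set (d + 1 + 3)) a b" using cab(1) unfolding S4 .
        have D: "\<bar>D a n b\<bar> = 2"
        proof (cases "a = fib_len (d + 4)")
          \<comment> \<open>The start of the chain: the relation turns the triple into the points of
            F_(d+3), F_(d+4), F_(d+5), whose determinant was computed directly.\<close>
          case True
          have "a' = fib_len (d + 3)" using a' a'lt level_set_initial_0[of a' d] True by simp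
          moreover have "b = fib_len (d + 5)" using cab(2) True fib_len_steps[of d] by simp
          ultimately show ?thesis using D_lin_rel_middle[OF rel, of b] D_fib_len[of "d + 3"] d True
            by (simp add: numeral_eq_Suc del: fib.simps)
        next
          case False
          have F4: "fib_len (d + 4) \<in> level_set (d + 4)" by (rule fib_len_in_level_set) auto
          have "fib_len (d + 4) < a" using False level_set_ge[OF ab4(1)] by simp
          then obtain a0 where a0: "consec (level_set (d + 4)) a0 a" using consec_prev[OF ab4(1) F4] by blast
          then have a0': "consec (level_set (d + 1 + 3)) a0 a" unfolding S4 .
          note tr = consec_triple[OF a0' cab', unfolded S4]
          have sm: "fib_len (d + 2) < fib_len (d + 3)" "fib_len (d + 1) < fib_len (d + 3)"
            by (rule fib_len_strict_mono; simp)+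
          show ?thesis
          proof (cases "a \<in> level_set (d + 5)")
            \<comment> \<open>The gaps at a in S_(d+4) are equal, so b is related to a0 as n is to
              a'. Both are replaced, and the determinant becomes that of a0, a', a, whose middle
              point is smaller and of exact level d + 3.\<close>
            case True
            have "a - a0 = b - a" using tr True by blast
            moreover have "a0 < a" using consecD[OF a0] by blast
            ultimately have aa0: "a = a0 + fib_len (d + 3)" using cab(2) by linarith
            have "a0 \<noteq> a'" using consec_gap[OF a'] aa0 sm by auto
            have a'4: "a' \<notin> level_set (d + 4)"
            proof
              assume "a' \<in> level_set (d + 4)"
              then have "a' \<le> a0" using consec_left_ge[OF a0] a'lt by blast
              moreover have "a0 \<le> a'" using consec_left_ge[OF a', of a0] consecD[OF a0] sub by blast
              ultimately show False using \<open>a0 \<noteq> a'\<close> by simp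
            qed
            note ps = consec_prev_skip[OF a' a'4 a0]
            have "\<bar>D a0 a' a\<bar> = 2"
              using less.IH[of a'] a'lt lt less.prems ps(1) a' a'4 by auto
            moreover have "lin_rel a0 a b"
            proof (rule equal_gap_relation[of "d + 1", OF _ a0' cab'])
              show "theta_ok a0" using IH1[of a0] consecD[OF a0] lt less.prems by simp
              show "a \<in> level_set (d + 1 + 4)" unfolding S4 by (rule True)
            qed (use d ok in auto)
            ultimately show ?thesis using D_lin_rel_both[OF rel, of a0 b] by simp
          next
            \<comment> \<open>The gaps at a differ on the next level, which forces a' = a0.
              Replacing n by a' gives a triple of S_(d+4) whose middle point a has exact level d +
              4: the outer hypothesis.\<close>
            case a5: False
            then have "a - a0 \<noteq> b - a" using tr by blast
            then have "a \<noteq> a0 + fib_len (d + 3)" using cab(2) by auto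
            then have "a' \<in> level_set (d + 4)" using consec_prev_skip(2)[OF a' _ a0] by blast
            then have "a' \<le> a0" using consec_left_ge[OF a0] a'lt by blast
            moreover have "a0 \<le> a'" using consec_left_ge[OF a', of a0] consecD[OF a0] sub by blast
            ultimately have "a' = a0" by simp
            have "\<bar>D a0 a b\<bar> = 2" by (rule IH2[OF a0 cab(1) a5 bI])
            then show ?thesis using D_lin_rel_middle[OF rel, of b] \<open>a' = a0\<close> by simp
          qed
        qed
        have "theta_ok n" unfolding theta_ok_def
        proof (intro allI impI)
          fix j assume j: "level n j"
          have "j = d + 3"
          proof -
            have "d + 3 \<le> j" using level_set_level_ge[OF j less.prems(1)] .
            moreover have "\<not> d + 4 \<le> j" using j n4 by (auto simp: level_set_def)
            ultimately show ?thesis by simp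
          qed
          have x: "0 < \<bar>real_of_int (x0 (d + 3))\<bar>" using x0_bounds(1)[of "d + 3"] d by simp
          have "\<bar>\<theta> n\<bar> * \<bar>real_of_int (x0 (d + 3))\<bar> \<le> T"
            using theta_from_det(1)[OF d a b n4 ok D] T3 by linarith
          then show "\<bar>\<theta> n\<bar> \<le> T / \<bar>real_of_int (x0 j)\<bar>" unfolding \<open>j = d + 3\<close> using x by (simp add: pos_le_divide_eq)
        qed
        moreover have "a2 = a \<and> b2 = b" if "consec (level_set (d + 3)) a2 n" "consec (level_set (d + 3)) n b2" for a2 b2
          using consec_left_unique[OF that(1) a] consec_right_le[OF b, of b2] consec_right_le[OF that(2), of b]
            consecD[OF that(2)] consecD[OF b] by auto
        ultimately show ?thesis using D by blast
      qed
    qed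
  qed
  have "\<bar>D a n b\<bar> = 2" if "consec (level_set (d + 3)) a n" "consec (level_set (d + 3)) n b"
      "n \<notin> level_set (d + 4)" "b \<le> fib_len I" for a n b
    using main[of n] that consecD[OF that(1)] consecD[OF that(2)] by simp
  then show ?case using main unfolding I_def by blast
qed

lemma theta_ok_level_set: "d0 \<le> d \<Longrightarrow> n \<in> level_set (d + 3) \<Longrightarrow> theta_ok n"
  using theta_det[of d n] fib_len_ge[of "d + 3 + n"] by auto

lemma det_level_set:
  "d0 \<le> d \<Longrightarrow> consec (level_set (d + 3)) a n \<Longrightarrow> consec (level_set (d + 3)) n b \<Longrightarrow> n \<notin> level_set (d + 4)
    \<Longrightarrow> \<bar>D a n b\<bar> = 2"
  using theta_det[of d b] fib_len_ge[of "d + 3 + b"] by auto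

end

section \<open>Trajectories and linear independence\<close>

definition det3 :: "real^3 \<Rightarrow> real^3 \<Rightarrow> real^3 \<Rightarrow> real" where
  "det3 x y w = x$1 * (y$2 * w$3 - y$3 * w$2) - x$2 * (y$1 * w$3 - y$3 * w$1) + x$3 * (y$1 * w$2 - y$2 * w$1)"

lemma det3_eq_det: "det3 x y w = det (vector [x, y, w] :: real^3^3)"
  by (simp add: det3_def det_3 vector_3 algebra_simps)

lemma lin_indep3_if_det3: 
  assumes "det3 x y w \<noteq> 0"
  shows "lin_indep3 x y w"
proof -
  let ?A = "vector [x, y, w] :: real^3^3"
  have row: "row i ?A = ?A $ i" for i by (simp add: row_def vec_lambda_eta)
  have "rows ?A = {?A $ 1, ?A $ 2, ?A $ 3}"
  proof -
    have "rows ?A = (\<lambda>i. ?A $ i) ` UNIV" unfolding rows_def row by auto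
    then show ?thesis unfolding UNIV_3 by simp
  qed
  then have rows: "rows ?A = {x, y, w}" by (simp only: vector_3)
  have "independent (rows ?A)" using assms det_dependent_rows[of ?A] unfolding det3_eq_det dependent_vec_eq by blast
  moreover have "distinct [x, y, w]" using assms by (auto simp: det3_def algebra_simps)
  ultimately show ?thesis unfolding lin_indep3_def rows by blast
qed

lemma not_lin_indep3_if_comb:
  assumes "w = t *\<^sub>R y + s *\<^sub>R x"
  shows "\<not> lin_indep3 x y w"
proof
  assume l: "lin_indep3 x y w"
  then have "w \<notin> {x, y}" "independent {x, y, w}" by (auto simp: lin_indep3_def)
  moreover have "{x, y, w} = insert w {x, y}" by auto
  ultimately have "w \<notin> span {x, y}" by (auto simp: independent_insert)
  moreover have "w \<in> span {x, y}" unfolding assms by (intro span_add span_scale span_base) auto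
  ultimately show False by simp
qed

text \<open>A lower bound for |f| is required only when S < R. At the points with S = R the two
  terms of f have comparable bounds and may cancel, even to 0.\<close>

lemma trajectory_bound:
  fixes x :: "real^3" and \<xi> q1 q2 R S C :: real
  defines "e \<equiv> x $ 1 * \<xi> - x $ 2" and "f \<equiv> x $ 1 * \<xi>\<^sup>2 - x $ 3"
  assumes x1: "x $ 1 \<noteq> 0" "\<bar>ln \<bar>x $ 1\<bar> - R\<bar> \<le> C"
    and e: "e \<noteq> 0" "\<bar>ln \<bar>e\<bar> + R\<bar> \<le> C"
    and f: "f \<noteq> 0 \<Longrightarrow> ln \<bar>f\<bar> \<le> C - S" "S < R \<Longrightarrow> f \<noteq> 0 \<and> - S - C \<le> ln \<bar>f\<bar>"
    and S: "S \<le> R" and q: "q2 \<le> q1"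
  shows "\<bar>trajectory \<xi> x (q1, q2) - Max {q1 - R, q2 - S, R}\<bar> \<le> C"
proof -
  have C: "0 \<le> C" using x1(2) by linarith
  define Z where "Z = {t + ln \<bar>y\<bar> | t y. y \<noteq> 0 \<and> (t, y) \<in> {(0, x $ 1), (q1, e), (q2, f)}}"
  have tr: "trajectory \<xi> x (q1, q2) = Max Z" by (simp add: trajectory_def Z_def e_def f_def)
  have Zeq: "Z = {ln \<bar>x $ 1\<bar>, q1 + ln \<bar>e\<bar>} \<union> (if f = 0 then {} else {q2 + ln \<bar>f\<bar>})"
  proof (rule set_eqI)
    fix w
    have "w \<in> Z \<longleftrightarrow> (\<exists>t y. w = t + ln \<bar>y\<bar> \<and> y \<noteq> 0 \<and>
        (t = 0 \<and> y = x $ 1 \<or> t = q1 \<and> y = e \<or> t = q2 \<and> y = f))"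
      by (simp add: Z_def)
    also have "\<dots> \<longleftrightarrow> w = ln \<bar>x $ 1\<bar> \<or> w = q1 + ln \<bar>e\<bar> \<or> f \<noteq> 0 \<and> w = q2 + ln \<bar>f\<bar>"
      using x1(1) e(1) by (simp add: conj_disj_distribL ex_disj_distrib conj_commute cong: conj_cong)
    finally show "w \<in> Z \<longleftrightarrow> w \<in> {ln \<bar>x $ 1\<bar>, q1 + ln \<bar>e\<bar>} \<union> (if f = 0 then {} else {q2 + ln \<bar>f\<bar>})"
      by simp
  qed
  let ?P = "max (q1 - R) (max (q2 - S) R)"
  have P: "Max {q1 - R, q2 - S, R} = ?P" by simp
  have "Max Z \<le> ?P + C"
  proof -
    have "finite Z" "Z \<noteq> {}" unfolding Zeq by auto
    moreover have "w \<le> ?P + C" if "w \<in> Z" for w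
    proof -
      have "w = ln \<bar>x $ 1\<bar> \<or> w = q1 + ln \<bar>e\<bar> \<or> f \<noteq> 0 \<and> w = q2 + ln \<bar>f\<bar>"
        using that unfolding Zeq by (auto split: if_splits)
      then show ?thesis using x1(2) e(2) f(1) by linarith
    qed
    ultimately show ?thesis by simp
  qed
  moreover have "?P - C \<le> Max Z"
  proof -
    have fin: "finite Z" unfolding Zeq by simp
    have A: "ln \<bar>x $ 1\<bar> \<le> Max Z" "q1 + ln \<bar>e\<bar> \<le> Max Z" by (rule Max_ge[OF fin]; simp add: Zeq)+
    have "q2 - S - C \<le> Max Z"
    proof (cases "S < R")
      case True
      then have "q2 + ln \<bar>f\<bar> \<le> Max Z" using f(2) by (intro Max_ge[OF fin]) (simp add: Zeq)
      then show ?thesis using f(2)[OF True] by linarith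
    next
      case False
      \<comment> \<open>With S = R the missing term q2 - S is at most q1 - R, because q2 does not
        exceed q1, and that term is already attained.\<close>
      then show ?thesis using S q A(2) e(2) by linarith
    qed
    then show ?thesis using A x1(2) e(2) by linarith
  qed
  ultimately show ?thesis unfolding tr P by linarith
qed

lemma P_fun_scaled:
  assumes "0 < \<rho>"
  shows "\<rho> * P_fun v (q1 / \<rho>, q2 / \<rho>) =
    Max {q1 - \<rho> * length v, q2 - \<rho> * length (alpha v), \<rho> * length v}"
proof -
  have "\<rho> * max a (max b c) = max (\<rho> * a) (max (\<rho> * b) (\<rho> * c))" for a b c
    using assms by (simp add: max_mult_distrib_left)
  then show ?thesis using assms by (simp add: P_fun_def right_diff_distrib)
qed

lemma ln_abs_bounds:
  fixes y c e :: real
  assumes "0 < c" "0 < e"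
  shows "y \<noteq> 0 \<Longrightarrow> \<bar>y\<bar> \<le> c * e \<Longrightarrow> ln \<bar>y\<bar> \<le> ln c + ln e"
    and "e \<le> c * \<bar>y\<bar> \<Longrightarrow> y \<noteq> 0 \<and> ln e - ln c \<le> ln \<bar>y\<bar>"
proof -
  show "ln \<bar>y\<bar> \<le> ln c + ln e" if "y \<noteq> 0" "\<bar>y\<bar> \<le> c * e"
    using ln_mono[OF that(2)] that assms by (simp add: ln_mult)
  assume a: "e \<le> c * \<bar>y\<bar>"
  then have "y \<noteq> 0" using assms by auto
  then show "y \<noteq> 0 \<and> ln e - ln c \<le> ln \<bar>y\<bar>"
    using ln_mono[OF a] assms by (simp add: ln_mult)
qed

context asymptotic
begin

definition pt :: "nat \<Rightarrow> real^3" where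
  "pt n = vector [real_of_int (p n), real_of_int (r n), real_of_int (z n)]"

lemma x_point_pre:
  assumes "n \<in> level_set (d0 + 3)"
  shows "x_point m \<xi> W (pre n) = pt n"
  unfolding pt_def
proof (rule x_mat_pre)
  have "theta_ok n" by (rule theta_ok_level_set[OF order_refl assms])
  then have "\<bar>\<theta> n\<bar> \<le> 1 / 8" using theta_small[OF _ assms] by simp
  then show "\<bar>real_of_int (r n) * \<xi> - real_of_int (z n)\<bar> < 1 / 2" by (simp add: \<theta>_def)
qed

lemma pt_det3: "det3 (pt a) (pt n) (pt b) = real_of_int (D a n b)"
  by (simp add: det3_def pt_def D_def vector_3)

lemma independence:
  assumes d: "d0 \<le> d" and c: "consec (level_set (d + 3)) a n" "consec (level_set (d + 3)) n b"
  shows "lin_indep3 (pt a) (pt n) (pt b) \<longleftrightarrow> n \<notin> level_set (d + 4)"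
proof
  assume "n \<notin> level_set (d + 4)"
  then have "D a n b \<noteq> 0" using det_level_set[OF d c] by auto
  then show "lin_indep3 (pt a) (pt n) (pt b)" by (intro lin_indep3_if_det3) (simp add: pt_det3)
next
  assume l: "lin_indep3 (pt a) (pt n) (pt b)"
  show "n \<notin> level_set (d + 4)"
  proof
    assume n: "n \<in> level_set (d + 4)"
    have "lin_rel a n b"
      using equal_gap_relation[OF d c n] theta_ok_level_set[OF d] consecD[OF c(1)] by blast
    then obtain t s where "p b = t * p n + s * p a" "r b = t * r n + s * r a" "z b = t * z n + s * z a"
      unfolding lin_rel_def by blast
    then have "pt b = real_of_int t *\<^sub>R pt n + real_of_int s *\<^sub>R pt a"
      by (simp add: pt_def vec_eq_iff forall_3 vector_3)
    then show False using not_lin_indep3_if_comb l by blast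
  qed
qed

text \<open>The sum of K and the logarithms of the constants in the bounds for x_0 \<xi> - x_1 and
  x_0 \<xi>^2 - x_2. Each summand is nonnegative, so the sum dominates every one of them.\<close>

definition C0 :: real where
  "C0 = K + ln (k * B) + ln (2 * k ^ 4) + ln (\<bar>\<xi>\<bar> * (k * B) + T * k) + ln (2 * k)"

lemma trajectory_estimate:
  assumes n: "n \<in> level_set (d0 + 3)" and q: "q2 \<le> q1"
  shows "\<bar>trajectory \<xi> (pt n) (q1, q2) - \<rho> * P_fun (pre n) (q1 / \<rho>, q2 / \<rho>)\<bar> \<le> C0"
proof -
  obtain j where j: "level n j" "d0 + 3 \<le> j" using n by (auto simp: level_set_def)
  define N where "N = fib_len j"
  have Nn: "N \<le> n" using level_ge[OF j(1)] by (simp add: N_def)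
  have NL: "N \<in> level_set (d0 + 3)" unfolding N_def using j by (intro fib_len_in_level_set) auto
  have len_alpha: "length (alpha (pre n)) = N" by (simp add: alpha_level[OF j(1)] length_fib_word N_def)
  define y where "y = pt n $ 1 * \<xi> - pt n $ 2"
  define f where "f = pt n $ 1 * \<xi>\<^sup>2 - pt n $ 3"
  let ?p = "\<bar>real_of_int (p n)\<bar>"
  note pb = p_bounds[OF n]
  have yh: "y = p n * h n" using pb(1) by (simp add: y_def pt_def h_def field_simps)
  \<comment> \<open>x_0 \<xi>^2 - x_2 splits as \<xi> (x_0 \<xi> - x_1) + (x_1 \<xi> - x_2), whose
    parts are of order at most 1 / E n and 1 / E N.\<close>
  have fy: "f = \<xi> * y + \<theta> n"
    by (simp add: f_def y_def pt_def \<theta>_def vector_3 power2_eq_square algebra_simps)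
  have k: "0 < k" "1 \<le> k" using k1 by auto
  have E: "0 < E n" "0 < 1 / E n" "0 < 1 / E N" by auto
  have ln: "1 \<le> k * B" "1 \<le> 2 * k ^ 4" "1 \<le> \<bar>\<xi>\<bar> * (k * B) + T * k" "1 \<le> 2 * k"
  proof -
    have "1 \<le> k ^ 3" "1 \<le> k ^ 4" using k by (auto intro: one_le_power)
    moreover have "0 \<le> K * k ^ 2" using K by simp
    ultimately have B1: "1 \<le> B" unfolding B_def by linarith
    show "1 \<le> k * B" using mult_mono[of 1 k 1 B] k B1 by simp
    show "1 \<le> 2 * k ^ 4" using \<open>1 \<le> k ^ 4\<close> by linarith
    have "1 \<le> T * k" using mult_mono[of 1 T 1 k] k T3 by simp
    moreover have "0 \<le> \<bar>\<xi>\<bar> * (k * B)" using k B1 by simp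
    ultimately show "1 \<le> \<bar>\<xi>\<bar> * (k * B) + T * k" by linarith
    show "1 \<le> 2 * k" using k by linarith
  qed
  have yu: "\<bar>y\<bar> \<le> (k * B) * (1 / E n)"
  proof -
    have "\<bar>y\<bar> \<le> (k * E n) * (B / (E n)\<^sup>2)"
      unfolding yh abs_mult using pb h_upper[OF n] k by (intro mult_mono) auto
    then show ?thesis by (simp add: power2_eq_square)
  qed
  have yl: "1 / E n \<le> (2 * k ^ 4) * \<bar>y\<bar>"
  proof -
    have "E n * (1 / (2 * k ^ 3 * (E n)\<^sup>2)) \<le> (k * ?p) * \<bar>h n\<bar>"
      using pb h_lower[OF n] k by (intro mult_mono) auto
    then have "(2 * k ^ 3) * (E n * (1 / (2 * k ^ 3 * (E n)\<^sup>2))) \<le> (2 * k ^ 3) * ((k * ?p) * \<bar>h n\<bar>)"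
      using k by (intro mult_left_mono) auto
    moreover have "(2 * k ^ 3) * (E n * (1 / (2 * k ^ 3 * (E n)\<^sup>2))) = 1 / E n"
      using k by (simp add: power2_eq_square)
    moreover have "(2 * k ^ 3) * ((k * ?p) * \<bar>h n\<bar>) = (2 * k ^ 4) * \<bar>y\<bar>"
      unfolding yh abs_mult by (simp add: power4_eq_xxxx power3_eq_cube)
    ultimately show ?thesis by simp
  qed
  let ?x = "\<bar>real_of_int (x0 j)\<bar>"
  have xb: "0 < ?x" "?x \<le> k * E N" "E N \<le> k * ?x" using x0_bounds[of j] j by (auto simp: N_def)
  have th: "\<bar>\<theta> n\<bar> \<le> (T * k) * (1 / E N)"
  proof -
    have "\<bar>\<theta> n\<bar> \<le> T / ?x" using theta_ok_level_set[OF order_refl n] j(1) by (simp add: theta_ok_def)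
    also have "\<dots> \<le> (T * k) * (1 / E N)" using xb T3 by (simp add: field_simps)
    finally show ?thesis .
  qed
  have ENn: "1 / E n \<le> 1 / E N" using E_mono[OF Nn] by (intro divide_left_mono) auto
  have xiy: "\<bar>\<xi> * y\<bar> \<le> \<bar>\<xi>\<bar> * (k * B) * (1 / E n)"
    unfolding abs_mult using yu mult_left_mono[of "\<bar>y\<bar>" "k * B * (1 / E n)" "\<bar>\<xi>\<bar>"] by simp
  have fu: "\<bar>f\<bar> \<le> (\<bar>\<xi>\<bar> * (k * B) + T * k) * (1 / E N)"
  proof -
    have "\<bar>\<xi>\<bar> * (k * B) * (1 / E n) \<le> \<bar>\<xi>\<bar> * (k * B) * (1 / E N)"
      using ENn k B_pos by (intro mult_left_mono) auto
    then have "\<bar>f\<bar> \<le> \<bar>\<xi>\<bar> * (k * B) * (1 / E N) + (T * k) * (1 / E N)"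
      unfolding fy using xiy th by linarith
    then show ?thesis by (simp only: distrib_right)
  qed
  \<comment> \<open>Here the determinant bounds \<theta> n from below by a multiple of 1 / E N.
    Since n and N differ by at least one gap, \<xi> y is at most half of that bound, so the two
    parts cannot cancel.\<close>
  have fl: "1 / E N \<le> (2 * k) * \<bar>f\<bar>" if Nn': "N < n"
  proof -
    obtain d where d: "j = d + 3" "d0 \<le> d" using j by (metis add.commute add_le_cancel_left le_Suc_ex add.assoc)
    have nL: "n \<in> level_set (d + 3)" "n \<notin> level_set (d + 4)"
      using j(1) level_set_level_ge[OF j(1), of "d + 4"] unfolding d by (auto simp: level_set_def)
    have "N \<in> level_set (d + 3)" unfolding N_def d by (rule fib_len_in_level_set) auto
    then obtain a where a: "consec (level_set (d + 3)) a n" using consec_prev[OF nL(1)] Nn' by blast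
    obtain b where b: "consec (level_set (d + 3)) n b" using consec_next nL by blast
    have ab: "a \<in> level_set (d + 3)" "b \<in> level_set (d + 3)" using consecD[OF a] consecD[OF b] by auto
    have "1 \<le> \<bar>\<theta> n\<bar> * ?x"
      using theta_from_det(2)[OF d(2) a b nL(2) _ _ det_level_set[OF d(2) a b nL(2)]]
        theta_ok_level_set[OF d(2)] ab unfolding d by blast
    also have "\<dots> \<le> \<bar>\<theta> n\<bar> * (k * E N)" using xb by (intro mult_left_mono) auto
    finally have t: "1 / E N \<le> k * \<bar>\<theta> n\<bar>" by (simp add: field_simps)
    have "2 * \<bar>\<xi>\<bar> * k ^ 2 * B * E N \<le> E n" by (rule E_gap(2)[OF NL n Nn'])
    then have lead: "2 * \<bar>\<xi>\<bar> * k ^ 2 * B * (1 / E n) \<le> 1 / E N" by (simp add: field_simps)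
    have "k * \<bar>\<xi> * y\<bar> \<le> k * (\<bar>\<xi>\<bar> * (k * B) * (1 / E n))"
      using k by (intro mult_left_mono xiy) auto
    also have "\<dots> = (2 * \<bar>\<xi>\<bar> * k ^ 2 * B * (1 / E n)) / 2" by (simp add: power2_eq_square)
    also have "\<dots> \<le> (1 / E N) / 2" by (rule divide_right_mono[OF lead]) simp
    finally have xi_half: "k * \<bar>\<xi> * y\<bar> \<le> (1 / E N) / 2" .
    have split: "k * \<bar>\<theta> n\<bar> \<le> k * \<bar>f\<bar> + k * \<bar>\<xi> * y\<bar>"
    proof -
      have "\<bar>\<theta> n\<bar> \<le> \<bar>f\<bar> + \<bar>\<xi> * y\<bar>" unfolding fy by linarith
      then have "k * \<bar>\<theta> n\<bar> \<le> k * (\<bar>f\<bar> + \<bar>\<xi> * y\<bar>)" using k by (intro mult_left_mono) auto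
      then show ?thesis by (simp only: distrib_left)
    qed
    have "u \<le> 2 * w" if "c \<le> u / 2" "s \<le> w + c" "u \<le> s" for u w c s :: real
      using that by linarith
    from this[OF xi_half split t] show ?thesis by (simp only: mult.assoc)
  qed
  have lnE: "ln (1 / E n) = - \<rho> * n" "ln (1 / E N) = - \<rho> * N" by (simp_all add: E_def ln_div)
  have l0: "0 \<le> ln (k * B)" "0 \<le> ln (2 * k ^ 4)" "0 \<le> ln (\<bar>\<xi>\<bar> * (k * B) + T * k)" "0 \<le> ln (2 * k)"
    using ln by auto
  have kB: "0 < k * B" "0 < 2 * k ^ 4" "0 < \<bar>\<xi>\<bar> * (k * B) + T * k" "0 < 2 * k" using ln by linarith+
  note y2 = ln_abs_bounds(2)[OF kB(2) E(2) yl]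
  note y1 = ln_abs_bounds(1)[OF kB(1) E(2) conjunct1[OF y2] yu]
  have zp: "\<bar>ln ?p - \<rho> * n\<bar> \<le> K"
    using level_set_imp_zeck[OF n d0] p_ln by blast
  have "\<bar>trajectory \<xi> (pt n) (q1, q2) - Max {q1 - \<rho> * n, q2 - \<rho> * N, \<rho> * n}\<bar> \<le> C0"
  proof (rule trajectory_bound, fold y_def f_def)
    show "pt n $ 1 \<noteq> 0" using pb(1) by (simp add: pt_def)
    show "\<bar>ln \<bar>pt n $ 1\<bar> - \<rho> * n\<bar> \<le> C0" using zp l0 by (simp add: pt_def C0_def)
    show "y \<noteq> 0" using y2 by blast
    show "\<bar>ln \<bar>y\<bar> + \<rho> * n\<bar> \<le> C0" using y1 y2 l0 K unfolding lnE C0_def by linarith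
    show "ln \<bar>f\<bar> \<le> C0 - \<rho> * N" if "f \<noteq> 0"
      using ln_abs_bounds(1)[OF kB(3) E(3) that fu] l0 K unfolding lnE C0_def by linarith
    show "f \<noteq> 0 \<and> - (\<rho> * N) - C0 \<le> ln \<bar>f\<bar>" if "\<rho> * N < \<rho> * n"
    proof -
      have "N < n" using that rho by simp
      from ln_abs_bounds(2)[OF kB(4) E(3) fl[OF this]] show ?thesis
        using l0 K unfolding lnE C0_def by linarith
    qed
    show "\<rho> * N \<le> \<rho> * n" using Nn rho by simp
  qed (rule q)
  then show ?thesis unfolding P_fun_scaled[OF rho] len_alpha length_pre .
qed

lemma consecutive_V_set:
  assumes "consecutive (V_set l) u v w" "1 \<le> l"
  obtains a n b where "u = pre a" "v = pre n" "w = pre b" "consec (level_set l) a n" "consec (level_set l) n b"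
proof -
  obtain a n b where e: "u = pre a" "v = pre n" "w = pre b" "a \<in> level_set l" "n \<in> level_set l" "b \<in> level_set l"
    using assms by (auto simp: consecutive_def V_set_eq)
  have "consec (level_set l) a n" "consec (level_set l) n b"
    using assms(1) e(4-6) unfolding consecutive_def V_set_eq[OF assms(2)] e(1-3) consec_def
    by (auto simp: strict_prefix_pre_iff)
  then show ?thesis using that e by blast
qed

lemma estimate_and_independence:
  assumes "d0 + 3 \<le> l"
  shows "(\<forall>v\<in>V_set l. \<forall>(q1, q2)\<in>A_empty.
       \<bar>trajectory \<xi> (x_point m \<xi> W v) (q1, q2) - \<rho> * P_fun v (q1 / \<rho>, q2 / \<rho>)\<bar> \<le> C0) \<and>
    (\<forall>u v w. consecutive (V_set l) u v w \<longrightarrow>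
       (lin_indep3 (x_point m \<xi> W u) (x_point m \<xi> W v) (x_point m \<xi> W w) \<longleftrightarrow> v \<notin> V_set (l + 1)))"
proof (intro conjI ballI allI impI)
  have l1: "1 \<le> l" using assms by simp
  have sub: "level_set l \<subseteq> level_set (d0 + 3)" by (rule level_set_antimono[OF assms])
  show "case q of (q1, q2) \<Rightarrow>
      \<bar>trajectory \<xi> (x_point m \<xi> W v) (q1, q2) - \<rho> * P_fun v (q1 / \<rho>, q2 / \<rho>)\<bar> \<le> C0"
    if v: "v \<in> V_set l" and q: "q \<in> A_empty" for v q
  proof -
    obtain n where n: "v = pre n" "n \<in> level_set (d0 + 3)" using v sub unfolding V_set_eq[OF l1] by blast
    obtain q1 q2 where "q = (q1, q2)" "q2 \<le> q1" using q by (auto simp: A_empty_def)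
    then show ?thesis using trajectory_estimate[OF n(2)] x_point_pre[OF n(2)] n(1) by simp
  qed
  fix u v w assume "consecutive (V_set l) u v w"
  then obtain a n b where e: "u = pre a" "v = pre n" "w = pre b"
    and c: "consec (level_set l) a n" "consec (level_set l) n b" using consecutive_V_set l1 by blast
  obtain d where d: "l = d + 3" "d0 \<le> d" using assms that[of "l - 3"] by simp
  have pts: "x_point m \<xi> W u = pt a" "x_point m \<xi> W v = pt n" "x_point m \<xi> W w = pt b"
    unfolding e using consecD[OF c(1)] consecD[OF c(2)] sub by (auto intro: x_point_pre)
  have "inj pre" by (metis injI length_pre)
  then have vn: "v \<in> V_set (l + 1) \<longleftrightarrow> n \<in> level_set (l + 1)"
    unfolding e by (subst V_set_eq) (auto simp: inj_image_mem_iff)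
  have l4: "l + 1 = d + 4" using d by simp
  show "lin_indep3 (x_point m \<xi> W u) (x_point m \<xi> W v) (x_point m \<xi> W w) \<longleftrightarrow> v \<notin> V_set (l + 1)"
    unfolding pts vn unfolding l4 by (rule independence[OF d(2) c[unfolded d(1)]])
qed

end

theorem theorem3p4:
  fixes m :: int and \<xi> :: real and W :: "nat \<Rightarrow> int^2^2"
  assumes "m \<ge> 1" and "admissible_seq m \<xi> W"
  shows "\<exists>(l0::nat) (\<rho>::real) (C::real). l0 \<ge> 4 \<and> \<rho> > 0 \<and> (\<forall>l\<ge>l0.
    (\<forall>v\<in>V_set l. \<forall>(q1, q2)\<in>A_empty.
       \<bar>trajectory \<xi> (x_point m \<xi> W v) (q1, q2) - \<rho> * P_fun v (q1 / \<rho>, q2 / \<rho>)\<bar> \<le> C) \<and>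
    (\<forall>u v w. consecutive (V_set l) u v w \<longrightarrow>
       (lin_indep3 (x_point m \<xi> W u) (x_point m \<xi> W v) (x_point m \<xi> W w) \<longleftrightarrow> v \<notin> V_set (l + 1))))"
proof -
  interpret admissible m \<xi> W using assms by unfold_locales
  obtain \<rho> K :: real and d :: nat where a: "0 < \<rho>" "1 \<le> d" "0 < K"
    "\<And>i n. zeck d i n \<Longrightarrow> p n \<noteq> 0 \<and> \<bar>ln \<bar>real_of_int (p n)\<bar> - \<rho> * real n\<bar> \<le> K"
    "\<And>i. d \<le> i \<Longrightarrow> x0 i \<noteq> 0 \<and> \<bar>ln \<bar>real_of_int (x0 i)\<bar> - \<rho> * real (fib_len i)\<bar> \<le> K \<and>
      \<bar>x0 i * \<xi> - x1 i\<bar> \<le> K / \<bar>real_of_int (x0 i)\<bar> \<and> \<bar>x1 i * \<xi> - x2 i\<bar> \<le> K / \<bar>real_of_int (x0 i)\<bar>"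
    by (rule asymptotics) blast
  \<comment> \<open>The threshold depends on K but not on the starting index, so K and \<rho> stay
    fixed while the index is raised: digits of index at least \<open>d0\<close> are in particular of
    index at least \<open>d\<close>.\<close>
  define H where "H = 2 * (4 * (m + 1) * (K + 3) * exp K ^ 2 + (2 * exp K ^ 3 + K * exp K ^ 2) * exp K ^ 3
      + \<bar>\<xi>\<bar> * exp K ^ 2 * (2 * exp K ^ 3 + K * exp K ^ 2) + 1)"
  obtain e :: nat where "H / \<rho> \<le> real e" using real_arch_simple by blast
  then have e: "H \<le> \<rho> * real e" using a(1) by (simp add: divide_le_eq mult.commute)
  define d0 where "d0 = d + e"
  have "H \<le> \<rho> * real (fib_len d0)"
  proof -
    have "real e \<le> real (fib_len d0)" using fib_len_ge[of d0] by (simp add: d0_def)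
    then show ?thesis using e mult_left_mono[of "real e" "real (fib_len d0)" \<rho>] a(1) by linarith
  qed
  then have H: "H \<le> exp (\<rho> * real (fib_len d0))"
    using exp_ge_add_one_self[of "\<rho> * real (fib_len d0)"] by linarith
  interpret asymptotic m \<xi> W \<rho> K d0
  proof unfold_locales
    show "1 \<le> d0" using a(2) by (simp add: d0_def)
    show "p n \<noteq> 0 \<and> \<bar>ln \<bar>real_of_int (p n)\<bar> - \<rho> * real n\<bar> \<le> K" if "zeck d0 i n" for i n
      using a(4) zeck_mono[OF that, of d] by (simp add: d0_def)
  qed (use a(1,3,5) H in \<open>auto simp: d0_def H_def\<close>)
  show ?thesis
    using estimate_and_independence a(1) a(2) by (intro exI[of _ "d0 + 3"] exI[of _ \<rho>] exI[of _ C0]) (auto simp: d0_def)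
qed

end
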